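(* Let $\tau,\eta\in\mathbb{C}$ with $\mathrm{Im}(\tau)>0$, $\mathrm{Im}(\eta)>0$, and with $j\tau-4\eta\notin\mathbb{Z}$ for every positive integer $j$ (so that the cycle $\gamma$ below exists). For $\lambda\in\mathbb{C}$ define $$\widetilde{I}(\lambda;\tau,\eta) := e^{-3\pi i\lambda}\int_\gamma \frac{\Gamma(t-2\eta;\tau,8\eta)}{\Gamma(t+2\eta;\tau,8\eta)}\,\frac{\theta_0(t+\lambda;\tau)}{\theta_0(t+2\eta;\tau)}\,\frac{\theta_0(t-4\eta;8\eta)}{\theta_0(t+2\eta;8\eta)}\,\theta_0(2t+6\tau-4\lambda+\tfrac12;8\tau)\,dt,$$ where $\gamma$ is the cycle described in the context, and set $I(\lambda;\tau,\eta):=\widetilde{I}(\lambda;\tau,\eta)-\widetilde{I}(-\lambda;\tau,\eta)$. Then $$I(\lambda;\tau,\eta)= e^{-12\pi i\eta}\,\frac{\Gamma(6\eta;\tau,8\eta)}{\Gamma(2\eta;\tau,8\eta)}\,\frac{1}{(8\tau;8\tau)\,\theta_0(-4\eta;\tau)}\,\frac{1}{(4\eta;4\eta)\,(2\eta+\tfrac12;2\eta)}\;e^{-3\pi i\lambda}\,\theta_0(\lambda;\tau)\,\theta_0(\lambda-2\eta;\tau)\,\theta_0(\lambda+2\eta;\tau).$$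
   Context: Additive notation is used. For $\mathrm{Im}(\tau),\mathrm{Im}(\sigma)>0$ and $z\in\mathbb{C}$: $(z;\tau):=\prod_{n\ge 0}(1-e^{2\pi i z+2\pi i\tau n})$; $\theta_0(z;\tau):=(z;\tau)(\tau-z;\tau)$; and the elliptic gamma function is $\Gamma(z;\tau,\sigma):=\prod_{n,m\ge0}\frac{1-e^{2\pi i(\tau+\sigma-z+n\tau+m\sigma)}}{1-e^{2\pi i (z+n\tau+m\sigma)}}$. The integrand is $1$-periodic in $t$ and its poles lie in the two families $2\eta-j\tau-8k\eta+\mathbb{Z}$ and $-2\eta+j\tau+8k\eta+\mathbb{Z}$ with $j,k\in\mathbb{Z}_{\ge0}$. The cycle $\gamma$ travels from $-\tfrac12$ to $\tfrac12$ (a closed cycle on $\mathbb{C}/\mathbb{Z}$), lies above the pole at $t=2\eta$ and below the pole at $t=-2\eta$, and separates the other poles, so that the whole first family lies below $\gamma$ and the whole second family lies above $\gamma$. *)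

theory Defs
  imports "HOL-Complex_Analysis.Complex_Analysis"
begin

definition e2pi :: "complex \<Rightarrow> complex" where
  "e2pi z = exp (2 * of_real pi * \<i> * z)"

text \<open>The infinite product \<open>(z; \<tau>)\<close> in additive notation.\<close>

definition qprod :: "complex \<Rightarrow> complex \<Rightarrow> complex" where
  "qprod z \<tau> = (\<Prod>n. 1 - e2pi (z + of_nat n * \<tau>))"

definition theta0 :: "complex \<Rightarrow> complex \<Rightarrow> complex" where
  "theta0 z \<tau> = qprod z \<tau> * qprod (\<tau> - z) \<tau>"

text \<open>The elliptic gamma function \<open>\<Gamma>(z; \<tau>, \<sigma>)\<close>.  The double product converges absolutely,
  so it is written as an iterated one.  At a pole of the elliptic gamma function one denominator
  vanishes and the value is \<open>0\<close>; its reciprocal is then also \<open>0\<close>, which is the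
  value of the meromorphic function \<open>1 / \<Gamma>\<close> there.\<close>

definition ell_Gamma :: "complex \<Rightarrow> complex \<Rightarrow> complex \<Rightarrow> complex" where
  "ell_Gamma z \<tau> \<sigma> =
     (\<Prod>n. \<Prod>m. (1 - e2pi (\<tau> + \<sigma> - z + of_nat n * \<tau> + of_nat m * \<sigma>)) /
               (1 - e2pi (z + of_nat n * \<tau> + of_nat m * \<sigma>)))"

text \<open>At the removable singularities of the integrand (points \<open>-2\<eta> - j\<tau>\<close> and \<open>-2\<eta> - 8j\<eta>\<close> modulo
  \<open>\<int>\<close> with \<open>j > 0\<close>, where a zero of a theta function in a denominator is cancelled by a zero
  of \<open>1 / \<Gamma>(t + 2\<eta>)\<close>) the expression below evaluates to \<open>0\<close>.  This does not affect integrals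
  along piecewise \<open>C\<^sup>1\<close> paths: the parameters at which such a path is at one of these points with
  nonzero derivative form a countable set.\<close>

definition integrand :: "complex \<Rightarrow> complex \<Rightarrow> complex \<Rightarrow> complex \<Rightarrow> complex" where
  "integrand \<tau> \<eta> l t =
     ell_Gamma (t - 2 * \<eta>) \<tau> (8 * \<eta>) / ell_Gamma (t + 2 * \<eta>) \<tau> (8 * \<eta>) *
     (theta0 (t + l) \<tau> / theta0 (t + 2 * \<eta>) \<tau>) *
     (theta0 (t - 4 * \<eta>) (8 * \<eta>) / theta0 (t + 2 * \<eta>) (8 * \<eta>)) *
     theta0 (2 * t + 6 * \<tau> - 4 * l + 1 / 2) (8 * \<tau>)"

definition first_poles :: "complex \<Rightarrow> complex \<Rightarrow> complex set" where
  "first_poles \<tau> \<eta> =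
     {2 * \<eta> - of_nat j * \<tau> - 8 * of_nat k * \<eta> + of_int m | (j :: nat) (k :: nat) (m :: int). True}"

definition second_poles :: "complex \<Rightarrow> complex \<Rightarrow> complex set" where
  "second_poles \<tau> \<eta> =
     {- 2 * \<eta> + of_nat j * \<tau> + 8 * of_nat k * \<eta> + of_int m | (j :: nat) (k :: nat) (m :: int). True}"

text \<open>A path from \<open>-1/2\<close> to \<open>1/2\<close> is a closed cycle on the cylinder \<open>\<complex>/\<int>\<close>, winding around it once.
  The map \<open>e2pi\<close> identifies the cylinder with \<open>\<complex> - {0}\<close>, its upper end \<open>Im t = +\<infinity>\<close> with \<open>0\<close>, its
  lower end \<open>Im t = -\<infinity>\<close> with infinity, and the cycle with a loop of winding number 1 about
  \<open>0\<close>.  Hence a point lies above the cycle iff the loop winds once around its image, and below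
  the cycle iff the loop does not wind around its image.\<close>

definition above_cycle :: "(real \<Rightarrow> complex) \<Rightarrow> complex \<Rightarrow> bool" where
  "above_cycle \<gamma> p \<longleftrightarrow>
     e2pi p \<notin> path_image (e2pi \<circ> \<gamma>) \<and> winding_number (e2pi \<circ> \<gamma>) (e2pi p) = 1"

definition below_cycle :: "(real \<Rightarrow> complex) \<Rightarrow> complex \<Rightarrow> bool" where
  "below_cycle \<gamma> p \<longleftrightarrow>
     e2pi p \<notin> path_image (e2pi \<circ> \<gamma>) \<and> winding_number (e2pi \<circ> \<gamma>) (e2pi p) = 0"

definition separating_cycle :: "complex \<Rightarrow> complex \<Rightarrow> (real \<Rightarrow> complex) \<Rightarrow> bool" where
  "separating_cycle \<tau> \<eta> \<gamma> \<longleftrightarrow>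
     valid_path \<gamma> \<and> pathstart \<gamma> = - 1 / 2 \<and> pathfinish \<gamma> = 1 / 2 \<and>
     (\<forall>p\<in>first_poles \<tau> \<eta>. below_cycle \<gamma> p) \<and>
     (\<forall>p\<in>second_poles \<tau> \<eta>. above_cycle \<gamma> p)"

definition I_tilde :: "(real \<Rightarrow> complex) \<Rightarrow> complex \<Rightarrow> complex \<Rightarrow> complex \<Rightarrow> complex" where
  "I_tilde \<gamma> l \<tau> \<eta> =
     exp (- 3 * of_real pi * \<i> * l) * contour_integral \<gamma> (integrand \<tau> \<eta> l)"

definition I_anti :: "(real \<Rightarrow> complex) \<Rightarrow> complex \<Rightarrow> complex \<Rightarrow> complex \<Rightarrow> complex" where
  "I_anti \<gamma> l \<tau> \<eta> = I_tilde \<gamma> l \<tau> \<eta> - I_tilde \<gamma> (- l) \<tau> \<eta>"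

end

theory Submission
  imports Defs
begin

text \<open>Put \<open>x = e2pi t\<close>, \<open>z = e2pi l\<close>, \<open>a = e2pi (2 * \<eta>)\<close>, \<open>p = e2pi \<tau>\<close>, \<open>P = p\<^sup>2\<close>, \<open>q = a ^ 4\<close>. The
  integrand is a weight \<open>w x\<close>, even under \<open>x \<mapsto> 1 / x\<close>, times \<open>theta (x * z) p\<close> and a theta function of
  nome \<open>p ^ 8\<close>. Inverting the cycle in the second integral of the antisymmetrization and adding the two
  theta functions of nome \<open>p ^ 8\<close> by a 2-dissection produces the integral \<open>F z\<close> of
  \<open>w x * theta (x * z) p * theta (- z\<^sup>2 / x) P\<close>. As a function of \<open>z\<close> it is a theta function of degree
  three which is odd under inversion, and it vanishes at \<open>z = a\<close> because there the symmetrized integrand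
  is a sum \<open>g x + g (1 / x)\<close> with \<open>g (q * x) = - g (1 / x)\<close>. Hence it is a multiple of
  \<open>theta z p * theta (z / a) p * theta (z * a) p\<close>.

  The multiple is found at \<open>z = -1\<close>. The same telescoping identity expresses \<open>F (-1)\<close> by a value of an elliptic
  beta integral with one free parameter \<open>t\<close>. For \<open>norm p < norm (a\<^sup>2)\<close> that integral, divided by a product
  of elliptic gamma functions, is \<open>q\<close>-periodic and holomorphic in an annulus, hence constant by the maximum
  modulus principle, and at \<open>t = - a\<^sup>2\<close> it reduces to a quotient of two theta functions. The
  remaining values of \<open>p\<close> follow by analytic continuation in \<open>p\<close>, since a separating cycle exists as long
  as \<open>p ^ j \<noteq> a\<^sup>2\<close> for all \<open>j > 0\<close> and stays separating under small changes of \<open>p\<close>.\<close>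

section \<open>Infinite products\<close>

text \<open>The integral comes without a free parameter. Squaring the nome creates one:
  \<open>egamma_split\<close> turns the gamma factors of nome \<open>p\<close> into factors of nome
  \<open>P\<close> with parameters \<open>t = 1 / a\<close> and \<open>s = p / a\<close>, which
  satisfy \<open>t * s * b = p\<close> for \<open>b = a^2\<close>. Under this balancing condition
  \<open>H t s\<close> has the multiplier of the functions \<open>tau u\<close>, two of which
  generically span, so the vanishing integral of \<open>weight * H\<close> becomes a linear relation
  between two integrals. With \<open>u = t\<close>, \<open>v = s\<close> it moves a factor
  \<open>q\<close> from one parameter to the other; with \<open>u = 1 / a\<close>,
  \<open>v = - 1\<close> it reaches \<open>F (- 1)\<close>. The point \<open>- 1\<close> is singled
  out because \<open>Phi (- 1)\<close> equals \<open>tau (- 1)\<close>. The size of \<open>p\<close>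
  shapes the rest. Both parameters \<open>t\<close> and \<open>b * p / t\<close> of the beta
  integral must lie in the unit disc, and the annulus of such \<open>t\<close> contains a full
  period of ratio \<open>norm q\<close> only if \<open>norm p < norm b\<close>. For the parameter
  \<open>1 / a\<close>, of norm greater than 1, the unit circle does not even separate the poles.
  Cycles are therefore handled through winding numbers alone, which makes integrals independent of
  the chosen cycle and allows continuation in \<open>p\<close> without any formula for it.\<close>

lemma uniform_limit_prodinf_M_test:
  fixes f :: "nat \<Rightarrow> 'a::topological_space \<Rightarrow> complex"
  assumes K: "compact K" and cont: "\<And>n. continuous_on K (f n)"
    and M: "summable M" and le: "\<And>n x. x \<in> K \<Longrightarrow> norm (f n x - 1) \<le> M n"
  shows "uniform_limit K (\<lambda>N x. \<Prod>n<N. f n x) (\<lambda>x. \<Prod>n. f n x) sequentially"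
proof -
  have "uniformly_convergent_on K (\<lambda>N x. \<Sum>n<N. norm (f n x - 1))"
    by (rule Weierstrass_m_test'[OF _ M]) (use le in auto)
  then have "uniformly_convergent_on K (\<lambda>N x. \<Prod>n<N. f n x)"
    by (intro uniformly_convergent_on_prod' cont K)
  then obtain g where g: "uniform_limit K (\<lambda>N x. \<Prod>n<N. f n x) g sequentially"
    by (auto simp: uniformly_convergent_on_def)
  have "g x = (\<Prod>n. f n x)" if x: "x \<in> K" for x
  proof -
    have "summable (\<lambda>n. norm (f n x - 1))"
      by (rule summable_comparison_test[OF _ M]) (use le x in auto)
    then have "convergent_prod (\<lambda>n. f n x)"
      by (simp add: abs_convergent_prod_conv_summable abs_convergent_prod_imp_convergent_prod)
    then have "(\<lambda>N. \<Prod>n\<le>N. f n x) \<longlonglongrightarrow> (\<Prod>n. f n x)"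
      by (rule convergent_prod_LIMSEQ)
    then have "(\<lambda>N. \<Prod>n<N. f n x) \<longlonglongrightarrow> (\<Prod>n. f n x)"
      by (simp add: LIMSEQ_lessThan_iff_atMost)
    moreover have "(\<lambda>N. \<Prod>n<N. f n x) \<longlonglongrightarrow> g x"
      by (rule tendsto_uniform_limitI[OF g x])
    ultimately show ?thesis
      by (rule LIMSEQ_unique[symmetric])
  qed
  then show ?thesis
    using g by (subst uniform_limit_cong'[where g = "\<lambda>N x. \<Prod>n<N. f n x" and i = g]) auto
qed

text \<open>The domain is a general Hausdorff space so that products depending jointly on an
  argument and a nome are covered; uniform convergence on a neighbourhood \<open>K\<close> of each
  point is enough.\<close>

lemma continuous_on_prodinf:
  fixes f :: "nat \<Rightarrow> 'a::t2_space \<Rightarrow> complex"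
  assumes cont: "\<And>n. continuous_on S (f n)"
    and loc: "\<And>x. x \<in> S \<Longrightarrow> \<exists>K M. compact K \<and> K \<subseteq> S \<and> x \<in> interior K \<and> summable M \<and>
                (\<forall>n. \<forall>y\<in>K. norm (f n y - 1) \<le> M n)"
  shows "continuous_on S (\<lambda>x. \<Prod>n. f n x)"
proof -
  have "isCont (\<lambda>x. \<Prod>n. f n x) x" if x: "x \<in> S" for x
  proof -
    obtain K M where K: "compact K" "K \<subseteq> S" "x \<in> interior K" "summable M"
      "\<And>n y. y \<in> K \<Longrightarrow> norm (f n y - 1) \<le> M n"
      using loc[OF x] by blast
    have contK: "continuous_on K (f n)" for n
      using cont K(2) by (rule continuous_on_subset)
    have "continuous_on K (\<lambda>x. \<Prod>n. f n x)"
      by (rule uniform_limit_theorem[OF _ uniform_limit_prodinf_M_test[OF K(1) contK K(4,5)]])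
         (auto intro!: always_eventually continuous_intros contK)
    then show ?thesis
      using K(3) by (rule continuous_on_interior)
  qed
  then show ?thesis
    by (rule continuous_at_imp_continuous_on[rule_format])
qed

lemma holomorphic_on_prodinf:
  fixes f :: "nat \<Rightarrow> complex \<Rightarrow> complex"
  assumes S: "open S" and hol: "\<And>n. f n holomorphic_on S"
    and loc: "\<And>K. compact K \<Longrightarrow> K \<subseteq> S \<Longrightarrow> \<exists>M. summable M \<and>
                (\<forall>n. \<forall>y\<in>K. norm (f n y - 1) \<le> M n)"
  shows "(\<lambda>x. \<Prod>n. f n x) holomorphic_on S"
proof (rule holomorphic_uniform_sequence[OF S])
  show "(\<lambda>x. \<Prod>n<N. f n x) holomorphic_on S" for N
    by (intro holomorphic_intros hol)
  fix x assume "x \<in> S"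
  then obtain d where d: "d > 0" "cball x d \<subseteq> S"
    using S open_contains_cball by blast
  obtain M where M: "summable M" "\<And>n y. y \<in> cball x d \<Longrightarrow> norm (f n y - 1) \<le> M n"
    using loc[OF compact_cball d(2)] by blast
  have "continuous_on (cball x d) (f n)" for n
    using hol d(2) by (meson holomorphic_on_imp_continuous_on holomorphic_on_subset)
  then have "uniform_limit (cball x d) (\<lambda>N x. \<Prod>n<N. f n x) (\<lambda>x. \<Prod>n. f n x) sequentially"
    using M by (intro uniform_limit_prodinf_M_test compact_cball)
  then show "\<exists>d>0. cball x d \<subseteq> S \<and>
      uniform_limit (cball x d) (\<lambda>N x. \<Prod>n<N. f n x) (\<lambda>x. \<Prod>n. f n x) sequentially"
    using d by blast
qed

lemma compact_norm_bound:
  fixes f :: "'a::topological_space \<Rightarrow> complex"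
  assumes "compact K" "continuous_on K f"
  obtains R where "R \<ge> 0" "\<And>x. x \<in> K \<Longrightarrow> norm (f x) \<le> R"
proof -
  have "bounded (f ` K)"
    using assms by (simp add: compact_continuous_image compact_imp_bounded)
  then show ?thesis
    unfolding bounded_iff using that by (metis imageI norm_ge_zero order_trans le_cases)
qed

lemma compact_norm_bound_less_one:
  fixes f :: "'a::topological_space \<Rightarrow> complex"
  assumes "compact K" "continuous_on K f" "\<And>x. x \<in> K \<Longrightarrow> norm (f x) < 1"
  obtains r where "0 \<le> r" "r < 1" "\<And>x. x \<in> K \<Longrightarrow> norm (f x) \<le> r"
proof (cases "K = {}")
  case False
  obtain x where "x \<in> K" "\<And>y. y \<in> K \<Longrightarrow> norm (f y) \<le> norm (f x)"
    using continuous_attains_sup[OF assms(1) False continuous_on_norm[OF assms(2)]] by blast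
  then show ?thesis
    using that[of "norm (f x)"] assms(3) by simp
qed (use that[of 0] in auto)

section \<open>Multiplicative q-products, simple and double\<close>

definition qpoch :: "complex \<Rightarrow> complex \<Rightarrow> complex" where
  "qpoch x q = (\<Prod>n. 1 - x * q ^ n)"

definition theta :: "complex \<Rightarrow> complex \<Rightarrow> complex" where
  "theta x p = qpoch x p * qpoch (p / x) p"

definition qpoch2 :: "complex \<Rightarrow> complex \<Rightarrow> complex \<Rightarrow> complex" where
  "qpoch2 x p q = (\<Prod>n. qpoch (x * p ^ n) q)"

definition egamma :: "complex \<Rightarrow> complex \<Rightarrow> complex \<Rightarrow> complex" where
  "egamma x p q = qpoch2 (p * q / x) p q / qpoch2 x p q"

lemma qpoch_bound:
  fixes u v :: "'a::topological_space \<Rightarrow> complex"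
  assumes "compact K" "continuous_on K u" "continuous_on K v" "\<And>x. x \<in> K \<Longrightarrow> norm (v x) < 1"
  shows "\<exists>M. summable M \<and> (\<forall>n. \<forall>y\<in>K. norm (1 - u y * v y ^ n - 1) \<le> M n)"
proof -
  obtain R where R: "R \<ge> 0" "\<And>x. x \<in> K \<Longrightarrow> norm (u x) \<le> R"
    using compact_norm_bound[OF assms(1,2)] by blast
  obtain r where r: "0 \<le> r" "r < 1" "\<And>x. x \<in> K \<Longrightarrow> norm (v x) \<le> r"
    using compact_norm_bound_less_one[OF assms(1,3,4)] by blast
  have "summable (\<lambda>n. R * r ^ n)"
    using r by (intro summable_mult summable_geometric) auto
  moreover have "norm (1 - u y * v y ^ n - 1) \<le> R * r ^ n" if "y \<in> K" for n y
    using R(1) R(2)[OF that] r(3)[OF that] r(1)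
    by (auto simp: norm_mult norm_power intro!: mult_mono power_mono)
  ultimately show ?thesis
    by (intro exI[of _ "\<lambda>n. R * r ^ n"]) auto
qed

lemma convergent_prod_qpoch:
  fixes x q :: complex
  assumes "norm q < 1"
  shows "convergent_prod (\<lambda>n. 1 - x * q ^ n)"
proof -
  have "summable (\<lambda>n. norm x * norm q ^ n)"
    using assms by (intro summable_mult summable_geometric) auto
  moreover have "norm (1 - x * q ^ n - 1) = norm x * norm q ^ n" for n
    by (simp add: norm_mult norm_power)
  ultimately have "summable (\<lambda>n. norm (1 - x * q ^ n - 1))"
    by presburger
  then show ?thesis
    by (simp only: abs_convergent_prod_conv_summable[symmetric] abs_convergent_prod_imp_convergent_prod)
qed

lemma qpoch_rec:
  assumes "norm q < 1"
  shows "qpoch x q = (1 - x) * qpoch (x * q) q"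
proof -
  have "(\<lambda>n. 1 - (x * q) * q ^ n) has_prod qpoch (x * q) q"
    unfolding qpoch_def using convergent_prod_qpoch[OF assms, of "x * q"]
    by (rule convergent_prod_has_prod)
  then have "(\<lambda>n. 1 - x * q ^ Suc n) has_prod qpoch (x * q) q"
    by (simp add: mult.assoc)
  then have "(\<lambda>n. 1 - x * q ^ n) has_prod (qpoch (x * q) q * (1 - x * q ^ 0))"
    by (rule has_prod_Suc_imp)
  then show ?thesis
    by (simp add: qpoch_def has_prod_iff mult.commute)
qed

lemma qpoch_eq_0_iff:
  assumes "norm q < 1"
  shows "qpoch x q = 0 \<longleftrightarrow> (\<exists>n. x * q ^ n = 1)"
proof -
  have "(\<lambda>n. 1 - x * q ^ n) has_prod qpoch x q"
    unfolding qpoch_def using convergent_prod_qpoch[OF assms] by (rule convergent_prod_has_prod)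
  then have "qpoch x q = 0 \<longleftrightarrow> 0 \<in> range (\<lambda>n. 1 - x * q ^ n)"
    by (rule has_prod_eq_0_iff)
  also have "\<dots> \<longleftrightarrow> (\<exists>n. x * q ^ n = 1)"
    by (auto simp: image_iff)
  finally show ?thesis .
qed

lemma qpoch_0 [simp]: "qpoch 0 q = 1"
  by (simp add: qpoch_def)

lemma qpoch_nz:
  assumes "norm q < 1" "norm x < 1"
  shows "qpoch x q \<noteq> 0"
proof -
  have "norm (x * q ^ n) < 1" for n
  proof -
    have "norm x * norm q ^ n \<le> norm x * 1"
      using assms by (intro mult_left_mono power_le_one) auto
    then show ?thesis
      using assms by (simp add: norm_mult norm_power)
  qed
  then show ?thesis
    using qpoch_eq_0_iff[OF assms(1)] by (metis norm_one less_irrefl)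
qed

lemma qpoch_even_odd:
  assumes "norm q < 1"
  shows "qpoch x q = qpoch x (q\<^sup>2) * qpoch (x * q) (q\<^sup>2)"
proof -
  have q2: "norm (q\<^sup>2) < 1"
    using assms by (simp add: norm_power power_less_one_iff)
  define f where "f n = 1 - x * q ^ n" for n
  have split: "(\<Prod>n<2 * N. f n) = (\<Prod>n<N. 1 - x * (q\<^sup>2) ^ n) * (\<Prod>n<N. 1 - (x * q) * (q\<^sup>2) ^ n)" for N
    by (induction N) (auto simp: f_def power_mult[symmetric] algebra_simps)
  have lim: "(\<lambda>N. \<Prod>n<N. 1 - y * r ^ n) \<longlonglongrightarrow> qpoch y r" if "norm r < 1" for y r
    using convergent_prod_LIMSEQ[OF convergent_prod_qpoch[OF that, of y]]
    by (simp add: qpoch_def LIMSEQ_lessThan_iff_atMost)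
  have "(\<lambda>N. \<Prod>n<2 * N. f n) \<longlonglongrightarrow> qpoch x q"
    using LIMSEQ_subseq_LIMSEQ[OF lim[OF assms, of x], of "\<lambda>N. 2 * N"]
    by (simp add: strict_mono_def o_def f_def)
  moreover have "(\<lambda>N. \<Prod>n<2 * N. f n) \<longlonglongrightarrow> qpoch x (q\<^sup>2) * qpoch (x * q) (q\<^sup>2)"
    unfolding split by (intro tendsto_mult lim q2)
  ultimately show ?thesis
    by (rule LIMSEQ_unique)
qed

lemma qpoch_square:
  assumes "norm q < 1"
  shows "qpoch (x\<^sup>2) (q\<^sup>2) = qpoch x q * qpoch (- x) q"
proof -
  have "qpoch x q * qpoch (- x) q = (\<Prod>n. (1 - x * q ^ n) * (1 - (- x) * q ^ n))"
    unfolding qpoch_def using convergent_prod_qpoch[OF assms] by (intro prodinf_mult)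
  also have "\<dots> = qpoch (x\<^sup>2) (q\<^sup>2)"
    unfolding qpoch_def
    by (intro prodinf_cong) (simp add: power2_eq_square algebra_simps power_mult_distrib)
  finally show ?thesis ..
qed

lemma holomorphic_on_qpoch:
  assumes S: "open S" and u: "u holomorphic_on S" and v: "v holomorphic_on S"
    and v1: "\<And>x. x \<in> S \<Longrightarrow> norm (v x) < 1"
  shows "(\<lambda>x. qpoch (u x) (v x)) holomorphic_on S"
  unfolding qpoch_def
proof (rule holomorphic_on_prodinf[OF S])
  show "(\<lambda>x. 1 - u x * v x ^ n) holomorphic_on S" for n
    by (intro holomorphic_intros u v)
  fix K :: "complex set" assume K: "compact K" "K \<subseteq> S"
  have "continuous_on K u" "continuous_on K v"
    using u v K(2) by (meson holomorphic_on_imp_continuous_on holomorphic_on_subset)+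
  then show "\<exists>M. summable M \<and> (\<forall>n. \<forall>y\<in>K. norm (1 - u y * v y ^ n - 1) \<le> M n)"
    using K v1 by (intro qpoch_bound) auto
qed

lemma compact_box_in_strip:
  fixes z :: "complex \<times> complex"
  assumes "norm (snd z) < 1"
  shows "\<exists>K. compact K \<and> K \<subseteq> {z. norm (snd z) < 1} \<and> z \<in> interior K"
proof -
  define K where "K = cball (fst z) 1 \<times> cball (snd z) ((1 - norm (snd z)) / 2)"
  have "compact K"
    unfolding K_def by (intro compact_Times compact_cball)
  moreover have "K \<subseteq> {z. norm (snd z) < 1}"
  proof
    fix w assume "w \<in> K"
    then have "norm (snd w - snd z) \<le> (1 - norm (snd z)) / 2"
      by (auto simp: K_def dist_norm norm_minus_commute)
    moreover have "norm (snd w) \<le> norm (snd z) + norm (snd w - snd z)"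
      by (metis norm_triangle_sub)
    ultimately have "norm (snd w) \<le> norm (snd z) + (1 - norm (snd z)) / 2"
      by linarith
    then show "w \<in> {z. norm (snd z) < 1}"
      using assms by (simp add: field_simps)
  qed
  moreover have "z \<in> interior K"
    using assms unfolding K_def interior_Times by (auto simp: mem_Times_iff)
  ultimately show ?thesis
    by blast
qed

lemma continuous_on_qpoch_pair:
  "continuous_on {z. norm (snd z) < 1} (\<lambda>z. qpoch (fst z) (snd z))"
  unfolding qpoch_def
proof (rule continuous_on_prodinf)
  fix z :: "complex \<times> complex" assume "z \<in> {z. norm (snd z) < 1}"
  then obtain K where K: "compact K" "K \<subseteq> {z. norm (snd z) < 1}" "z \<in> interior K"
    using compact_box_in_strip[of z] by auto
  have "\<exists>M. summable M \<and> (\<forall>n. \<forall>y\<in>K. norm (1 - fst y * snd y ^ n - 1) \<le> M n)"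
    using K by (intro qpoch_bound) (auto intro!: continuous_intros)
  then show "\<exists>K M. compact K \<and> K \<subseteq> {z. norm (snd z) < 1} \<and> z \<in> interior K \<and> summable M \<and>
           (\<forall>n. \<forall>y\<in>K. norm (1 - fst y * snd y ^ n - 1) \<le> M n)"
    using K by blast
qed (intro continuous_intros)

lemma continuous_on_qpoch:
  assumes "continuous_on S u" "continuous_on S v" "\<And>x. x \<in> S \<Longrightarrow> norm (v x) < 1"
  shows "continuous_on S (\<lambda>x. qpoch (u x) (v x))"
  using continuous_on_compose2[OF continuous_on_qpoch_pair continuous_on_Pair[OF assms(1,2)]] assms(3)
  by (simp add: image_subset_iff)

text \<open>Since \<open>qpoch\<close> is entire in its argument with value 1 at 0, its difference
  quotient at 0 extends holomorphically and is bounded on discs. This dominates the outer product of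
  \<open>qpoch2\<close> by a geometric series.\<close>

lemma qpoch_linear_bound:
  assumes q: "norm q < 1"
  shows "\<exists>C\<ge>0. \<forall>x. norm x \<le> R \<longrightarrow> norm (qpoch x q - 1) \<le> C * norm x"
proof -
  define h where "h z = (if z = 0 then deriv (\<lambda>x. qpoch x q) 0
                         else (qpoch z q - qpoch 0 q) / (z - 0))" for z
  have "(\<lambda>x. qpoch x q) holomorphic_on UNIV"
    using q by (intro holomorphic_on_qpoch holomorphic_intros) auto
  then have "h holomorphic_on UNIV"
    unfolding h_def by (rule pole_lemma_open) auto
  then have "continuous_on (cball 0 R) h"
    by (meson holomorphic_on_imp_continuous_on holomorphic_on_subset subset_UNIV)
  then obtain C where C: "C \<ge> 0" "\<And>x. x \<in> cball 0 R \<Longrightarrow> norm (h x) \<le> C"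
    using compact_norm_bound[OF compact_cball] by blast
  have "norm (qpoch x q - 1) \<le> C * norm x" if "norm x \<le> R" for x
  proof (cases "x = 0")
    case False
    then have "qpoch x q - 1 = h x * x"
      by (simp add: h_def)
    then show ?thesis
      using C(2)[of x] that by (simp add: norm_mult mult_right_mono)
  qed auto
  then show ?thesis
    using C(1) by blast
qed

lemma qpoch2_bound:
  fixes u v :: "'a::topological_space \<Rightarrow> complex"
  assumes "compact K" "continuous_on K u" "continuous_on K v" "\<And>x. x \<in> K \<Longrightarrow> norm (v x) < 1"
    and q: "norm q < 1"
  shows "\<exists>M. summable M \<and> (\<forall>n. \<forall>y\<in>K. norm (qpoch (u y * v y ^ n) q - 1) \<le> M n)"
proof -
  obtain R where R: "R \<ge> 0" "\<And>x. x \<in> K \<Longrightarrow> norm (u x) \<le> R"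
    using compact_norm_bound[OF assms(1,2)] by blast
  obtain r where r: "0 \<le> r" "r < 1" "\<And>x. x \<in> K \<Longrightarrow> norm (v x) \<le> r"
    using compact_norm_bound_less_one[OF assms(1,3,4)] by blast
  obtain C where C: "C \<ge> 0" "\<And>x. norm x \<le> R \<Longrightarrow> norm (qpoch x q - 1) \<le> C * norm x"
    using qpoch_linear_bound[OF q] by blast
  have "summable (\<lambda>n. C * (R * r ^ n))"
    using r by (intro summable_mult summable_geometric) auto
  moreover have "norm (qpoch (u y * v y ^ n) q - 1) \<le> C * (R * r ^ n)" if "y \<in> K" for n y
  proof -
    have *: "norm (u y * v y ^ n) \<le> R * r ^ n"
      using R(1) R(2)[OF that] r(3)[OF that] r(1)
      by (auto simp: norm_mult norm_power intro!: mult_mono power_mono)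
    also have "R * r ^ n \<le> R * 1"
      using R(1) r by (intro mult_left_mono power_le_one) auto
    finally have "norm (qpoch (u y * v y ^ n) q - 1) \<le> C * norm (u y * v y ^ n)"
      by (intro C(2)) simp
    also have "\<dots> \<le> C * (R * r ^ n)"
      using * C(1) by (intro mult_left_mono)
    finally show ?thesis .
  qed
  ultimately show ?thesis
    by (intro exI[of _ "\<lambda>n. C * (R * r ^ n)"]) auto
qed

lemma holomorphic_on_qpoch2:
  assumes S: "open S" and u: "u holomorphic_on S" and v: "v holomorphic_on S"
    and v1: "\<And>x. x \<in> S \<Longrightarrow> norm (v x) < 1" and q: "norm q < 1"
  shows "(\<lambda>x. qpoch2 (u x) (v x) q) holomorphic_on S"
  unfolding qpoch2_def
proof (rule holomorphic_on_prodinf[OF S])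
  show "(\<lambda>x. qpoch (u x * v x ^ n) q) holomorphic_on S" for n
    using q by (intro holomorphic_on_qpoch holomorphic_intros u v S) auto
  fix K :: "complex set" assume K: "compact K" "K \<subseteq> S"
  have "continuous_on K u" "continuous_on K v"
    using u v K(2) by (meson holomorphic_on_imp_continuous_on holomorphic_on_subset)+
  then show "\<exists>M. summable M \<and> (\<forall>n. \<forall>y\<in>K. norm (qpoch (u y * v y ^ n) q - 1) \<le> M n)"
    using K v1 q by (intro qpoch2_bound) auto
qed

lemma continuous_on_qpoch2_pair:
  assumes q: "norm q < 1"
  shows "continuous_on {z. norm (snd z) < 1} (\<lambda>z. qpoch2 (fst z) (snd z) q)"
  unfolding qpoch2_def
proof (rule continuous_on_prodinf)
  fix z :: "complex \<times> complex" assume "z \<in> {z. norm (snd z) < 1}"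
  then obtain K where K: "compact K" "K \<subseteq> {z. norm (snd z) < 1}" "z \<in> interior K"
    using compact_box_in_strip[of z] by auto
  have "\<exists>M. summable M \<and> (\<forall>n. \<forall>y\<in>K. norm (qpoch (fst y * snd y ^ n) q - 1) \<le> M n)"
    using K q by (intro qpoch2_bound) (auto intro!: continuous_intros)
  then show "\<exists>K M. compact K \<and> K \<subseteq> {z. norm (snd z) < 1} \<and> z \<in> interior K \<and> summable M \<and>
           (\<forall>n. \<forall>y\<in>K. norm (qpoch (fst y * snd y ^ n) q - 1) \<le> M n)"
    using K by blast
qed (use q in \<open>auto intro!: continuous_on_qpoch continuous_intros\<close>)

lemma continuous_on_qpoch2:
  assumes "continuous_on S u" "continuous_on S v" "\<And>x. x \<in> S \<Longrightarrow> norm (v x) < 1" "norm q < 1"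
  shows "continuous_on S (\<lambda>x. qpoch2 (u x) (v x) q)"
  using continuous_on_compose2[OF continuous_on_qpoch2_pair[OF assms(4)] continuous_on_Pair[OF assms(1,2)]]
    assms(3)
  by (simp add: image_subset_iff)

lemma convergent_prod_qpoch2:
  assumes "norm p < 1" "norm q < 1"
  shows "convergent_prod (\<lambda>n. qpoch (x * p ^ n) q)"
proof -
  obtain M where M: "summable M" "\<And>n. norm (qpoch (x * p ^ n) q - 1) \<le> M n"
    using qpoch2_bound[of "{0::complex}" "\<lambda>_. x" "\<lambda>_. p" q] assms by auto
  have "summable (\<lambda>n. norm (qpoch (x * p ^ n) q - 1))"
    by (rule summable_comparison_test[OF _ M(1)]) (use M(2) in auto)
  then show ?thesis
    by (simp only: abs_convergent_prod_conv_summable[symmetric] abs_convergent_prod_imp_convergent_prod)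
qed

lemma qpoch2_rec:
  assumes "norm p < 1" "norm q < 1"
  shows "qpoch2 x p q = qpoch x q * qpoch2 (x * p) p q"
proof -
  have "(\<lambda>n. qpoch ((x * p) * p ^ n) q) has_prod qpoch2 (x * p) p q"
    unfolding qpoch2_def using convergent_prod_qpoch2[OF assms, of "x * p"]
    by (rule convergent_prod_has_prod)
  then have "(\<lambda>n. qpoch (x * p ^ Suc n) q) has_prod qpoch2 (x * p) p q"
    by (simp add: mult.assoc)
  then have "(\<lambda>n. qpoch (x * p ^ n) q) has_prod (qpoch2 (x * p) p q * qpoch (x * p ^ 0) q)"
    by (rule has_prod_Suc_imp)
  then show ?thesis
    by (simp add: qpoch2_def has_prod_iff mult.commute)
qed

text \<open>The iterated product is cut in the other direction: each inner product gives up its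
  first factor \<open>1 - x * p ^ n\<close>, and these factors multiply to
  \<open>qpoch x p\<close>.\<close>

lemma qpoch2_rec':
  assumes "norm p < 1" "norm q < 1"
  shows "qpoch2 x p q = qpoch x p * qpoch2 (x * q) p q"
proof -
  have "qpoch x p * qpoch2 (x * q) p q = (\<Prod>n. (1 - x * p ^ n) * qpoch (x * q * p ^ n) q)"
    unfolding qpoch2_def qpoch_def[of x p]
    using convergent_prod_qpoch[OF assms(1)] convergent_prod_qpoch2[OF assms] by (intro prodinf_mult)
  also have "\<dots> = qpoch2 x p q"
    unfolding qpoch2_def
  proof (intro prodinf_cong)
    show "(1 - x * p ^ n) * qpoch (x * q * p ^ n) q = qpoch (x * p ^ n) q" for n
      using qpoch_rec[OF assms(2), of "x * p ^ n"] by (simp add: mult_ac)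
  qed
  finally show ?thesis ..
qed

lemma qpoch2_eq_0_iff:
  assumes "norm p < 1" "norm q < 1"
  shows "qpoch2 x p q = 0 \<longleftrightarrow> (\<exists>j k. x * p ^ j * q ^ k = 1)"
proof -
  have "(\<lambda>n. qpoch (x * p ^ n) q) has_prod qpoch2 x p q"
    unfolding qpoch2_def using convergent_prod_qpoch2[OF assms] by (rule convergent_prod_has_prod)
  then have "qpoch2 x p q = 0 \<longleftrightarrow> 0 \<in> range (\<lambda>n. qpoch (x * p ^ n) q)"
    by (rule has_prod_eq_0_iff)
  also have "\<dots> \<longleftrightarrow> (\<exists>j. qpoch (x * p ^ j) q = 0)"
    by (metis (no_types, lifting) image_iff rangeI)
  finally show ?thesis
    by (simp add: qpoch_eq_0_iff assms(2))
qed

lemma qpoch2_0 [simp]: "qpoch2 0 p q = 1"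
  by (simp add: qpoch2_def)

lemma qpoch2_nz:
  assumes "norm p < 1" "norm q < 1" "norm x < 1"
  shows "qpoch2 x p q \<noteq> 0"
proof -
  have "norm (x * p ^ j * q ^ k) < 1" for j k
  proof -
    have "norm x * norm p ^ j * norm q ^ k \<le> norm x * 1 * 1"
      using assms by (intro mult_mono power_le_one) auto
    then show ?thesis
      using assms by (simp add: norm_mult norm_power)
  qed
  then show ?thesis
    using qpoch2_eq_0_iff[OF assms(1,2)] by (metis norm_one less_irrefl)
qed

lemma qpoch2_even_odd:
  assumes p: "norm p < 1" and q: "norm q < 1"
  shows "qpoch2 x p q = qpoch2 x (p\<^sup>2) q * qpoch2 (x * p) (p\<^sup>2) q"
proof -
  have p2: "norm (p\<^sup>2) < 1"
    using p by (simp add: norm_power power_less_one_iff)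
  define f where "f n = qpoch (x * p ^ n) q" for n
  have split: "(\<Prod>n<2 * N. f n) = (\<Prod>n<N. qpoch (x * (p\<^sup>2) ^ n) q) * (\<Prod>n<N. qpoch ((x * p) * (p\<^sup>2) ^ n) q)" for N
    by (induction N) (auto simp: f_def power_mult[symmetric] mult_ac)
  have lim: "(\<lambda>N. \<Prod>n<N. qpoch (y * r ^ n) q) \<longlonglongrightarrow> qpoch2 y r q" if "norm r < 1" for y r
    using convergent_prod_LIMSEQ[OF convergent_prod_qpoch2[OF that q, of y]]
    by (simp add: qpoch2_def LIMSEQ_lessThan_iff_atMost)
  have "(\<lambda>N. \<Prod>n<2 * N. f n) \<longlonglongrightarrow> qpoch2 x p q"
    using LIMSEQ_subseq_LIMSEQ[OF lim[OF p, of x], of "\<lambda>N. 2 * N"]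
    by (simp add: strict_mono_def o_def f_def)
  moreover have "(\<lambda>N. \<Prod>n<2 * N. f n) \<longlonglongrightarrow> qpoch2 x (p\<^sup>2) q * qpoch2 (x * p) (p\<^sup>2) q"
    unfolding split by (intro tendsto_mult lim p2)
  ultimately show ?thesis
    by (rule LIMSEQ_unique)
qed

section \<open>Theta functions\<close>

lemma theta_inverse:
  assumes "norm p < 1" "x \<noteq> 0"
  shows "theta (1 / x) p = - theta x p / x"
proof -
  have "theta (1 / x) p = (1 - 1 / x) * (qpoch (p / x) p * qpoch (p * x) p)"
    using qpoch_rec[OF assms(1), of "1 / x"] by (simp add: theta_def)
  moreover have "theta x p = (1 - x) * (qpoch (p / x) p * qpoch (p * x) p)"
    using qpoch_rec[OF assms(1), of x] by (simp add: theta_def mult_ac)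
  ultimately show ?thesis
    using assms(2) by (simp only:) (simp add: field_simps)
qed

lemma theta_reflect:
  assumes "p \<noteq> 0"
  shows "theta (p / x) p = theta x p"
  using assms by (cases "x = 0") (auto simp: theta_def)

lemma theta_shift:
  assumes "norm p < 1" "p \<noteq> 0" "x \<noteq> 0"
  shows "theta (p * x) p = - theta x p / x"
  using theta_inverse[OF assms(1,3)] theta_reflect[OF assms(2), of "1 / x"] by simp

lemma theta_split:
  assumes "norm p < 1" "p \<noteq> 0"
  shows "theta x p = theta x (p\<^sup>2) * theta (p * x) (p\<^sup>2)"
proof -
  have "qpoch x p = qpoch x (p\<^sup>2) * qpoch (p * x) (p\<^sup>2)"
    using qpoch_even_odd[OF assms(1), of x] by (simp add: mult.commute)
  moreover have "qpoch (p / x) p = qpoch (p\<^sup>2 / (p * x)) (p\<^sup>2) * qpoch (p\<^sup>2 / x) (p\<^sup>2)"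
    using qpoch_even_odd[OF assms(1), of "p / x"] assms(2) by (simp add: power2_eq_square)
  ultimately show ?thesis
    by (simp add: theta_def)
qed

lemma theta_square:
  assumes "norm p < 1"
  shows "theta (x\<^sup>2) (p\<^sup>2) = theta x p * theta (- x) p"
  using qpoch_square[OF assms, of x] qpoch_square[OF assms, of "p / x"]
  by (simp add: theta_def power_divide mult_ac)

lemma theta_1 [simp]: "norm p < 1 \<Longrightarrow> theta 1 p = 0"
  using qpoch_rec[of p 1] by (simp add: theta_def)

lemma theta_eq_0_iff:
  assumes "norm p < 1" "p \<noteq> 0" "x \<noteq> 0"
  shows "theta x p = 0 \<longleftrightarrow> (\<exists>k :: int. x = p powi k)"
proof -
  have "qpoch x p = 0 \<longleftrightarrow> (\<exists>n. x = p powi (- int n))"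
    using assms by (simp add: qpoch_eq_0_iff power_int_minus field_simps)
  moreover have "qpoch (p / x) p = 0 \<longleftrightarrow> (\<exists>n. x = p powi (int n + 1))"
    using assms by (auto simp: qpoch_eq_0_iff power_int_add field_simps)
  moreover have "(\<exists>n. x = p powi (- int n)) \<or> (\<exists>n. x = p powi (int n + 1)) \<longleftrightarrow> (\<exists>k :: int. x = p powi k)"
  proof safe
    fix k :: int assume "x = p powi k" and no: "\<nexists>n. p powi k = p powi (int n + 1)"
    have "k \<le> 0"
    proof (rule ccontr)
      assume "\<not> k \<le> 0"
      then have "k = int (nat (k - 1)) + 1" by simp
      then show False using no by metis
    qed
    then have "k = - int (nat (- k))" by simp
    then show "\<exists>n. p powi k = p powi - int n" by metis
  qed blast+
  ultimately show ?thesis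
    by (auto simp: theta_def)
qed

lemma theta_nz:
  assumes "norm p < 1" "p \<noteq> 0" "norm p < norm x" "norm x < 1"
  shows "theta x p \<noteq> 0"
proof -
  have "norm (p / x) < 1"
    using assms by (simp add: norm_divide divide_less_eq)
  then show ?thesis
    using assms by (simp add: theta_def qpoch_nz)
qed

lemma holomorphic_on_theta:
  assumes "open S" "u holomorphic_on S" "v holomorphic_on S" "\<And>x. x \<in> S \<Longrightarrow> norm (v x) < 1"
    "\<And>x. x \<in> S \<Longrightarrow> u x \<noteq> 0"
  shows "(\<lambda>x. theta (u x) (v x)) holomorphic_on S"
  unfolding theta_def using assms
  by (intro holomorphic_intros holomorphic_on_qpoch) auto

lemma continuous_on_theta:
  assumes "continuous_on S u" "continuous_on S v" "\<And>x. x \<in> S \<Longrightarrow> norm (v x) < 1"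
    "\<And>x. x \<in> S \<Longrightarrow> u x \<noteq> 0"
  shows "continuous_on S (\<lambda>x. theta (u x) (v x))"
  unfolding theta_def using assms
  by (intro continuous_intros continuous_on_qpoch) auto

text \<open>Differentiating \<open>theta_shift\<close> at a zero transports a nonzero derivative
  from \<open>p powi k\<close> to \<open>p powi (k + 1)\<close> and back. Only the zero at 1 is
  computed, where the factor \<open>1 - x\<close> splits off.\<close>

lemma deriv_theta_nz:
  assumes p: "norm p < 1" "p \<noteq> 0" and x: "x \<noteq> 0" "theta x p = 0"
  shows "deriv (\<lambda>x. theta x p) x \<noteq> 0"
proof -
  have hol: "(\<lambda>x. theta x p) holomorphic_on - {0}"
    using p by (intro holomorphic_on_theta holomorphic_intros) auto
  have D: "((\<lambda>x. theta x p) has_field_derivative deriv (\<lambda>x. theta x p) y) (at y)" if "y \<noteq> 0" for y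
    using holomorphic_derivI[OF hol, of y] that by auto
  have step: "p * deriv (\<lambda>x. theta x p) (p * y) = - deriv (\<lambda>x. theta x p) y / y"
    if y: "y \<noteq> 0" "theta y p = 0" for y
  proof -
    have "((\<lambda>x. theta (p * x) p) has_field_derivative (deriv (\<lambda>x. theta x p) (p * y) * p)) (at y)"
      using y p by (intro DERIV_chain2[where f = "\<lambda>x. theta x p" and g = "\<lambda>x. p * x"] D)
        (auto intro!: derivative_eq_intros)
    moreover have "((\<lambda>x. - theta x p / x) has_field_derivative
        ((- deriv (\<lambda>x. theta x p) y * y - (- theta y p) * 1) / (y * y))) (at y)"
      using y by (intro derivative_intros D DERIV_divide[OF DERIV_minus[OF D] DERIV_ident]) auto
    then have "((\<lambda>x. theta (p * x) p) has_field_derivative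
        ((- deriv (\<lambda>x. theta x p) y * y - (- theta y p) * 1) / (y * y))) (at y)"
      by (rule has_field_derivative_transform_within_open[of _ _ _ "- {0}"])
        (use p y in \<open>auto simp: theta_shift\<close>)
    ultimately have "deriv (\<lambda>x. theta x p) (p * y) * p =
        (- deriv (\<lambda>x. theta x p) y * y - (- theta y p) * 1) / (y * y)"
      by (rule DERIV_unique)
    then show ?thesis
      using y by (simp add: field_simps)
  qed
  have zero: "theta (p powi k) p = 0" for k
    using p theta_eq_0_iff[of p "p powi k"] by auto
  have "deriv (\<lambda>x. theta x p) (p powi k) \<noteq> 0" for k
  proof (induction k rule: int_induct[where k = 0])
    case base
    define h where "h x = qpoch (x * p) p * qpoch (p / x) p" for x
    have "h holomorphic_on - {0}"
      unfolding h_def using p by (intro holomorphic_intros holomorphic_on_qpoch) auto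
    then have "(h has_field_derivative deriv h 1) (at 1)"
      by (rule holomorphic_derivI) auto
    then have "((\<lambda>x. (1 - x) * h x) has_field_derivative - h 1) (at 1)"
      by (auto intro!: derivative_eq_intros)
    moreover have "(\<lambda>x. (1 - x) * h x) = (\<lambda>x. theta x p)"
    proof
      show "(1 - x) * h x = theta x p" for x
        by (simp only: theta_def h_def qpoch_rec[OF p(1), of x] mult.assoc)
    qed
    ultimately have "deriv (\<lambda>x. theta x p) 1 = - h 1"
      by (simp add: DERIV_imp_deriv)
    then show ?case
      using p by (simp add: h_def qpoch_nz)
  next
    case (step1 k)
    have "p * deriv (\<lambda>x. theta x p) (p * p powi k) = - deriv (\<lambda>x. theta x p) (p powi k) / p powi k"
      by (rule step) (use p zero in simp_all)
    moreover have "p * p powi k = p powi (k + 1)"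
      using p by (simp add: power_int_add mult.commute)
    ultimately show ?case
      using step1(2) p by auto
  next
    case (step2 k)
    have "p * deriv (\<lambda>x. theta x p) (p * p powi (k - 1)) = - deriv (\<lambda>x. theta x p) (p powi (k - 1)) / p powi (k - 1)"
      by (rule step) (use p zero in simp_all)
    moreover have "p * p powi (k - 1) = p powi k"
      using p by (simp add: power_int_diff)
    ultimately show ?case
      using step2(2) p by auto
  qed
  then show ?thesis
    using x p by (auto simp: theta_eq_0_iff)
qed

section \<open>Division by simple zeros, the identity theorem and periodic functions\<close>

lemma open_nonzeros:
  assumes "open S" "continuous_on S f"
  shows "open {x \<in> S. f x \<noteq> (0 :: 'b :: {t1_space,zero})}"
proof -
  have "open (S \<inter> f -` (- {0}))"
    using assms by (intro continuous_open_preimage) auto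
  moreover have "S \<inter> f -` (- {0}) = {x \<in> S. f x \<noteq> 0}"
    by auto
  ultimately show ?thesis
    by simp
qed

text \<open>Near a zero \<open>a\<close> of \<open>g\<close> both functions are replaced by their
  difference quotients at \<open>a\<close>. The quotient of these is holomorphic there because
  \<open>g1 a = deriv g a\<close> is nonzero.\<close>

lemma holomorphic_on_divide_simple_zeros:
  assumes S: "open S" and G: "G holomorphic_on S" and g: "g holomorphic_on S"
    and zeros: "\<And>x. x \<in> S \<Longrightarrow> g x = 0 \<Longrightarrow> G x = 0 \<and> deriv g x \<noteq> 0"
  shows "\<exists>h. h holomorphic_on S \<and> (\<forall>x\<in>S. G x = h x * g x)"
proof -
  define h where "h x = (if g x = 0 then deriv G x / deriv g x else G x / g x)" for x
  have "h analytic_on {a}" if a: "a \<in> S" for a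
  proof -
    have "\<exists>T k. open T \<and> a \<in> T \<and> k holomorphic_on T \<and> (\<forall>x\<in>T. h x = k x)"
    proof (cases "g a = 0")
      case False
      define T where "T = {x \<in> S. g x \<noteq> 0}"
      have "open T"
        unfolding T_def using S g by (intro open_nonzeros holomorphic_on_imp_continuous_on)
      moreover have "(\<lambda>x. G x / g x) holomorphic_on T"
        using G g by (intro holomorphic_intros) (auto simp: T_def elim: holomorphic_on_subset)
      ultimately show ?thesis
        using False a by (intro exI[of _ T] exI[of _ "\<lambda>x. G x / g x"]) (auto simp: T_def h_def)
    next
      case True
      define g1 where "g1 z = (if z = a then deriv g a else (g z - g a) / (z - a))" for z
      define G1 where "G1 z = (if z = a then deriv G a else (G z - G a) / (z - a))" for z
      have hol: "g1 holomorphic_on S" "G1 holomorphic_on S"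
        unfolding g1_def G1_def by (intro pole_lemma_open g G S)+
      define T where "T = {x \<in> S. g1 x \<noteq> 0}"
      have "open T"
        unfolding T_def using S hol(1) by (intro open_nonzeros holomorphic_on_imp_continuous_on)
      moreover have "(\<lambda>x. G1 x / g1 x) holomorphic_on T"
        using hol by (intro holomorphic_intros) (auto simp: T_def elim: holomorphic_on_subset)
      moreover have "a \<in> T"
        using a zeros[OF a True] by (simp add: T_def g1_def)
      moreover have "h x = G1 x / g1 x" if "x \<in> T" for x
        using that True zeros[OF a True] by (auto simp: h_def G1_def g1_def T_def)
      ultimately show ?thesis
        by blast
    qed
    then obtain T k where T: "open T" "a \<in> T" "k holomorphic_on T" "\<And>x. x \<in> T \<Longrightarrow> h x = k x"
      by blast
    have "h holomorphic_on T"
      using T(3,4) by (simp cong: holomorphic_cong)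
    then show ?thesis
      using T(1,2) by (simp add: analytic_at) blast
  qed
  then have "h holomorphic_on S"
    using analytic_imp_holomorphic analytic_on_analytic_at by blast
  moreover have "G x = h x * g x" if "x \<in> S" for x
    using zeros[OF that] by (auto simp: h_def)
  ultimately show ?thesis
    by blast
qed

text \<open>This is the device for removing genericity assumptions: \<open>g\<close> collects the
  nonvanishing conditions under which \<open>f\<close> is known to vanish, and one point where they
  all hold suffices.\<close>

lemma holomorphic_mult_eq_0:
  assumes S: "open S" "connected S" and f: "f holomorphic_on S" and g: "g holomorphic_on S"
    and eq: "\<And>x. x \<in> S \<Longrightarrow> f x * g x = 0" and nz: "b \<in> S" "g b \<noteq> 0" and x: "x \<in> S"
  shows "f x = 0"
proof (rule ccontr)
  assume "f x \<noteq> 0"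
  define T where "T = {x \<in> S. f x \<noteq> 0}"
  have T: "open T" "x \<in> T" "T \<subseteq> S"
    unfolding T_def using S(1) f x \<open>f x \<noteq> 0\<close>
    by (auto intro!: open_nonzeros holomorphic_on_imp_continuous_on)
  have "x islimpt T"
    using T by (intro interior_limit_point) (simp add: interior_open)
  moreover have "g z = 0" if "z \<in> T" for z
    using eq[of z] that by (auto simp: T_def)
  ultimately have "g b = 0"
    using analytic_continuation[OF g S T(3) x _ _ nz(1)] by blast
  then show False
    using nz by simp
qed

lemma connected_punctured_plane: "connected (- {0 :: complex})"
  using connected_punctured_universe[of "0 :: complex"] by (simp add: Compl_eq_Diff_UNIV)

text \<open>The norm of \<open>f\<close> attains its maximum over the fundamental annulus, and by periodicity that is a
  maximum over all of \<open>A\<close>.\<close>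

lemma q_periodic_constant:
  fixes f :: "complex \<Rightarrow> complex"
  assumes q: "q \<noteq> 0" "norm q < 1" and I: "is_interval I" and A: "A = {x. norm x \<in> I}"
    and op: "open A" "connected A" and f: "f holomorphic_on A"
    and \<rho>: "\<rho> > 0" "\<rho> \<in> I" "\<rho> * norm q \<in> I"
    and per: "\<And>x. x \<in> A \<Longrightarrow> q * x \<in> A \<Longrightarrow> f (q * x) = f x"
    and pos: "\<And>x. x \<in> I \<Longrightarrow> x > 0"
  shows "\<exists>c. \<forall>x\<in>A. f x = c"
proof -
  define K where "K = {x :: complex. \<rho> * norm q \<le> norm x \<and> norm x \<le> \<rho>}"
  have "K \<subseteq> A"
  proof
    fix x assume "x \<in> K"
    then have "\<rho> * norm q \<le> norm x" "norm x \<le> \<rho>"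
      by (auto simp: K_def)
    then have "norm x \<in> I"
      using I \<rho> unfolding is_interval_1 by blast
    then show "x \<in> A"
      by (simp add: A)
  qed
  have "K = cball 0 \<rho> - ball 0 (\<rho> * norm q)"
    by (auto simp: K_def)
  then have "compact K"
    by (simp add: compact_diff)
  moreover have "of_real \<rho> \<in> K"
    using q \<rho> by (auto simp: K_def mult_le_one)
  moreover have "continuous_on K (\<lambda>x. norm (f x))"
    using f \<open>K \<subseteq> A\<close> by (intro continuous_on_norm) (meson holomorphic_on_imp_continuous_on holomorphic_on_subset)
  ultimately obtain \<xi> where \<xi>: "\<xi> \<in> K" "\<And>y. y \<in> K \<Longrightarrow> norm (f y) \<le> norm (f \<xi>)"
    using continuous_attains_sup by (metis empty_iff)
  \<comment> \<open>Periodicity is assumed only inside \<open>A\<close>. The intermediate powers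
    stay in \<open>A\<close> because their norms lie between those of the two ends and
    \<open>I\<close> is an interval.\<close>
  have iter: "f (q ^ n * x) = f x" if "x \<in> A" "q ^ n * x \<in> A" for n x
    using that
  proof (induction n)
    case (Suc n)
    have "norm (q ^ Suc n * x) \<le> norm (q ^ n * x)"
      using q by (auto simp: norm_mult norm_power mult_left_le_one_le mult_right_mono intro!: mult_right_mono)
    moreover have "norm (q ^ n * x) \<le> norm x"
      using q by (auto simp: norm_mult norm_power intro!: mult_left_le_one_le power_le_one)
    ultimately have "q ^ n * x \<in> A"
      using Suc.prems I unfolding A is_interval_1 by blast
    then show ?case
      using Suc per[of "q ^ n * x"] by (simp add: mult.assoc)
  qed auto
  have red: "\<exists>y\<in>K. f y = f x" if x: "x \<in> A" for x
  proof (cases "norm x \<le> \<rho>")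
    case False
    have x0: "norm x > 0"
      using x pos[of "norm x"] by (simp add: A)
    obtain n0 where "norm q ^ n0 < \<rho> / norm x"
      using real_arch_pow_inv[of "\<rho> / norm x" "norm q"] q \<rho>(1) x0 by auto
    then have "\<exists>n. norm q ^ n * norm x \<le> \<rho>"
      using x0 by (intro exI[of _ n0]) (simp add: field_simps)
    define n where "n = (LEAST n. norm q ^ n * norm x \<le> \<rho>)"
    have n: "norm q ^ n * norm x \<le> \<rho>"
      unfolding n_def by (rule LeastI_ex) fact
    have "n \<noteq> 0"
      using n False by (intro notI) simp
    then obtain m where m: "n = Suc m"
      by (cases n) auto
    have "\<not> norm q ^ m * norm x \<le> \<rho>"
      using not_less_Least[of m "\<lambda>n. norm q ^ n * norm x \<le> \<rho>"] m unfolding n_def by linarith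
    then have "\<rho> * norm q \<le> norm q ^ n * norm x"
      using q m by (simp add: mult.commute mult_left_mono)
    then have "q ^ n * x \<in> K"
      using n by (simp add: K_def norm_mult norm_power)
    then show ?thesis
      using iter[OF x, of n] \<open>K \<subseteq> A\<close> by blast
  next
    case True
    have x0: "norm x > 0"
      using x pos[of "norm x"] by (simp add: A)
    have \<rho>q: "\<rho> * norm q > 0"
      using q \<rho> by simp
    obtain n0 where "norm q ^ n0 < norm x / (\<rho> * norm q)"
      using real_arch_pow_inv[of "norm x / (\<rho> * norm q)" "norm q"] q \<rho>q x0 by auto
    then have "\<exists>n. norm q ^ n * (\<rho> * norm q) \<le> norm x"
      using \<rho>q by (intro exI[of _ n0]) (simp only: pos_less_divide_eq less_imp_le)
    define n where "n = (LEAST n. norm q ^ n * (\<rho> * norm q) \<le> norm x)"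
    have n: "norm q ^ n * (\<rho> * norm q) \<le> norm x"
      unfolding n_def by (rule LeastI_ex) fact
    have le: "norm x \<le> norm q ^ n * \<rho>"
    proof (cases n)
      case (Suc m)
      have "\<not> norm q ^ m * (\<rho> * norm q) \<le> norm x"
        using not_less_Least[of m "\<lambda>n. norm q ^ n * (\<rho> * norm q) \<le> norm x"] Suc unfolding n_def by linarith
      then show ?thesis
        using Suc by (simp add: mult_ac)
    qed (use True in simp)
    define y where "y = x / q ^ n"
    have y: "y \<in> K"
      using n le q by (simp add: K_def y_def norm_divide norm_power field_simps)
    have "q ^ n * y = x"
      using q by (simp add: y_def)
    then have "f y = f x"
      using iter[of y n] y x \<open>K \<subseteq> A\<close> by auto
    then show ?thesis
      using y by blast
  qed
  have "f constant_on A"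
  proof (rule maximum_modulus_principle[OF f op op(1) order_refl])
    show "\<xi> \<in> A"
      using \<xi>(1) \<open>K \<subseteq> A\<close> by blast
    show "norm (f z) \<le> norm (f \<xi>)" if "z \<in> A" for z
      using red[OF that] \<xi>(2) by metis
  qed
  then show ?thesis
    by (auto simp: constant_on_def)
qed

text \<open>Each prescribed zero allows division by one theta factor, which lowers the degree of the
  multiplier by one; at degree zero the function is \<open>p\<close>-periodic on the punctured
  plane, hence constant. The pairwise condition says that the zeros are distinct modulo powers of
  \<open>p\<close>, so that later zeros survive earlier divisions.\<close>

lemma theta_space:
  assumes p: "norm p < 1" "p \<noteq> 0"
    and "sorted_wrt (\<lambda>u v. theta (v / u) p \<noteq> 0) us"
    and "\<And>u. u \<in> set us \<Longrightarrow> u \<noteq> 0 \<and> G u = 0"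
    and "G holomorphic_on - {0}"
    and "\<And>x. x \<noteq> 0 \<Longrightarrow> G (p * x) = (- 1) ^ length us * prod_list us / x ^ length us * G x"
  shows "\<exists>k. \<forall>x. x \<noteq> 0 \<longrightarrow> G x = k * (\<Prod>u\<leftarrow>us. theta (x / u) p)"
  using assms(3-)
proof (induction us arbitrary: G)
  case Nil
  have "\<exists>c. \<forall>x\<in>- {0}. G x = c"
    using p Nil.prems
    by (intro q_periodic_constant[where q = p and I = "{0<..}" and \<rho> = 1] connected_punctured_plane) auto
  then show ?case
    by auto
next
  case (Cons u us)
  have u: "u \<noteq> 0" "G u = 0"
    using Cons.prems(2) by auto
  define T where "T x = theta (x / u) p" for x
  have T: "T holomorphic_on - {0}"
    unfolding T_def using p u by (intro holomorphic_on_theta holomorphic_intros) auto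
  have quasi: "G (p * x) = 0 \<longleftrightarrow> G x = 0" if "x \<noteq> 0" for x
    using Cons.prems(2) Cons.prems(4)[OF that] that
    by (auto simp: prod_list_zero_iff)
  have G0: "G (p powi k * u) = 0" for k
  proof (induction k rule: int_induct[where k = 0])
    case (step1 k)
    then show ?case
      using quasi[of "p powi k * u"] u p by (simp add: power_int_add mult_ac)
  next
    case (step2 k)
    then show ?case
      using quasi[of "p powi (k - 1) * u"] u p by (simp add: power_int_diff mult_ac)
  qed (use u in auto)
  have zeros: "G x = 0 \<and> deriv T x \<noteq> 0" if "x \<in> - {0}" "T x = 0" for x
  proof
    have "x / u \<noteq> 0" "theta (x / u) p = 0"
      using that u by (auto simp: T_def)
    then obtain k :: int where "x / u = p powi k"
      using theta_eq_0_iff[OF p] by blast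
    then show "G x = 0"
      using G0[of k] u by (simp add: field_simps)
    have "deriv T x = deriv (\<lambda>x. theta x p) (x / u) * (1 / u)"
    proof (rule DERIV_imp_deriv)
      have "(\<lambda>x. theta x p) holomorphic_on - {0}"
        using p by (intro holomorphic_on_theta holomorphic_intros) auto
      then have "((\<lambda>x. theta x p) has_field_derivative deriv (\<lambda>x. theta x p) (x / u)) (at (x / u))"
        by (rule holomorphic_derivI) (use that u in auto)
      then show "(T has_field_derivative deriv (\<lambda>x. theta x p) (x / u) * (1 / u)) (at x)"
        unfolding T_def using u
        by (intro DERIV_chain2[where f = "\<lambda>x. theta x p" and g = "\<lambda>x. x / u"])
          (auto intro!: derivative_eq_intros)
    qed
    then show "deriv T x \<noteq> 0"
      using deriv_theta_nz[OF p, of "x / u"] that u by (simp add: T_def)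
  qed
  obtain H where H: "H holomorphic_on - {0}" "\<And>x. x \<noteq> 0 \<Longrightarrow> G x = H x * T x"
    using holomorphic_on_divide_simple_zeros[OF _ Cons.prems(3) T zeros] by auto
  have "\<exists>b. b \<noteq> 0 \<and> T b \<noteq> 0"
  proof -
    define y where "y = complex_of_real ((norm p + 1) / 2)"
    have "norm y = (norm p + 1) / 2"
      unfolding y_def norm_of_real by (rule abs_of_nonneg) simp
    then have y: "norm p < norm y" "norm y < 1"
      using p(1) by auto
    then have "T (y * u) \<noteq> 0" "y * u \<noteq> 0"
      using theta_nz[OF p y] u by (auto simp: T_def)
    then show ?thesis by blast
  qed
  then obtain b where b: "b \<noteq> 0" "T b \<noteq> 0"
    by blast
  define c where "c = (- 1) ^ length us * prod_list us"
  \<comment> \<open>After multiplication by \<open>T\<close> this is the quasi-periodicity of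
    \<open>G\<close>; the factor \<open>T\<close>, nonzero at \<open>b\<close>, is cancelled by the
    identity theorem.\<close>
  have Hp: "H (p * x) = c / x ^ length us * H x" if x: "x \<noteq> 0" for x
  proof -
    define D where "D x = H (p * x) - c / x ^ length us * H x" for x
    have "(H \<circ> (\<lambda>x. p * x)) holomorphic_on - {0}"
      using p by (intro holomorphic_on_compose_gen[OF _ H(1)] holomorphic_intros) auto
    then have D: "D holomorphic_on - {0}"
      unfolding D_def o_def using H(1) by (intro holomorphic_intros) auto
    have "D x = 0"
    proof (rule holomorphic_mult_eq_0[OF _ connected_punctured_plane D T _ _ b(2)])
      fix x :: complex assume "x \<in> - {0}"
      then have x: "x \<noteq> 0" by simp
      have "T (p * x) = - (u / x) * T x"
        using theta_shift[OF p, of "x / u"] x u by (simp add: T_def)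
      then have "H (p * x) * (- (u / x) * T x) = (- 1) ^ Suc (length us) * (u * prod_list us) / x ^ Suc (length us) * (H x * T x)"
        using Cons.prems(4)[OF x] H(2)[OF x] H(2)[of "p * x"] x p by simp
      then have "- (u / x) * ((H (p * x) - c / x ^ length us * H x) * T x) = 0"
        using x by (simp add: c_def field_simps)
      then show "D x * T x = 0"
        using x u by (simp add: D_def)
    qed (use x b in auto)
    then show ?thesis
      by (simp add: D_def)
  qed
  have "H v = 0" if "v \<in> set us" for v
    using Cons.prems(1) Cons.prems(2)[of v] H(2)[of v] that by (auto simp: T_def)
  then obtain k where "\<forall>x. x \<noteq> 0 \<longrightarrow> H x = k * (\<Prod>u\<leftarrow>us. theta (x / u) p)"
    using Cons.IH[of H] Cons.prems(1,2) H(1) Hp unfolding c_def by auto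
  then show ?case
    using H(2) by (intro exI[of _ k]) (auto simp: T_def)
qed

text \<open>By the Jacobi triple product the left side is the sum of
  \<open>q ^ (n * (n - 1) / 2) * y ^ n\<close> over all integers \<open>n\<close>; the two summands
  on the right collect the even and the odd \<open>n\<close>. The proof compares multipliers and the
  zero at \<open>y = - 1\<close> instead, and fixes the constant at \<open>y = 1\<close>.\<close>

lemma theta_dissection:
  assumes q: "norm q < 1" "q \<noteq> 0" and y: "y \<noteq> 0"
  shows "qpoch q q * theta (- y) q =
    qpoch (q ^ 4) (q ^ 4) * (theta (- (q * y\<^sup>2)) (q ^ 4) + y * theta (- (q ^ 3 * y\<^sup>2)) (q ^ 4))"
proof -
  have q2: "norm (q\<^sup>2) < 1" and q4: "norm (q ^ 4) < 1"
    using q by (auto simp: norm_power power_less_one_iff)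
  have pow: "q * q ^ 3 = q ^ 4" "(q\<^sup>2)\<^sup>2 = q ^ 4" "q * q\<^sup>2 = q ^ 3" "q\<^sup>2 * q = q ^ 3" "q ^ 4 / q = q ^ 3"
    using q by (simp_all add: power_numeral_reduce power2_eq_square)
  define G where "G y = theta (- (q * y\<^sup>2)) (q ^ 4) + y * theta (- (q ^ 3 * y\<^sup>2)) (q ^ 4)" for y
  have "\<exists>k. \<forall>y. y \<noteq> 0 \<longrightarrow> G y = k * (\<Prod>u\<leftarrow>[- 1]. theta (y / u) q)"
  proof (rule theta_space[OF q])
    show "G holomorphic_on - {0}"
      unfolding G_def using q q4 by (intro holomorphic_intros holomorphic_on_theta) auto
    show "u \<noteq> 0 \<and> G u = 0" if "u \<in> set [- 1]" for u
      using that theta_reflect[of "q ^ 4" "- q"] q pow by (auto simp: G_def)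
    show "G (q * x) = (- 1) ^ length [- 1] * prod_list [- 1] / x ^ length [- 1 :: complex] * G x"
      if "x \<noteq> 0" for x
    proof -
      have "theta (q ^ 4 * - (q * x\<^sup>2)) (q ^ 4) = theta (- (q * x\<^sup>2)) (q ^ 4) / (q * x\<^sup>2)"
        using theta_shift[OF q4, of "- (q * x\<^sup>2)"] that q by simp
      moreover have "q ^ 4 * - (q * x\<^sup>2) = - (q ^ 3 * (q * x)\<^sup>2)" "q ^ 3 * x\<^sup>2 = q * (q * x)\<^sup>2"
        by (simp_all add: power_mult_distrib power_numeral_reduce)
      ultimately show ?thesis
        using that q by (simp add: G_def field_simps power2_eq_square)
    qed
  qed simp
  then obtain k where k: "\<And>y. y \<noteq> 0 \<Longrightarrow> G y = k * theta (- y) q"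
    by auto
  define A where "A = qpoch q q"
  define B where "B = qpoch (- q) q"
  define C where "C = qpoch (- q) (q\<^sup>2)"
  define D where "D = qpoch (- (q\<^sup>2)) (q\<^sup>2)"
  have "theta (- q) (q ^ 4) = theta (- (q ^ 3)) (q ^ 4)"
    using theta_reflect[of "q ^ 4" "- q"] q pow by auto
  then have "G 1 = 2 * theta (- q) (q ^ 4)"
    by (simp add: G_def)
  also have "theta (- q) (q ^ 4) = C"
    using qpoch_even_odd[OF q2, of "- q"] pow by (simp add: theta_def C_def)
  finally have "2 * C = k * theta (- 1) q"
    using k[of 1] by simp
  also have "theta (- 1) q = 2 * B * B"
    using qpoch_rec[OF q(1), of "- 1"] by (simp add: theta_def B_def)
  finally have "C = k * B * B"
    by simp
  moreover have "B = C * D"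
    using qpoch_even_odd[OF q(1), of "- q"] by (simp add: B_def C_def D_def power2_eq_square)
  moreover have "B \<noteq> 0"
    using q by (simp add: B_def qpoch_nz)
  ultimately have kBD: "k * B * D = 1"
    by (auto simp: mult_ac)
  have "qpoch (q ^ 4) (q ^ 4) = A * B * D"
    using qpoch_square[OF q(1), of q] qpoch_square[OF q2, of "q\<^sup>2"] pow
    by (simp add: A_def B_def D_def)
  then have "qpoch (q ^ 4) (q ^ 4) * G y = A * (k * B * D) * theta (- y) q"
    using k[OF y] by (simp add: mult_ac)
  then show ?thesis
    using kBD by (simp add: A_def G_def)
qed

text \<open>The multiplier allows three zeros modulo powers of \<open>P\<close>, and evenness forces
  one of them at \<open>- 1 / p\<close>. What remains is determined by two values, and since
  \<open>tau u\<close> vanishes at \<open>u\<close> and \<open>tau v\<close> at \<open>v\<close>,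
  the formula is Lagrange interpolation.\<close>

lemma theta_even_interpolation:
  fixes p :: complex
  defines "P \<equiv> p\<^sup>2"
  defines "tau \<equiv> \<lambda>u x. theta (- (p * x)) P * theta (u * x) P * theta (u / x) P"
  assumes p: "norm p < 1" "p \<noteq> 0"
    and T: "T holomorphic_on - {0}" "\<And>x. x \<noteq> 0 \<Longrightarrow> T (1 / x) = T x"
      "\<And>x. x \<noteq> 0 \<Longrightarrow> T (P * x) = T x / (p * x) ^ 3"
    and u: "u \<noteq> 0" and v: "v \<noteq> 0" and x: "x \<noteq> 0"
    and nz: "theta (u\<^sup>2) P \<noteq> 0" "tau u v \<noteq> 0" "tau v u \<noteq> 0"
  shows "T x = T v * tau u x / tau u v + T u * tau v x / tau v u"
proof -
  have P: "norm P < 1" "P \<noteq> 0"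
    using p by (auto simp: P_def norm_power power_less_one_iff)
  have tau_hol: "tau w holomorphic_on - {0}" if "w \<noteq> 0" for w
    unfolding tau_def using P p that by (intro holomorphic_intros holomorphic_on_theta) auto
  have tau_inv: "tau w (1 / x) = tau w x" if "x \<noteq> 0" for w x
    using theta_reflect[OF P(2), of "- (p * x)"] p that
    by (simp add: tau_def P_def power2_eq_square mult_ac)
  have tau_P: "tau w (P * x) = tau w x / (p * x) ^ 3" if "x \<noteq> 0" "w \<noteq> 0" for w x
  proof -
    have "theta (- (p * (P * x))) P = theta (- (p * x)) P / (p * x)"
      using theta_shift[OF P, of "- (p * x)"] p that by (simp add: mult_ac)
    moreover have "theta (w * (P * x)) P = - theta (w * x) P / (w * x)"
      using theta_shift[OF P, of "w * x"] that by (simp add: mult_ac)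
    moreover have "theta (w / (P * x)) P = - (w / (P * x)) * theta (w / x) P"
      using theta_shift[OF P, of "w / (P * x)"] that P by (simp add: field_simps)
    ultimately have "tau w (P * x) = theta (- (p * x)) P / (p * x) * (- theta (w * x) P / (w * x)) *
        (- (w / (P * x)) * theta (w / x) P)"
      unfolding tau_def by simp
    also have "\<dots> = tau w x / (p * x) ^ 3"
      unfolding tau_def using that p
      by (simp add: P_def power2_eq_square power3_eq_cube mult_ac)
    finally show ?thesis .
  qed
  define D where "D x = T x - (T v * tau u x / tau u v + T u * tau v x / tau v u)" for x
  have "D holomorphic_on - {0}"
    unfolding D_def using u v nz by (intro holomorphic_intros T tau_hol) auto
  have D_inv: "D (1 / x) = D x" if "x \<noteq> 0" for x
    using that by (simp add: D_def T tau_inv)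
  have D_P: "D (P * x) = D x / (p * x) ^ 3" if "x \<noteq> 0" for x
    using that u v by (simp add: D_def T tau_P diff_divide_distrib add_divide_distrib mult.commute)
  have "tau u u = 0" "tau v v = 0"
    using u v P by (auto simp: tau_def)
  then have D0: "D u = 0" "D v = 0"
    using nz by (auto simp: D_def)
  \<comment> \<open>The points \<open>- 1 / p\<close> and \<open>- p\<close> are inverse to each
    other and also differ by the factor \<open>P\<close>. Evenness makes the two values equal, and
    the multiplier, which is \<open>- 1\<close> there, makes them opposite.\<close>
  have "D (- 1 / p) = - D (- p)"
    using D_P[of "- 1 / p"] D_inv[of "- 1 / p"] D_inv[of "- p"] p
    by (simp add: P_def power2_eq_square)
  moreover have "D (- 1 / p) = D (- p)"
    using D_inv[of "- p"] p by simp
  ultimately have "D (- 1 / p) = 0"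
    by simp
  moreover have "P * (- 1 / p ^ 3) = - 1 / p"
    using p by (simp add: P_def field_simps power_numeral_reduce)
  ultimately have Dw: "D (- 1 / p ^ 3) = 0"
    using D_P[of "- 1 / p ^ 3"] p by simp
  have th1: "theta (- (p * u)) P \<noteq> 0"
    using nz by (auto simp: tau_def)
  have th3: "theta (- (p ^ 3 * x)) P = theta (- (p * x)) P / (p * x)" if "x \<noteq> 0" for x
    using theta_shift[OF P, of "- (p * x)"] p that
    by (simp add: P_def power2_eq_square power3_eq_cube mult_ac)
  have th3': "theta (- 1 / p ^ 3 / x) P = theta (- (p ^ 3 * x)) P / (p ^ 3 * x)" if "x \<noteq> 0" for x
    using theta_inverse[OF P(1), of "- (p ^ 3 * x)"] p that by (simp add: field_simps)
  \<comment> \<open>The forced zero is represented by \<open>- 1 / p ^ 3\<close>, since the product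
    of the listed zeros has to reproduce the multiplier \<open>1 / (p * x) ^ 3\<close>.\<close>
  have "\<exists>k. \<forall>x. x \<noteq> 0 \<longrightarrow> D x = k * (\<Prod>u\<leftarrow>[u, 1 / u, - 1 / p ^ 3]. theta (x / u) P)"
  proof (rule theta_space[OF P])
    show "D holomorphic_on - {0}" by fact
    show "w \<noteq> 0 \<and> D w = 0" if "w \<in> set [u, 1 / u, - 1 / p ^ 3]" for w
      using that u p D0 Dw D_inv[of u] by auto
    show "sorted_wrt (\<lambda>u v. theta (v / u) P \<noteq> 0) [u, 1 / u, - 1 / p ^ 3]"
    proof -
      have "theta (1 / u / u) P \<noteq> 0"
        using theta_inverse[OF P(1), of "u\<^sup>2"] u nz by (simp add: power2_eq_square)
      moreover have "theta (- 1 / p ^ 3 / u) P \<noteq> 0"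
        using th3[of u] th3'[of u] th1 u p by simp
      moreover have "theta (- 1 / p ^ 3 / (1 / u)) P \<noteq> 0"
        using th3[of "1 / u"] th3'[of "1 / u"] th1 u p theta_reflect[OF P(2), of "- (p * u)"]
        by (simp add: P_def power2_eq_square)
      ultimately show ?thesis by simp
    qed
    show "D (P * x) = (- 1) ^ length [u, 1 / u, - 1 / p ^ 3] * prod_list [u, 1 / u, - 1 / p ^ 3] /
          x ^ length [u, 1 / u, - 1 / p ^ 3] * D x" if "x \<noteq> 0" for x
      using D_P[OF that] that u p by (simp add: power_mult_distrib field_simps power_numeral_reduce)
  qed
  then obtain k where k: "\<And>x. x \<noteq> 0 \<Longrightarrow> D x = k * (theta (x / u) P * theta (u * x) P * theta (- (p ^ 3 * x)) P)"
    using p by (auto simp: mult_ac)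
  have "theta (v / u) P \<noteq> 0"
    using nz by (auto simp: tau_def)
  moreover have "theta (u * v) P \<noteq> 0" "theta (- (p ^ 3 * v)) P \<noteq> 0"
    using nz th3[of v] v p by (auto simp: tau_def)
  ultimately have "k = 0"
    using k[OF v] D0 by auto
  then have "D x = 0"
    using k[OF x] by simp
  then show ?thesis
    by (simp add: D_def)
qed

text \<open>The zeros 1, \<open>a\<close> and \<open>1 / a\<close> have product 1, which is what the
  multiplier \<open>- 1 / z ^ 3\<close> demands; the conditions on \<open>a\<close> keep them
  distinct modulo powers of \<open>p\<close>.\<close>

lemma theta_odd_space:
  assumes p: "norm p < 1" "p \<noteq> 0" and a: "a \<noteq> 0" "theta a p \<noteq> 0" "theta (a\<^sup>2) p \<noteq> 0"
    and F: "F holomorphic_on - {0}" "F 1 = 0" "F a = 0" "F (1 / a) = 0"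
      "\<And>z. z \<noteq> 0 \<Longrightarrow> F (p * z) = - F z / z ^ 3"
  shows "\<exists>k. \<forall>z. z \<noteq> 0 \<longrightarrow> F z = k * (theta z p * theta (z / a) p * theta (z * a) p)"
proof -
  have "theta (1 / a) p \<noteq> 0" "theta (1 / a / a) p \<noteq> 0"
    using theta_inverse[OF p(1), of a] theta_inverse[OF p(1), of "a\<^sup>2"] a by (auto simp: power2_eq_square)
  then have "\<exists>k. \<forall>x. x \<noteq> 0 \<longrightarrow> F x = k * (\<Prod>u\<leftarrow>[1, a, 1 / a]. theta (x / u) p)"
    using a F by (intro theta_space[OF p]) (auto simp: power3_eq_cube)
  then show ?thesis
    by (auto simp: mult_ac)
qed

section \<open>Functional equations of the elliptic gamma function\<close>

lemma egamma_shift_q: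
  assumes "norm p < 1" "norm q < 1" "q \<noteq> 0" "x \<noteq> 0" "qpoch x p \<noteq> 0"
  shows "egamma (q * x) p q = theta x p * egamma x p q"
proof -
  have "qpoch2 (p / x) p q = qpoch (p / x) p * qpoch2 (p * q / x) p q"
    using qpoch2_rec'[OF assms(1,2), of "p / x"] by simp
  moreover have "qpoch2 x p q = qpoch x p * qpoch2 (q * x) p q"
    using qpoch2_rec'[OF assms(1,2), of x] by (simp add: mult.commute)
  moreover have "p * q / (q * x) = p / x"
    using assms by simp
  ultimately show ?thesis
    using assms by (simp add: egamma_def theta_def)
qed

lemma egamma_reflect:
  assumes "p \<noteq> 0" "q \<noteq> 0" "x \<noteq> 0"
  shows "egamma (p * q / x) p q = inverse (egamma x p q)"
  using assms by (simp add: egamma_def)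

lemma egamma_split:
  assumes "norm p < 1" "p \<noteq> 0" "norm q < 1" "x \<noteq> 0"
  shows "egamma x p q = egamma x (p\<^sup>2) q * egamma (p * x) (p\<^sup>2) q"
proof -
  have "qpoch2 (p * q / x) p q = qpoch2 (p\<^sup>2 * q / (p * x)) (p\<^sup>2) q * qpoch2 (p\<^sup>2 * q / x) (p\<^sup>2) q"
    using qpoch2_even_odd[OF assms(1,3), of "p * q / x"] assms by (simp add: power2_eq_square mult_ac)
  moreover have "qpoch2 x p q = qpoch2 x (p\<^sup>2) q * qpoch2 (p * x) (p\<^sup>2) q"
    using qpoch2_even_odd[OF assms(1,3), of x] by (simp add: mult.commute)
  ultimately show ?thesis
    by (simp add: egamma_def)
qed

section \<open>Contour integrals\<close>

text \<open>Balls of half the isolation radius are pairwise disjoint, and only countably many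
  disjoint open sets fit into the reals.\<close>

lemma countable_isolated_reals:
  fixes Z :: "real set"
  assumes "\<And>t. t \<in> Z \<Longrightarrow> \<exists>d>0. \<forall>s\<in>Z. s \<noteq> t \<longrightarrow> d \<le> \<bar>s - t\<bar>"
  shows "countable Z"
proof -
  obtain d where d: "\<And>t. t \<in> Z \<Longrightarrow> d t > 0" "\<And>s t. t \<in> Z \<Longrightarrow> s \<in> Z \<Longrightarrow> s \<noteq> t \<Longrightarrow> d t \<le> \<bar>s - t\<bar>"
    using assms by metis
  define B where "B t = ball t (d t / 2)" for t
  have disj: "B s \<inter> B t = {}" if "s \<in> Z" "t \<in> Z" "s \<noteq> t" for s t
  proof -
    have "d t \<le> \<bar>s - t\<bar>" "d s \<le> \<bar>s - t\<bar>"
      using d(2)[of t s] d(2)[of s t] that by (auto simp: abs_minus_commute)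
    then show ?thesis
      unfolding B_def by (intro disjoint_ballI) (auto simp: dist_real_def)
  qed
  have "countable (B ` Z)"
  proof (rule countable_disjoint_open_subsets)
    show "open S" if "S \<in> B ` Z" for S
      using that by (auto simp: B_def)
    show "disjoint (B ` Z)"
      using disj by (fastforce simp: disjoint_def)
  qed
  moreover have "inj_on B Z"
  proof (rule inj_onI, rule ccontr)
    fix s t assume "s \<in> Z" "t \<in> Z" "B s = B t" "s \<noteq> t"
    moreover have "s \<in> B s"
      using d(1) \<open>s \<in> Z\<close> by (simp add: B_def)
    ultimately show False
      using disj[of s t] by auto
  qed
  ultimately show ?thesis
    by (rule countable_image_inj_on)
qed

text \<open>A path with a nonzero derivative at a point of a fibre leaves that fibre at once; where the
  derivative vanishes the value of the integrand is irrelevant.\<close>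

lemma contour_integral_cong_countable:
  assumes "valid_path \<gamma>" "countable C" "\<And>z. z \<in> path_image \<gamma> - C \<Longrightarrow> f z = g z"
  shows "contour_integral \<gamma> f = contour_integral \<gamma> g"
proof -
  obtain S where S: "finite S" "\<gamma> C1_differentiable_on {0..1} - S"
    using assms(1) by (auto simp: valid_path_def piecewise_C1_differentiable_on_def)
  define Z where "Z c = {t \<in> {0..1} - S. \<gamma> t = c \<and> vector_derivative \<gamma> (at t) \<noteq> 0}" for c
  have "countable (Z c)" for c
  proof (rule countable_isolated_reals)
    fix t assume t: "t \<in> Z c"
    define v where "v = vector_derivative \<gamma> (at t)"
    have v: "v \<noteq> 0" and "\<gamma> t = c"
      using t by (auto simp: Z_def v_def)
    have "(\<gamma> has_vector_derivative v) (at t)"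
      using S(2) t unfolding C1_differentiable_on_eq v_def by (auto simp: Z_def vector_derivative_works)
    then have "((\<lambda>s. norm (\<gamma> s - \<gamma> t - (s - t) *\<^sub>R v) / norm (s - t)) \<longlongrightarrow> 0) (at t)"
      by (simp add: has_vector_derivative_def has_derivative_iff_norm)
    then have "\<forall>\<^sub>F s in at t. norm (\<gamma> s - \<gamma> t - (s - t) *\<^sub>R v) / norm (s - t) < norm v"
      using v by (intro order_tendstoD) auto
    then obtain d where d: "d > 0" "\<And>s. s \<noteq> t \<Longrightarrow> dist s t < d \<Longrightarrow>
        norm (\<gamma> s - \<gamma> t - (s - t) *\<^sub>R v) / norm (s - t) < norm v"
      unfolding eventually_at by blast
    have "d \<le> \<bar>s - t\<bar>" if "s \<in> Z c" "s \<noteq> t" for s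
    proof (rule ccontr)
      assume "\<not> d \<le> \<bar>s - t\<bar>"
      then have "norm (\<gamma> s - \<gamma> t - (s - t) *\<^sub>R v) / norm (s - t) < norm v"
        using that by (intro d) (auto simp: dist_real_def)
      then show False
        using that t by (simp add: Z_def)
    qed
    then show "\<exists>d>0. \<forall>s\<in>Z c. s \<noteq> t \<longrightarrow> d \<le> \<bar>s - t\<bar>"
      using d(1) by blast
  qed
  then have "countable (S \<union> (\<Union>c\<in>C. Z c))"
    using assms(2) S(1) by (auto simp: countable_finite)
  then have "negligible (\<Union>t\<in>S \<union> (\<Union>c\<in>C. Z c). {t})"
    by (intro negligible_countable_Union) auto
  then have "negligible (S \<union> (\<Union>c\<in>C. Z c))"
    by simp
  then show ?thesis
    unfolding contour_integral_integral
  proof (rule integral_spike)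
    fix t assume t: "t \<in> {0..1} - (S \<union> (\<Union>c\<in>C. Z c))"
    show "g (\<gamma> t) * vector_derivative \<gamma> (at t) = f (\<gamma> t) * vector_derivative \<gamma> (at t)"
    proof (cases "\<gamma> t \<in> C")
      case True
      then have "vector_derivative \<gamma> (at t) = 0"
        using t by (auto simp: Z_def)
      then show ?thesis by simp
    next
      case False
      then have "f (\<gamma> t) = g (\<gamma> t)"
        using t by (intro assms(3)) (auto simp: path_image_def)
      then show ?thesis by simp
    qed
  qed
qed

lemma contour_integral_cmult:
  "contour_integral \<gamma> (\<lambda>x. c * f x) = c * contour_integral \<gamma> f"
proof (cases "c = 0 \<or> f contour_integrable_on \<gamma>")
  case True
  then show ?thesis
    by (auto simp: contour_integral_lmul)
next
  case False
  then show ?thesis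
    using not_integrable_contour_integral[of f \<gamma>] not_integrable_contour_integral[of "\<lambda>x. c * f x" \<gamma>]
    by (simp add: contour_integrable_lmul_iff)
qed

text \<open>Cauchy's inequality on discs of radius \<open>r / 2\<close> bounds the second derivative
  by \<open>2 * M / (r / 2)^2\<close>, the source of \<open>8 * M / r^2\<close>. The bound involves
  \<open>g\<close> only through \<open>M\<close>, so it is uniform over a family of
  functions.\<close>

lemma holomorphic_second_order_bound:
  assumes r: "r > 0" and hol: "g holomorphic_on ball u0 (2 * r)"
    and bd: "\<And>u. u \<in> ball u0 (2 * r) \<Longrightarrow> norm (g u) \<le> M" and u: "norm (u - u0) < r"
  shows "norm (g u - g u0 - deriv g u0 * (u - u0)) \<le> 8 * M / r\<^sup>2 * (norm (u - u0))\<^sup>2"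
proof -
  have b2: "norm ((deriv ^^ 2) g w) \<le> 8 * M / r\<^sup>2" if w: "w \<in> ball u0 r" for w
  proof -
    have sub: "cball w (r / 2) \<subseteq> ball u0 (2 * r)"
    proof
      fix x assume "x \<in> cball w (r / 2)"
      then have "dist u0 x \<le> dist u0 w + r / 2"
        using dist_triangle[of u0 x w] by simp
      then show "x \<in> ball u0 (2 * r)"
        using w r by simp
    qed
    have "norm ((deriv ^^ 2) g w) \<le> fact 2 * M / (r / 2) ^ 2"
    proof (rule Cauchy_inequality)
      show "g holomorphic_on ball w (r / 2)"
        using hol sub by (meson ball_subset_cball holomorphic_on_subset subset_trans)
      show "continuous_on (cball w (r / 2)) g"
        using hol sub by (meson holomorphic_on_imp_continuous_on holomorphic_on_subset)
      show "norm (g x) \<le> M" if "norm (w - x) = r / 2" for x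
        using sub that by (intro bd) (auto simp: dist_norm)
    qed (use r in auto)
    then show ?thesis
      by (simp add: power_divide mult.commute)
  qed
  have hol': "(deriv ^^ i) g holomorphic_on ball u0 r" for i
    using hol r by (intro holomorphic_higher_deriv) (auto elim!: holomorphic_on_subset)
  have "norm ((deriv ^^ 0) g u - (\<Sum>i\<le>1. (deriv ^^ i) g u0 * (u - u0) ^ i / fact i))
          \<le> 8 * M / r\<^sup>2 * norm (u - u0) ^ Suc 1 / fact 1"
  proof (rule complex_Taylor[where S = "ball u0 r" and f = "\<lambda>i. (deriv ^^ i) g"])
    fix i x assume "x \<in> ball u0 r"
    then show "((deriv ^^ i) g has_field_derivative (deriv ^^ Suc i) g x) (at x within ball u0 r)"
      using holomorphic_derivI[OF hol'[of i] open_ball, of x] by (simp add: has_field_derivative_at_within)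
  qed (use b2 u r in \<open>auto simp: dist_norm norm_minus_commute numeral_2_eq_2\<close>)
  then show ?thesis
    by (simp add: power2_eq_square algebra_simps)
qed

text \<open>The second-order bound makes the difference quotients in \<open>u\<close> converge
  uniformly along the path. A polynomial path has a continuous, hence bounded, derivative, so the
  limit passes through the integral.\<close>

lemma contour_integral_param_holomorphic:
  assumes U: "open U" and \<gamma>: "polynomial_function \<gamma>"
    and cont: "continuous_on (U \<times> path_image \<gamma>) (\<lambda>(u, x). f u x)"
    and hol: "\<And>x. x \<in> path_image \<gamma> \<Longrightarrow> (\<lambda>u. f u x) holomorphic_on U"
  shows "(\<lambda>u. contour_integral \<gamma> (f u)) holomorphic_on U"
proof -
  have vp: "valid_path \<gamma>"
    using \<gamma> by (rule valid_path_polynomial_function)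
  obtain \<gamma>' where \<gamma>': "polynomial_function \<gamma>'" "\<And>x. (\<gamma> has_vector_derivative \<gamma>' x) (at x)"
    using has_vector_derivative_polynomial_function[OF \<gamma>] by blast
  have "compact (\<gamma>' ` {0..1})"
    using \<gamma>'(1) by (intro compact_continuous_image continuous_on_polymonial_function) auto
  then obtain B where B: "\<And>t. t \<in> {0..1} \<Longrightarrow> norm (\<gamma>' t) \<le> B"
    by (metis bounded_iff compact_imp_bounded imageI)
  have cont_x: "continuous_on (path_image \<gamma>) (f u)" if "u \<in> U" for u
  proof -
    have "continuous_on (path_image \<gamma>) ((\<lambda>(u, x). f u x) \<circ> (\<lambda>x. (u, x)))"
      using that by (intro continuous_on_compose continuous_intros continuous_on_subset[OF cont]) auto
    then show ?thesis by (simp add: o_def)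
  qed
  have int: "f u contour_integrable_on \<gamma>" if "u \<in> U" for u
  proof -
    have "continuous_on {0..1} \<gamma>"
      using \<gamma> by (rule continuous_on_polymonial_function)
    then have "continuous_on {0..1} (\<lambda>t. f u (\<gamma> t) * \<gamma>' t)"
      using continuous_on_compose2[OF cont_x[OF that], of "{0..1}" \<gamma>] continuous_on_polymonial_function[OF \<gamma>'(1)]
      by (intro continuous_on_mult) (auto simp: path_image_def)
    then have "(\<lambda>t. f u (\<gamma> t) * \<gamma>' t) integrable_on {0..1}"
      by (rule integrable_continuous_interval)
    then show ?thesis
      unfolding contour_integrable_on using vector_derivative_at[OF \<gamma>'(2)] by simp
  qed
  have "\<exists>D. ((\<lambda>u. contour_integral \<gamma> (f u)) has_field_derivative D) (at u0)" if u0: "u0 \<in> U" for u0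
  proof -
    obtain e where e: "e > 0" "cball u0 e \<subseteq> U"
      using U u0 open_contains_cball by blast
    define r where "r = e / 2"
    have r: "r > 0" "ball u0 (2 * r) \<subseteq> U"
      using e by (auto simp: r_def)
    have "compact (cball u0 e \<times> path_image \<gamma>)"
      using vp by (intro compact_Times compact_cball compact_path_image valid_path_imp_path)
    moreover have "continuous_on (cball u0 e \<times> path_image \<gamma>) (\<lambda>(u, x). f u x)"
      using e by (intro continuous_on_subset[OF cont]) auto
    ultimately obtain M where M: "M \<ge> 0" "\<And>z. z \<in> cball u0 e \<times> path_image \<gamma> \<Longrightarrow> norm (case z of (u, x) \<Rightarrow> f u x) \<le> M"
      using compact_norm_bound by blast
    have bound: "norm (f u x - f u0 x - deriv (\<lambda>u. f u x) u0 * (u - u0)) \<le> 8 * M / r\<^sup>2 * (norm (u - u0))\<^sup>2"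
      if "x \<in> path_image \<gamma>" "norm (u - u0) < r" for u x
    proof (rule holomorphic_second_order_bound[OF r(1)])
      show "(\<lambda>u. f u x) holomorphic_on ball u0 (2 * r)"
        using hol[OF that(1)] r(2) by (rule holomorphic_on_subset)
      show "norm (f u x) \<le> M" if "u \<in> ball u0 (2 * r)" for u
        using M(2)[of "(u, x)"] that \<open>x \<in> path_image \<gamma>\<close> by (simp add: r_def)
    qed fact
    define q where "q = (\<lambda>u x. (f u x - f u0 x) / (u - u0))"
    define l where "l x = deriv (\<lambda>u. f u x) u0" for x
    have near: "\<forall>\<^sub>F u in at u0. norm (u - u0) < d \<and> u \<noteq> u0" if "d > 0" for d
      using that by (auto simp: eventually_at dist_norm)
    have "uniform_limit (path_image \<gamma>) q l (at u0)"
    proof (rule uniform_limitI)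
      fix \<epsilon> :: real assume \<epsilon>: "\<epsilon> > 0"
      define C where "C = 8 * M / r\<^sup>2"
      have C: "C \<ge> 0"
        using M by (simp add: C_def)
      define d where "d = min r (\<epsilon> / (C + 1))"
      have "d > 0"
        using r \<epsilon> C by (simp add: d_def)
      from near[OF this] show "\<forall>\<^sub>F u in at u0. \<forall>x\<in>path_image \<gamma>. dist (q u x) (l x) < \<epsilon>"
      proof (rule eventually_mono, intro ballI)
        fix u x assume u: "norm (u - u0) < d \<and> u \<noteq> u0" and x: "x \<in> path_image \<gamma>"
        then have pos: "norm (u - u0) > 0" by simp
        have "q u x - l x = (f u x - f u0 x - deriv (\<lambda>u. f u x) u0 * (u - u0)) / (u - u0)"
          using u by (simp add: q_def l_def field_simps)
        then have "norm (q u x - l x) = norm (f u x - f u0 x - deriv (\<lambda>u. f u x) u0 * (u - u0)) / norm (u - u0)"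
          by (simp add: norm_divide)
        also have "\<dots> \<le> C * (norm (u - u0))\<^sup>2 / norm (u - u0)"
          using bound[OF x, of u] u by (intro divide_right_mono) (auto simp: C_def d_def)
        also have "\<dots> = C * norm (u - u0)"
          using pos by (simp add: power2_eq_square)
        also have "\<dots> \<le> C * (\<epsilon> / (C + 1))"
          using u C by (intro mult_left_mono) (auto simp: d_def)
        also have "\<dots> < \<epsilon>"
          using C \<epsilon> by (simp add: field_simps)
        finally show "dist (q u x) (l x) < \<epsilon>"
          by (simp add: dist_norm)
      qed
    qed
    moreover have ev: "\<forall>\<^sub>F u in at u0. u \<in> U \<and> u \<noteq> u0"
      using near[OF r(1)] by eventually_elim (use r in \<open>auto simp: dist_norm norm_minus_commute subset_iff\<close>)
    moreover have "\<forall>\<^sub>F u in at u0. q u contour_integrable_on \<gamma>"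
      using ev by eventually_elim
        (auto simp: q_def intro!: contour_integrable_div contour_integrable_diff int u0)
    ultimately have "((\<lambda>u. contour_integral \<gamma> (q u)) \<longlongrightarrow> contour_integral \<gamma> l) (at u0)"
      by (intro contour_integral_uniform_limit(2)[where B = B] vp) (auto simp: vector_derivative_at[OF \<gamma>'(2)] B)
    moreover have "\<forall>\<^sub>F u in at u0. contour_integral \<gamma> (q u) =
        (contour_integral \<gamma> (f u) - contour_integral \<gamma> (f u0)) / (u - u0)"
      using ev by eventually_elim
        (auto simp: q_def contour_integral_div contour_integral_diff contour_integrable_diff int u0)
    ultimately have "((\<lambda>u. (contour_integral \<gamma> (f u) - contour_integral \<gamma> (f u0)) / (u - u0)) \<longlongrightarrow>
        contour_integral \<gamma> l) (at u0)"
      by (rule Lim_transform_eventually)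
    then show ?thesis
      unfolding has_field_derivative_iff by blast
  qed
  then show ?thesis
    using U by (auto simp: holomorphic_on_open)
qed

text \<open>Joined inside \<Omega> by a path run forth and back, \<open>g\<close> and the reversed
  \<open>h\<close> form a loop that does not wind around any point outside \<Omega>. The global
  Cauchy theorem applies, and the connecting path cancels.\<close>

lemma contour_integral_eq_same_winding:
  assumes \<Omega>: "open \<Omega>" "connected \<Omega>" and f: "f holomorphic_on \<Omega>"
    and g: "valid_path g" "pathfinish g = pathstart g" "path_image g \<subseteq> \<Omega>"
    and h: "valid_path h" "pathfinish h = pathstart h" "path_image h \<subseteq> \<Omega>"
    and wn: "\<And>w. w \<notin> \<Omega> \<Longrightarrow> winding_number g w = winding_number h w"
  shows "contour_integral g f = contour_integral h f"
proof -
  have "pathstart g \<in> \<Omega>" "pathstart h \<in> \<Omega>"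
    using g(3) h(3) by auto
  then obtain c where c: "polynomial_function c" "path_image c \<subseteq> \<Omega>" "pathstart c = pathstart g" "pathfinish c = pathstart h"
    using connected_open_polynomial_connected[OF \<Omega>] by blast
  have vc: "valid_path c"
    using c(1) by (rule valid_path_polynomial_function)
  note paths = valid_path_imp_path[OF g(1)] valid_path_imp_path[OF h(1)] valid_path_imp_path[OF vc]
  define \<Gamma> where "\<Gamma> = g +++ (c +++ (reversepath h +++ reversepath c))"
  have "(f has_contour_integral 0) \<Gamma>"
  proof (rule Cauchy_theorem_global[OF \<Omega>(1) f])
    show "valid_path \<Gamma>" "pathfinish \<Gamma> = pathstart \<Gamma>" "path_image \<Gamma> \<subseteq> \<Omega>"
      unfolding \<Gamma>_def using g h c vc by (auto simp: path_image_join)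
    fix w assume w: "w \<notin> \<Omega>"
    then have "w \<notin> path_image g" "w \<notin> path_image h" "w \<notin> path_image c"
      using g h c by auto
    then show "winding_number \<Gamma> w = 0"
      unfolding \<Gamma>_def using g h c paths wn[OF w]
      by (simp add: winding_number_join winding_number_reversepath path_image_join)
  qed
  then have "contour_integral \<Gamma> f = 0"
    by (rule contour_integral_unique)
  moreover have "f contour_integrable_on g" "f contour_integrable_on h" "f contour_integrable_on c"
    using contour_integrable_holomorphic_simple[OF f \<Omega>(1)] g h c vc by auto
  then have "contour_integral \<Gamma> f = contour_integral g f - contour_integral h f"
    unfolding \<Gamma>_def using g h c vc
    by (simp add: contour_integrable_reversepath contour_integral_reversepath)
  ultimately show ?thesis
    by simp
qed

text \<open>The approximation is so close that the straight segments between corresponding points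
  stay in \<Omega>; the linear homotopy then preserves winding numbers about outside points.\<close>

lemma polynomial_loop_same_winding:
  assumes \<Omega>: "open \<Omega>" and g: "path g" "pathfinish g = pathstart g" "path_image g \<subseteq> \<Omega>"
  obtains h where "polynomial_function h" "pathfinish h = pathstart h" "path_image h \<subseteq> \<Omega>"
    "\<And>w. w \<notin> \<Omega> \<Longrightarrow> winding_number h w = winding_number g w"
proof -
  obtain e where e: "e > 0" "(\<Union>x\<in>path_image g. ball x e) \<subseteq> \<Omega>"
    using compact_subset_open_imp_ball_epsilon_subset[OF compact_path_image[OF g(1)] \<Omega> g(3)] by blast
  obtain h where h: "polynomial_function h" "pathstart h = pathstart g" "pathfinish h = pathfinish g"
    "\<And>t. t \<in> {0..1} \<Longrightarrow> norm (h t - g t) < e"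
    using path_approx_polynomial_function[OF g(1) e(1)] by blast
  have seg: "closed_segment (g t) (h t) \<subseteq> \<Omega>" if "t \<in> {0..1}" for t
  proof -
    have "closed_segment (g t) (h t) \<subseteq> ball (g t) e"
      using h(4)[OF that] e(1)
      by (intro closed_segment_subset convex_ball) (auto simp: dist_norm norm_minus_commute)
    also have "\<dots> \<subseteq> \<Omega>"
      using e(2) that by (force simp: path_image_def)
    finally show ?thesis .
  qed
  show ?thesis
  proof
    show "polynomial_function h" by fact
    show "pathfinish h = pathstart h"
      using h g by simp
    show "path_image h \<subseteq> \<Omega>"
      using seg by (force simp: path_image_def)
    show "winding_number h w = winding_number g w" if "w \<notin> \<Omega>" for w
      using h g seg that
      by (intro winding_number_loops_linear_eq) (auto simp: path_polynomial_function)
  qed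
qed

section \<open>Separating cycles\<close>

text \<open>\<open>D\<close> is an entire function whose zeros are the points that the cycle must leave outside; the
  inverses of these zeros must lie inside.\<close>

definition sep_cycle :: "(complex \<Rightarrow> complex) \<Rightarrow> (real \<Rightarrow> complex) \<Rightarrow> bool" where
  "sep_cycle D \<Gamma> \<longleftrightarrow>
     valid_path \<Gamma> \<and> pathfinish \<Gamma> = pathstart \<Gamma> \<and> 0 \<notin> path_image \<Gamma> \<and> winding_number \<Gamma> 0 = 1 \<and>
     (\<forall>y. y \<noteq> 0 \<longrightarrow>
       (D y = 0 \<longrightarrow> y \<notin> path_image \<Gamma> \<and> winding_number \<Gamma> y = 0) \<and>
       (D (1 / y) = 0 \<longrightarrow> y \<notin> path_image \<Gamma> \<and> winding_number \<Gamma> y = 1))"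

text \<open>The invariant form \<open>dx / (2 * pi * i * x)\<close> is unchanged by scaling, changes
  sign under inversion, and pulls back to \<open>dt\<close> under \<open>e2pi\<close>.\<close>

definition cycle_integral :: "(real \<Rightarrow> complex) \<Rightarrow> (complex \<Rightarrow> complex) \<Rightarrow> complex" where
  "cycle_integral \<Gamma> f = contour_integral \<Gamma> (\<lambda>x. f x / x) / (2 * of_real pi * \<i>)"

text \<open>Two functions are allowed because the telescoping function of the beta kernel has inner
  poles carrying an extra factor \<open>q\<close>: there \<open>E\<close> is \<open>D\<close>
  composed with multiplication by \<open>q\<close>.\<close>

definition zero_free :: "(complex \<Rightarrow> complex) \<Rightarrow> (complex \<Rightarrow> complex) \<Rightarrow> complex set" where
  "zero_free D E = {x. x \<noteq> 0 \<and> D x \<noteq> 0 \<and> E (1 / x) \<noteq> 0}"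

lemma sep_cycleD:
  assumes "sep_cycle D \<Gamma>"
  shows "valid_path \<Gamma>" "path \<Gamma>" "pathfinish \<Gamma> = pathstart \<Gamma>" "0 \<notin> path_image \<Gamma>" "winding_number \<Gamma> 0 = 1"
    "\<And>y. y \<noteq> 0 \<Longrightarrow> D y = 0 \<Longrightarrow> y \<notin> path_image \<Gamma>" "\<And>y. y \<noteq> 0 \<Longrightarrow> D y = 0 \<Longrightarrow> winding_number \<Gamma> y = 0"
    "\<And>y. y \<noteq> 0 \<Longrightarrow> D (1 / y) = 0 \<Longrightarrow> y \<notin> path_image \<Gamma>" "\<And>y. y \<noteq> 0 \<Longrightarrow> D (1 / y) = 0 \<Longrightarrow> winding_number \<Gamma> y = 1"
  using assms by (auto simp: sep_cycle_def valid_path_imp_path)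

lemma sep_cycle_mono:
  assumes "sep_cycle D \<Gamma>" "\<And>y. y \<noteq> 0 \<Longrightarrow> E y = 0 \<Longrightarrow> D y = 0"
  shows "sep_cycle E \<Gamma>"
  using assms(1) assms(2)[of "1 / y" for y] assms(2) unfolding sep_cycle_def by simp

lemma sep_cycle_zero_free:
  "sep_cycle D \<Gamma> \<Longrightarrow> path_image \<Gamma> \<subseteq> zero_free D D"
proof
  fix x assume \<Gamma>: "sep_cycle D \<Gamma>" and x: "x \<in> path_image \<Gamma>"
  then have "x \<noteq> 0"
    using sep_cycleD(4) by blast
  then show "x \<in> zero_free D D"
    using sep_cycleD(6,8)[OF \<Gamma>, of x] x by (auto simp: zero_free_def)
qed

lemma countable_zeros_entire:
  assumes "D holomorphic_on UNIV" "D 0 \<noteq> 0"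
  shows "countable {z. D z = 0}"
proof (cases "D constant_on UNIV")
  case True
  then have "{z. D z = 0} = {}"
    using assms(2) by (auto simp: constant_on_def)
  then show ?thesis by (metis countable_empty)
next
  case False
  then show ?thesis
    using holomorphic_countable_zeros[OF assms(1) open_UNIV connected_UNIV] by simp
qed

lemma finite_zeros_entire:
  assumes "D holomorphic_on UNIV" "D 0 \<noteq> 0" "compact K"
  shows "finite {z \<in> K. D z = 0}"
proof (cases "D constant_on UNIV")
  case True
  then have "{z \<in> K. D z = 0} = {}"
    using assms(2) by (auto simp: constant_on_def)
  then show ?thesis by (metis finite.emptyI)
next
  case False
  then show ?thesis
    using holomorphic_compact_finite_zeros[OF assms(1) open_UNIV connected_UNIV assms(3)] by simp
qed

text \<open>An entire function that is nonzero at 0 has countably many zeros, and the plane stays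
  connected when countably many points are removed.\<close>

lemma zero_free_open_connected:
  assumes D: "D holomorphic_on UNIV" "D 0 \<noteq> 0" and E: "E holomorphic_on UNIV" "E 0 \<noteq> 0"
  shows "open (zero_free D E)" "connected (zero_free D E)"
proof -
  have "continuous_on (- {0}) (\<lambda>x. D x * E (1 / x))"
    by (intro continuous_intros continuous_on_compose2[OF holomorphic_on_imp_continuous_on[OF E(1)]]
        holomorphic_on_imp_continuous_on[OF holomorphic_on_subset[OF D(1)]]) auto
  then have "open {x \<in> - {0}. D x * E (1 / x) \<noteq> 0}"
    by (intro open_nonzeros) auto
  moreover have "{x \<in> - {0}. D x * E (1 / x) \<noteq> 0} = zero_free D E"
    by (auto simp: zero_free_def)
  ultimately show "open (zero_free D E)" by simp
  have "countable ({0} \<union> {z. D z = 0} \<union> (\<lambda>z. 1 / z) ` {z. E z = 0})"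
    using countable_zeros_entire[OF D] countable_zeros_entire[OF E] by auto
  then have "connected (UNIV - ({0} \<union> {z. D z = 0} \<union> (\<lambda>z. 1 / z) ` {z. E z = 0}))"
    by (intro connected_open_diff_countable) auto
  moreover have "UNIV - ({0} \<union> {z. D z = 0} \<union> (\<lambda>z. 1 / z) ` {z. E z = 0}) = zero_free D E"
  proof -
    have "x \<in> (\<lambda>z. 1 / z) ` {z. E z = 0} \<longleftrightarrow> E (1 / x) = 0" if "x \<noteq> 0" for x
      using that by (auto simp: image_iff intro!: exI[of _ "1 / x"])
    then show ?thesis
      by (auto simp: zero_free_def)
  qed
  ultimately show "connected (zero_free D E)" by simp
qed

lemma zero_free_nz: "x \<in> zero_free D E \<Longrightarrow> x \<noteq> 0"
  by (simp add: zero_free_def)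

lemma cycle_integral_eq:
  assumes D: "D holomorphic_on UNIV" "D 0 \<noteq> 0" and f: "f holomorphic_on zero_free D D"
    and \<Gamma>: "sep_cycle D \<Gamma>1" "sep_cycle D \<Gamma>2"
  shows "cycle_integral \<Gamma>1 f = cycle_integral \<Gamma>2 f"
proof -
  have "contour_integral \<Gamma>1 (\<lambda>x. f x / x) = contour_integral \<Gamma>2 (\<lambda>x. f x / x)"
  proof (rule contour_integral_eq_same_winding[OF zero_free_open_connected[OF D D]])
    show "(\<lambda>x. f x / x) holomorphic_on zero_free D D"
      using f zero_free_nz by (intro holomorphic_intros) auto
    show "winding_number \<Gamma>1 w = winding_number \<Gamma>2 w" if "w \<notin> zero_free D D" for w
      using that sep_cycleD(5,7,9)[OF \<Gamma>(1)] sep_cycleD(5,7,9)[OF \<Gamma>(2)] by (cases "w = 0") (auto simp: zero_free_def)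
  qed (use \<Gamma> sep_cycle_zero_free sep_cycleD(1,3) in auto)
  then show ?thesis
    by (simp add: cycle_integral_def)
qed

text \<open>Inversion exchanges the zeros of \<open>D\<close> with their inverses and reverses the
  orientation about 0. The inverted loop run backwards is therefore again a separating cycle, and
  the integral does not distinguish such cycles.\<close>

lemma cycle_integral_inverse:
  assumes D: "D holomorphic_on UNIV" "D 0 \<noteq> 0" and f: "f holomorphic_on zero_free D D"
    and \<Gamma>: "sep_cycle D \<Gamma>"
  shows "cycle_integral \<Gamma> (\<lambda>x. f (1 / x)) = cycle_integral \<Gamma> f"
proof -
  note c = sep_cycleD[OF \<Gamma>]
  have nz: "x \<noteq> 0" if "x \<in> path_image \<Gamma>" for x
    using that c(4) by auto
  have an: "(\<lambda>x. 1 / x :: complex) analytic_on - {0}"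
    by (intro analytic_intros) auto
  have der: "deriv (\<lambda>x. 1 / x :: complex) x = - (1 / x\<^sup>2)" if "x \<noteq> 0" for x
    using that by (intro DERIV_imp_deriv) (auto intro!: derivative_eq_intros simp: power2_eq_square)
  define h where "h = (\<lambda>x. 1 / x) \<circ> \<Gamma>"
  have vh: "valid_path h"
    unfolding h_def
    by (rule valid_path_compose_holomorphic[OF c(1) analytic_imp_holomorphic[OF an]]) (use nz in auto)
  have int: "contour_integral h F = contour_integral \<Gamma> (\<lambda>w. - (1 / w\<^sup>2) * F (1 / w))" for F
  proof -
    have "contour_integral h F = contour_integral \<Gamma> (\<lambda>w. deriv (\<lambda>x. 1 / x) w * F (1 / w))"
      unfolding h_def by (rule contour_integral_comp_analyticW[OF an c(1)]) (use nz in auto)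
    also have "\<dots> = contour_integral \<Gamma> (\<lambda>w. - (1 / w\<^sup>2) * F (1 / w))"
      by (rule contour_integral_cong) (use nz der in auto)
    finally show ?thesis .
  qed
  have im: "y \<in> path_image h \<longleftrightarrow> 1 / y \<in> path_image \<Gamma>" if "y \<noteq> 0" for y
    using that by (auto simp: h_def path_image_compose image_iff intro!: bexI[of _ "1 / y"])
  have im0: "0 \<notin> path_image h"
    using nz by (auto simp: h_def path_image_compose image_iff)
  have "contour_integral h (\<lambda>w. 1 / (w - 0)) = contour_integral \<Gamma> (\<lambda>w. - (1 / (w - 0)))"
    unfolding int by (rule contour_integral_cong) (use nz in \<open>auto simp: power2_eq_square\<close>)
  also have "\<dots> = - contour_integral \<Gamma> (\<lambda>w. 1 / (w - 0))"
    by (rule contour_integral_neg)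
  finally have w0: "winding_number h 0 = - 1"
    using winding_number_valid_path[OF vh im0] winding_number_valid_path[OF c(1) c(4)] c(5) by simp
  \<comment> \<open>Pulling back \<open>1 / (w - y)\<close> creates a second pole, at 0; the
    \<open>- 1\<close> is its contribution.\<close>
  have wy: "winding_number h y = winding_number \<Gamma> (1 / y) - 1" if y: "y \<noteq> 0" "1 / y \<notin> path_image \<Gamma>" for y
  proof -
    have "contour_integral h (\<lambda>w. 1 / (w - y)) = contour_integral \<Gamma> (\<lambda>w. 1 / (w - 1 / y) - 1 / (w - 0))"
      unfolding int
    proof (rule contour_integral_cong[OF refl])
      fix w assume w: "w \<in> path_image \<Gamma>"
      then have "w \<noteq> 0" "w \<noteq> 1 / y"
        using nz y by auto
      moreover from this have "y * w \<noteq> 1"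
        using y by (auto simp: field_simps)
      ultimately show "- (1 / w\<^sup>2) * (1 / (1 / w - y)) = 1 / (w - 1 / y) - 1 / (w - 0)"
        using y by (auto simp: divide_simps power2_eq_square)
    qed
    also have "\<dots> = contour_integral \<Gamma> (\<lambda>w. 1 / (w - 1 / y)) - contour_integral \<Gamma> (\<lambda>w. 1 / (w - 0))"
      using c(1,4) y by (intro contour_integral_diff contour_integrable_inversediff)
    finally have eq: "contour_integral h (\<lambda>w. 1 / (w - y)) =
      contour_integral \<Gamma> (\<lambda>w. 1 / (w - 1 / y)) - contour_integral \<Gamma> (\<lambda>w. 1 / (w - 0))" .
    have "y \<notin> path_image h"
      using im y by blast
    then have "winding_number h y = 1 / (2 * pi * \<i>) * contour_integral h (\<lambda>w. 1 / (w - y))"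
      by (rule winding_number_valid_path[OF vh])
    also have "\<dots> = 1 / (2 * pi * \<i>) * contour_integral \<Gamma> (\<lambda>w. 1 / (w - 1 / y)) -
        1 / (2 * pi * \<i>) * contour_integral \<Gamma> (\<lambda>w. 1 / (w - 0))"
      by (simp only: eq right_diff_distrib)
    also have "\<dots> = winding_number \<Gamma> (1 / y) - winding_number \<Gamma> 0"
      using winding_number_valid_path[OF c(1) y(2)] winding_number_valid_path[OF c(1) c(4)] by presburger
    finally show ?thesis
      using c(5) by simp
  qed
  have "sep_cycle D (reversepath h)"
    unfolding sep_cycle_def
  proof (intro conjI allI impI)
    show "valid_path (reversepath h)"
      using vh by simp
    show "pathfinish (reversepath h) = pathstart (reversepath h)"
      using c(3) by (simp add: h_def pathstart_compose pathfinish_compose)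
    show "0 \<notin> path_image (reversepath h)"
      using im0 by simp
    show "winding_number (reversepath h) 0 = 1"
      using winding_number_reversepath[OF valid_path_imp_path[OF vh] im0] w0 by simp
    fix y :: complex assume y: "y \<noteq> 0"
    have rev: "winding_number (reversepath h) y = 1 - winding_number \<Gamma> (1 / y)" if "1 / y \<notin> path_image \<Gamma>"
      using winding_number_reversepath[OF valid_path_imp_path[OF vh], of y] im[OF y] wy[OF y] that by simp
    show "y \<notin> path_image (reversepath h)" "winding_number (reversepath h) y = 0" if "D y = 0"
      using c(8,9)[of "1 / y"] y that im[OF y] rev by auto
    show "y \<notin> path_image (reversepath h)" "winding_number (reversepath h) y = 1" if "D (1 / y) = 0"
      using c(6,7)[of "1 / y"] y that im[OF y] rev by auto
  qed
  then have "cycle_integral \<Gamma> f = cycle_integral (reversepath h) f"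
    by (intro cycle_integral_eq[OF D f \<Gamma>])
  also have "contour_integral h (\<lambda>x. f x / x) = contour_integral \<Gamma> (\<lambda>x. - (f (1 / x) / x))"
    unfolding int by (rule contour_integral_cong) (use nz in \<open>auto simp: power2_eq_square\<close>)
  then have "cycle_integral (reversepath h) f = cycle_integral \<Gamma> (\<lambda>x. f (1 / x))"
    using vh by (simp add: cycle_integral_def contour_integral_reversepath contour_integral_neg)
  finally show ?thesis ..
qed

text \<open>The scaled loop need not separate for \<open>D\<close>. About every point where
  \<open>f\<close> may be singular its winding number is nevertheless that of
  \<open>\<Gamma>\<close>: by \<open>mono\<close>, dividing an outer zero by \<open>q\<close> gives
  an outer zero again, and a point \<open>w\<close> with \<open>D (q / w) = 0\<close> has both
  \<open>w\<close> and \<open>w / q\<close> inside.\<close>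

lemma cycle_integral_scale:
  assumes D: "D holomorphic_on UNIV" "D 0 \<noteq> 0" and q: "q \<noteq> 0"
    and mono: "\<And>y. D (q * y) = 0 \<Longrightarrow> D y = 0"
    and f: "f holomorphic_on zero_free D (\<lambda>y. D (q * y))"
    and \<Gamma>: "sep_cycle D \<Gamma>"
  shows "cycle_integral \<Gamma> (\<lambda>x. f (q * x)) = cycle_integral \<Gamma> f"
proof -
  note c = sep_cycleD[OF \<Gamma>]
  define h where "h = (\<lambda>x. q * x) \<circ> \<Gamma>"
  have an: "(\<lambda>x. q * x) analytic_on UNIV"
    by (intro analytic_intros)
  have vh: "valid_path h"
    unfolding h_def by (rule valid_path_compose_holomorphic[OF c(1) analytic_imp_holomorphic[OF an]]) auto
  have int: "contour_integral h F = contour_integral \<Gamma> (\<lambda>w. q * F (q * w))" for F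
    unfolding h_def using contour_integral_comp_analyticW[OF an c(1), of F] by simp
  have im: "y \<in> path_image h \<longleftrightarrow> y / q \<in> path_image \<Gamma>" for y
    using q by (auto simp: h_def path_image_compose image_iff intro!: bexI[of _ "y / q"])
  have wn: "winding_number h y = winding_number \<Gamma> (y / q)" if "y / q \<notin> path_image \<Gamma>" for y
  proof -
    have "contour_integral h (\<lambda>w. 1 / (w - y)) = contour_integral \<Gamma> (\<lambda>w. 1 / (w - y / q))"
      unfolding int
    proof (rule contour_integral_cong[OF refl])
      fix w assume "w \<in> path_image \<Gamma>"
      then have "w \<noteq> y / q"
        using that by auto
      then show "q * (1 / (q * w - y)) = 1 / (w - y / q)"
        using q by (auto simp: field_simps)
    qed
    then show ?thesis
      using winding_number_valid_path[OF vh, of y] winding_number_valid_path[OF c(1), of "y / q"] im that by simp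
  qed
  define E where "E = (\<lambda>y. D (q * y))"
  have E: "E holomorphic_on UNIV" "E 0 \<noteq> 0"
    unfolding E_def using D holomorphic_on_compose_gen[OF _ D(1), of "\<lambda>y. q * y" UNIV]
    by (auto simp: o_def intro!: holomorphic_intros)
  have mono': "D (y / q) = 0" if "D y = 0" for y
    using mono[of "y / q"] that q by simp
  have "contour_integral h (\<lambda>x. f x / x) = contour_integral \<Gamma> (\<lambda>x. f x / x)"
  proof (rule contour_integral_eq_same_winding[OF zero_free_open_connected[OF D E]])
    show "(\<lambda>x. f x / x) holomorphic_on zero_free D E"
      using f zero_free_nz unfolding E_def by (intro holomorphic_intros) auto
    show "path_image \<Gamma> \<subseteq> zero_free D E"
      using sep_cycle_zero_free[OF \<Gamma>] mono by (auto simp: zero_free_def E_def)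
    show "path_image h \<subseteq> zero_free D E"
    proof
      fix y assume "y \<in> path_image h"
      then have "y / q \<in> zero_free D D"
        using im sep_cycle_zero_free[OF \<Gamma>] by auto
      then show "y \<in> zero_free D E"
        using q mono' by (auto simp: zero_free_def E_def)
    qed
    show "winding_number h w = winding_number \<Gamma> w" if w: "w \<notin> zero_free D E" for w
    proof (cases "w = 0")
      case True
      then show ?thesis
        using wn[of 0] c(4) by simp
    next
      case False
      then have "D w = 0 \<or> D (q / w) = 0"
        using w by (auto simp: zero_free_def E_def)
      then show ?thesis
      proof
        assume *: "D w = 0"
        then have "D (w / q) = 0"
          by (rule mono')
        then show ?thesis
          using c(6,7)[of w] c(6,7)[of "w / q"] wn[of w] * False q by simp
      next
        assume *: "D (q / w) = 0"
        then have "D (1 / w) = 0"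
          using mono[of "1 / w"] by simp
        then show ?thesis
          using c(8,9)[of w] c(8,9)[of "w / q"] wn[of w] * False q by simp
      qed
    qed
    show "pathfinish h = pathstart h"
      using c(3) by (simp add: h_def pathstart_compose pathfinish_compose)
  qed (use vh c in auto)
  moreover have "contour_integral h (\<lambda>x. f x / x) = contour_integral \<Gamma> (\<lambda>x. f (q * x) / x)"
    unfolding int using q by simp
  ultimately show ?thesis
    by (simp add: cycle_integral_def)
qed

section \<open>Existence and stability of separating cycles\<close>

lemma winding_circlepath_outside:
  assumes "r > 0" "norm y > r"
  shows "y \<notin> path_image (circlepath 0 r)" "winding_number (circlepath 0 r) y = 0"
proof -
  show "y \<notin> path_image (circlepath 0 r)"
    using assms by auto
  show "winding_number (circlepath 0 r) y = 0"
    by (rule winding_number_zero_outside[where s = "cball 0 r"]) (use assms in auto)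
qed

lemma winding_circlepath_inside:
  assumes "norm y < r"
  shows "y \<notin> path_image (circlepath 0 r)" "winding_number (circlepath 0 r) y = 1"
  using assms winding_number_circlepath[of y 0 r] norm_ge_zero[of y] by (auto simp del: norm_ge_zero)

lemma sep_cycle_circlepath:
  assumes "\<And>y. norm y \<le> 1 \<Longrightarrow> D y \<noteq> 0"
  shows "sep_cycle D (circlepath 0 1)"
  unfolding sep_cycle_def
proof (intro conjI allI impI)
  fix y :: complex assume y: "y \<noteq> 0"
  show "y \<notin> path_image (circlepath 0 1)" "winding_number (circlepath 0 1) y = 0" if "D y = 0"
    using assms[of y] that winding_circlepath_outside[of 1 y] by force+
  have "norm y < 1" if "D (1 / y) = 0"
  proof -
    have "\<not> norm (1 / y) \<le> 1"
      using assms[of "1 / y"] that by auto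
    then show ?thesis
      using y by (simp add: norm_divide divide_le_eq)
  qed
  then show "y \<notin> path_image (circlepath 0 1)" "winding_number (circlepath 0 1) y = 1" if "D (1 / y) = 0"
    using winding_circlepath_inside[of y 1] that by auto
qed (use winding_circlepath_inside[of 0 1] in auto)

text \<open>Each point of \<open>B\<close> is isolated in the complement of \<Omega>. A small circle
  around it, attached by a path run forth and back, changes the winding number at that point and at
  no other point outside \<Omega>.\<close>

lemma loop_modify_winding:
  fixes \<Omega> Z :: "complex set"
  assumes \<Omega>: "open \<Omega>" "connected \<Omega>" and iso: "\<And>c. c \<in> B \<Longrightarrow> \<exists>\<epsilon>>0. cball c \<epsilon> - {c} \<subseteq> \<Omega> \<and> c \<notin> \<Omega>"
    and B: "finite B" and e: "\<And>c. e c = 1 \<or> e c = - 1"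
    and g: "path g" "pathfinish g = pathstart g" "path_image g \<subseteq> \<Omega>"
  shows "\<exists>h. path h \<and> pathfinish h = pathstart h \<and> path_image h \<subseteq> \<Omega> \<and>
    (\<forall>y. y \<notin> \<Omega> \<longrightarrow> winding_number h y = winding_number g y + (if y \<in> B then e y else 0))"
  using B iso
proof (induction B rule: finite_induct)
  case empty
  then show ?case
    using g by auto
next
  case (insert c B)
  obtain h where h: "path h" "pathfinish h = pathstart h" "path_image h \<subseteq> \<Omega>"
    "\<And>y. y \<notin> \<Omega> \<Longrightarrow> winding_number h y = winding_number g y + (if y \<in> B then e y else 0)"
    using insert by auto
  obtain \<epsilon> where \<epsilon>: "\<epsilon> > 0" "cball c \<epsilon> - {c} \<subseteq> \<Omega>" "c \<notin> \<Omega>"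
    using insert.prems by blast
  define \<sigma> where "\<sigma> = (if e c = 1 then circlepath c \<epsilon> else reversepath (circlepath c \<epsilon>))"
  have \<sigma>: "path \<sigma>" "pathfinish \<sigma> = pathstart \<sigma>" "path_image \<sigma> = sphere c \<epsilon>"
    using \<epsilon>(1) by (auto simp: \<sigma>_def)
  have "sphere c \<epsilon> \<subseteq> cball c \<epsilon> - {c}"
    using \<epsilon>(1) by auto
  then have \<sigma>\<Omega>: "path_image \<sigma> \<subseteq> \<Omega>"
    using \<epsilon>(2) \<sigma>(3) by blast
  have w\<sigma>: "winding_number \<sigma> y = (if y = c then e c else 0)" if y: "y \<notin> \<Omega>" for y
  proof -
    have "y \<notin> path_image (circlepath c \<epsilon>)"
      using \<sigma>\<Omega> y \<sigma>(3) \<epsilon>(1) by auto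
    moreover have "winding_number (circlepath c \<epsilon>) y = (if y = c then 1 else 0)"
    proof (cases "y = c")
      case True
      then show ?thesis
        using \<epsilon>(1) winding_number_circlepath_centre by simp
    next
      case False
      then have "y \<notin> cball c \<epsilon>"
        using \<epsilon>(2) y by auto
      then have "winding_number (circlepath c \<epsilon>) y = 0"
        by (intro winding_number_zero_outside[where s = "cball c \<epsilon>"]) (use \<epsilon>(1) in auto)
      then show ?thesis
        using False by simp
    qed
    ultimately show ?thesis
      using e[of c] by (auto simp: \<sigma>_def winding_number_reversepath)
  qed
  have "pathstart h \<in> \<Omega>" "pathstart \<sigma> \<in> \<Omega>"
    using h(3) \<sigma>\<Omega> by auto
  moreover have "path_connected \<Omega>"
    using \<Omega> by (simp add: connected_open_path_connected)
  ultimately obtain d where d: "path d" "path_image d \<subseteq> \<Omega>" "pathstart d = pathstart h" "pathfinish d = pathstart \<sigma>"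
    unfolding path_connected_def by blast
  define k where "k = h +++ (d +++ (\<sigma> +++ reversepath d))"
  have "path k \<and> pathfinish k = pathstart k \<and> path_image k \<subseteq> \<Omega>"
    unfolding k_def using h \<sigma> \<sigma>\<Omega> d by (auto simp: path_image_join)
  moreover have "winding_number k y = winding_number g y + (if y \<in> insert c B then e y else 0)"
    if y: "y \<notin> \<Omega>" for y
  proof -
    have "y \<notin> path_image h" "y \<notin> path_image d" "y \<notin> path_image \<sigma>"
      using y h(3) d(2) \<sigma>\<Omega> by auto
    then have "winding_number k y = winding_number h y + winding_number \<sigma> y"
      unfolding k_def using h \<sigma> d
      by (simp add: winding_number_join winding_number_reversepath path_image_join)
    then show ?thesis
      using h(4)[OF y] w\<sigma>[OF y] insert.hyps(2) by auto
  qed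
  ultimately show ?case
    by blast
qed

text \<open>A circle about 0 that avoids the zeros of \<open>D\<close> and their inverses has the wrong winding number about
  only finitely many of them; small circles around these correct it.\<close>

lemma sep_cycle_exists:
  assumes D: "D holomorphic_on UNIV" "D 0 \<noteq> 0" and no: "\<And>y. y \<noteq> 0 \<Longrightarrow> D y = 0 \<Longrightarrow> D (1 / y) \<noteq> 0"
  shows "\<exists>\<Gamma>. polynomial_function \<Gamma> \<and> sep_cycle D \<Gamma>"
proof -
  define \<Omega> where "\<Omega> = zero_free D D"
  have \<Omega>: "open \<Omega>" "connected \<Omega>"
    unfolding \<Omega>_def by (rule zero_free_open_connected[OF D D])+
  define N where "N = norm ` ({z. D z = 0} \<union> (\<lambda>z. 1 / z) ` {z. D z = 0})"
  have "countable N"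
    unfolding N_def using countable_zeros_entire[OF D] by auto
  then have "uncountable ({1<..<2} - N)"
    by (intro uncountable_minus_countable) (auto simp: uncountable_open_interval)
  then obtain r where r: "1 < r" "r < 2" "r \<notin> N"
    by (metis Diff_iff countable_empty greaterThanLessThan_iff ex_in_conv)
  have rD: "norm y \<noteq> r" if "D y = 0 \<or> (y \<noteq> 0 \<and> D (1 / y) = 0)" for y
  proof -
    have "y \<in> {z. D z = 0} \<union> (\<lambda>z. 1 / z) ` {z. D z = 0}"
    proof (cases "D y = 0")
      case False
      then have "y = 1 / (1 / y)" "1 / y \<in> {z. D z = 0}"
        using that by auto
      then show ?thesis by blast
    qed simp
    then have "norm y \<in> N"
      unfolding N_def by (rule imageI)
    then show ?thesis
      using r by auto
  qed
  define B1 where "B1 = {y \<in> cball 0 r. D y = 0}"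
  define B2 where "B2 = (\<lambda>z. 1 / z) ` {z \<in> cball 0 (1 / r). D z = 0}"
  have fin: "finite (B1 \<union> B2)"
    unfolding B1_def B2_def using finite_zeros_entire[OF D compact_cball]
    by (intro finite_UnI finite_imageI)
  have B1: "y \<in> B1 \<longleftrightarrow> norm y < r \<and> D y = 0" for y
    using rD[of y] by (auto simp: B1_def)
  have B2: "y \<in> B2 \<longleftrightarrow> r < norm y \<and> D (1 / y) = 0" if "y \<noteq> 0" for y
  proof
    assume "y \<in> B2"
    then obtain z where z: "y = 1 / z" "norm z \<le> 1 / r" "D z = 0"
      by (auto simp: B2_def)
    then have "norm z * r \<le> 1" "norm z > 0"
      using r that by (auto simp: field_simps)
    then have "r \<le> norm y"
      using z(1) by (simp add: norm_divide le_divide_eq mult.commute)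
    then show "r < norm y \<and> D (1 / y) = 0"
      using rD[of y] z that by auto
  next
    assume "r < norm y \<and> D (1 / y) = 0"
    then show "y \<in> B2"
      using r unfolding B2_def image_iff
      by (intro bexI[of _ "1 / y"]) (auto simp: norm_divide divide_le_eq)
  qed
  have iso: "\<exists>\<epsilon>>0. cball c \<epsilon> - {c} \<subseteq> \<Omega> \<and> c \<notin> \<Omega>" if c: "c \<in> B1 \<union> B2" for c
  proof -
    have c0: "c \<noteq> 0"
      using c D(2) by (auto simp: B1_def B2_def)
    have c\<Omega>: "c \<notin> \<Omega>"
      using c c0 B1 B2 by (auto simp: \<Omega>_def zero_free_def)
    define K where "K = cball c (norm c / 2)"
    have K0: "0 \<notin> K"
      using c0 by (auto simp: K_def)
    have K: "compact K"
      by (simp add: K_def)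
    have K': "compact ((\<lambda>z. 1 / z) ` K)"
      unfolding K_def using c0 by (intro compact_continuous_image continuous_intros compact_cball) auto
    have "finite ({y \<in> K. D y = 0} \<union> (\<lambda>z. 1 / z) ` {z \<in> (\<lambda>z. 1 / z) ` K. D z = 0})" (is "finite ?F")
      by (rule finite_UnI[OF finite_zeros_entire[OF D K] finite_imageI[OF finite_zeros_entire[OF D K']]])
    from finite_set_avoid[OF this, of c]
    obtain d where d: "d > 0" "\<And>x. x \<in> ?F \<Longrightarrow> x \<noteq> c \<Longrightarrow> d \<le> dist c x"
      by blast
    define \<epsilon> where "\<epsilon> = min (norm c / 2) (d / 2)"
    have "\<epsilon> > 0"
      using d c0 by (simp add: \<epsilon>_def)
    moreover have "y \<in> \<Omega>" if y: "y \<in> cball c \<epsilon> - {c}" for y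
    proof -
      have yK: "y \<in> K" and "dist c y < d"
        using y d(1) by (auto simp: K_def \<epsilon>_def)
      then have "y \<notin> ?F"
        using d(2)[of y] y by force
      moreover have "1 / y \<in> (\<lambda>z. 1 / z) ` K"
        using yK by blast
      ultimately have "D y \<noteq> 0" "D (1 / y) \<noteq> 0"
        using yK by (auto simp: image_iff)
      then show ?thesis
        using yK K0 by (auto simp: \<Omega>_def zero_free_def)
    qed
    ultimately show ?thesis
      using c\<Omega> by blast
  qed
  \<comment> \<open>A zero of \<open>D\<close> inside the circle has winding number 1 instead of 0,
    and the inverse of a zero outside it has 0 instead of 1. By assumption \<open>no\<close>, a
    point never falls under both cases.\<close>
  define e :: "complex \<Rightarrow> complex" where "e y = (if D y = 0 then - 1 else 1)" for y
  have "path_image (circlepath 0 r) \<subseteq> \<Omega>"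
  proof
    fix y assume "y \<in> path_image (circlepath 0 r)"
    then have "norm y = r"
      using r by simp
    moreover from this have "y \<noteq> 0"
      using r by auto
    ultimately show "y \<in> \<Omega>"
      using rD[of y] by (auto simp: \<Omega>_def zero_free_def)
  qed
  moreover have "e c = 1 \<or> e c = - 1" for c
    by (simp add: e_def)
  ultimately obtain h where h: "path h" "pathfinish h = pathstart h" "path_image h \<subseteq> \<Omega>"
    "\<And>y. y \<notin> \<Omega> \<Longrightarrow> winding_number h y = winding_number (circlepath 0 r) y + (if y \<in> B1 \<union> B2 then e y else 0)"
    using loop_modify_winding[OF \<Omega> iso fin, of e "circlepath 0 r"]
    by (metis path_circlepath pathfinish_circlepath pathstart_circlepath)
  obtain \<Gamma> where \<Gamma>: "polynomial_function \<Gamma>" "pathfinish \<Gamma> = pathstart \<Gamma>" "path_image \<Gamma> \<subseteq> \<Omega>"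
    "\<And>w. w \<notin> \<Omega> \<Longrightarrow> winding_number \<Gamma> w = winding_number h w"
    using polynomial_loop_same_winding[OF \<Omega>(1) h(1-3)] by blast
  have out: "y \<notin> \<Omega>" if "D y = 0 \<or> D (1 / y) = 0 \<or> y = 0" for y
    using that by (auto simp: \<Omega>_def zero_free_def)
  have wn: "winding_number \<Gamma> y = winding_number (circlepath 0 r) y + (if y \<in> B1 \<union> B2 then e y else 0)"
    if "D y = 0 \<or> D (1 / y) = 0 \<or> y = 0" for y
    using \<Gamma>(4) h(4) out[OF that] by simp
  have "sep_cycle D \<Gamma>"
    unfolding sep_cycle_def
  proof (intro conjI allI impI)
    show "valid_path \<Gamma>"
      using \<Gamma>(1) by (rule valid_path_polynomial_function)
    show "0 \<notin> path_image \<Gamma>"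
      using \<Gamma>(3) out[of 0] by auto
    have "0 \<notin> B1 \<union> B2"
      using D(2) by (auto simp: B1_def B2_def)
    then show "winding_number \<Gamma> 0 = 1"
      using wn[of 0] winding_circlepath_inside[of 0 r] r by simp
    fix y :: complex assume y: "y \<noteq> 0"
    {
      assume *: "D y = 0"
      then show "y \<notin> path_image \<Gamma>"
        using \<Gamma>(3) out[of y] by auto
      have "winding_number (circlepath 0 r) y = (if norm y < r then 1 else 0)"
        using winding_circlepath_inside[of y r] winding_circlepath_outside[of r y] rD[of y] * r by auto
      then show "winding_number \<Gamma> y = 0"
        using wn[of y] * no[OF y *] B1[of y] B2[OF y] by (auto simp: e_def)
    }
    {
      assume *: "D (1 / y) = 0"
      then have "D y \<noteq> 0"
        using no[of y] y by auto
      show "y \<notin> path_image \<Gamma>"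
        using \<Gamma>(3) out[of y] * by auto
      have "winding_number (circlepath 0 r) y = (if norm y < r then 1 else 0)" "norm y \<noteq> r"
        using winding_circlepath_inside[of y r] winding_circlepath_outside[of r y] rD[of y] * r y by auto
      then show "winding_number \<Gamma> y = 1"
        using wn[of y] * \<open>D y \<noteq> 0\<close> B1[of y] B2[OF y] by (auto simp: e_def)
    }
  qed (use \<Gamma> in auto)
  then show ?thesis
    using \<Gamma>(1) by blast
qed

text \<open>Winding numbers are locally constant, 0 near infinity and 1 near 0, so the set that the
  zeros of \<open>D u\<close> must avoid is compact. Avoiding it is then an open condition in
  \<open>u\<close>, by the tube lemma.\<close>

lemma sep_cycle_stable:
  fixes D :: "complex \<Rightarrow> complex \<Rightarrow> complex"
  assumes U: "open U" "u0 \<in> U" and cont: "continuous_on (U \<times> UNIV) (\<lambda>(u, x). D u x)"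
    and D0: "D u0 0 \<noteq> 0" and \<Gamma>: "sep_cycle (D u0) \<Gamma>"
  shows "\<exists>V. open V \<and> u0 \<in> V \<and> V \<subseteq> U \<and> (\<forall>u\<in>V. sep_cycle (D u) \<Gamma>)"
proof -
  note c = sep_cycleD[OF \<Gamma>]
  define L where "L k = {z. z \<notin> path_image \<Gamma> \<and> winding_number \<Gamma> z = k}" for k
  have L: "open (L k)" for k
    unfolding L_def by (rule open_winding_number_levelsets[OF c(2,3)])
  \<comment> \<open>The cycle separates for \<open>D u\<close> as soon as \<open>D u\<close> has no zeros in \<open>K0 \<union> K1\<close>.\<close>
  define K0 where "K0 = - L 0"
  define K1 where "K1 = - ((\<lambda>z. 1 / z) -` L 1 \<inter> - {0})"
  have "compact K0"
  proof -
    obtain b where b: "\<And>z. b \<le> norm z \<Longrightarrow> winding_number \<Gamma> z = 0"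
      using winding_number_zero_at_infinity[OF c(2,3)] by blast
    obtain b' where b': "\<And>z. z \<in> path_image \<Gamma> \<Longrightarrow> norm z \<le> b'"
      using bounded_path_image[OF c(2)] unfolding bounded_iff by blast
    have "norm z \<le> max b b'" if "z \<in> K0" for z
      using that b[of z] b'[of z] by (force simp: K0_def L_def)
    then have "bounded K0"
      unfolding bounded_iff by blast
    then show ?thesis
      unfolding K0_def using L by (simp add: compact_eq_bounded_closed closed_Compl)
  qed
  moreover have "compact K1"
  proof -
    have "0 \<in> L 1"
      using c(4,5) by (simp add: L_def)
    then obtain d where d: "d > 0" "ball 0 d \<subseteq> L 1"
      using L open_contains_ball by blast
    have "norm z \<le> 1 / d" if "z \<in> K1" for z
    proof (rule ccontr)
      assume *: "\<not> norm z \<le> 1 / d"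
      moreover have "z \<noteq> 0"
        using * d(1) by auto
      ultimately have "1 / z \<in> ball 0 d"
        using d(1) by (auto simp: norm_divide field_simps)
      then show False
        using that d(2) \<open>z \<noteq> 0\<close> by (auto simp: K1_def)
    qed
    then have "bounded K1"
      unfolding bounded_iff by blast
    moreover have "open ((\<lambda>z. 1 / z) -` L 1 \<inter> - {0})"
      by (rule continuous_on_open_vimage[THEN iffD1, rule_format, OF _ _ L]) (auto intro!: continuous_intros)
    ultimately show ?thesis
      unfolding K1_def compact_eq_bounded_closed by (intro conjI closed_Compl)
  qed
  ultimately have K: "compact (K0 \<union> K1)"
    by (rule compact_Un)
  define W where "W = {z \<in> U \<times> UNIV. (case z of (u, x) \<Rightarrow> D u x) \<noteq> 0}"
  have "open W"
    unfolding W_def using U cont by (intro open_nonzeros open_Times) auto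
  have nz0: "D u0 y \<noteq> 0" if "y \<in> K0" for y
    using that c(6,7)[of y] D0 by (cases "y = 0") (auto simp: K0_def L_def)
  have nz1: "D u0 y \<noteq> 0" if "y \<in> K1" for y
    using that c(8,9)[of "1 / y"] D0 by (cases "y = 0") (auto simp: K1_def L_def)
  have "{u0} \<times> (K0 \<union> K1) \<subseteq> W"
    using nz0 nz1 U by (auto simp: W_def)
  then obtain V where V: "u0 \<in> V" "open V" "V \<times> (K0 \<union> K1) \<subseteq> W"
    using Elementary_Topology.tube_lemma[OF K \<open>open W\<close>] by blast
  have "sep_cycle (D u) \<Gamma>" if u: "u \<in> V" for u
    unfolding sep_cycle_def
  proof (intro conjI allI impI)
    fix y :: complex assume y: "y \<noteq> 0"
    have nz: "D u x \<noteq> 0" if "x \<in> K0 \<union> K1" for x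
      using that V(3) u by (auto simp: W_def)
    show "y \<notin> path_image \<Gamma>" "winding_number \<Gamma> y = 0" if "D u y = 0"
      using nz[of y] that by (auto simp: K0_def L_def)
    show "y \<notin> path_image \<Gamma>" "winding_number \<Gamma> y = 1" if "D u (1 / y) = 0"
      using nz[of "1 / y"] that y by (auto simp: K1_def L_def)
  qed (use c in auto)
  then show ?thesis
    using V U by (intro exI[of _ "V \<inter> U"]) auto
qed

text \<open>The cycles \<open>\<Gamma> u\<close> may be chosen without any regularity in
  \<open>u\<close>: near each parameter one fixed polynomial cycle separates for all nearby
  \<open>u\<close> and yields the same integrals.\<close>

lemma cycle_integral_param_holomorphic:
  fixes D f :: "complex \<Rightarrow> complex \<Rightarrow> complex"
  assumes U: "open U" and contD: "continuous_on (U \<times> UNIV) (\<lambda>(u, x). D u x)"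
    and D: "\<And>u. u \<in> U \<Longrightarrow> D u holomorphic_on UNIV" "\<And>u. u \<in> U \<Longrightarrow> D u 0 \<noteq> 0"
    and \<Gamma>: "\<And>u. u \<in> U \<Longrightarrow> sep_cycle (D u) (\<Gamma> u)"
    and f: "\<And>u. u \<in> U \<Longrightarrow> f u holomorphic_on zero_free (D u) (D u)"
    and contf: "continuous_on {(u, x). u \<in> U \<and> x \<in> zero_free (D u) (D u)} (\<lambda>(u, x). f u x)"
    and holf: "\<And>x V. open V \<Longrightarrow> V \<subseteq> U \<Longrightarrow> (\<And>u. u \<in> V \<Longrightarrow> x \<in> zero_free (D u) (D u)) \<Longrightarrow>
                (\<lambda>u. f u x) holomorphic_on V"
  shows "(\<lambda>u. cycle_integral (\<Gamma> u) (f u)) holomorphic_on U"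
proof -
  have "(\<lambda>u. cycle_integral (\<Gamma> u) (f u)) analytic_on {u0}" if u0: "u0 \<in> U" for u0
  proof -
    have no: "D u0 (1 / y) \<noteq> 0" if "y \<noteq> 0" "D u0 y = 0" for y
      using sep_cycleD(7,9)[OF \<Gamma>[OF u0], of y] that by auto
    obtain G where G: "polynomial_function G" "sep_cycle (D u0) G"
      using sep_cycle_exists[OF D[OF u0] no] by blast
    obtain V where V: "open V" "u0 \<in> V" "V \<subseteq> U" "\<And>u. u \<in> V \<Longrightarrow> sep_cycle (D u) G"
      using sep_cycle_stable[OF U u0 contD D(2)[OF u0] G(2)] by blast
    have img: "x \<in> zero_free (D u) (D u)" if "u \<in> V" "x \<in> path_image G" for u x
      using sep_cycle_zero_free[OF V(4)[OF that(1)]] that(2) by blast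
    have nz: "x \<noteq> 0" if "x \<in> path_image G" for x
      using img[OF V(2) that] by (rule zero_free_nz)
    have "(\<lambda>u. contour_integral G (\<lambda>x. f u x / x)) holomorphic_on V"
    proof (rule contour_integral_param_holomorphic[OF V(1) G(1)])
      have "continuous_on (V \<times> path_image G) (\<lambda>z. (case z of (u, x) \<Rightarrow> f u x) / snd z)"
        using img V(3) nz
        by (intro continuous_intros continuous_on_subset[OF contf]) auto
      then show "continuous_on (V \<times> path_image G) (\<lambda>(u, x). f u x / x)"
        by (simp add: case_prod_unfold)
      show "(\<lambda>u. f u x / x) holomorphic_on V" if "x \<in> path_image G" for x
        using img nz that V by (intro holomorphic_intros holf) auto
    qed
    then have "(\<lambda>u. cycle_integral G (f u)) holomorphic_on V"
      unfolding cycle_integral_def by (intro holomorphic_intros) auto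
    moreover have "cycle_integral (\<Gamma> u) (f u) = cycle_integral G (f u)" if "u \<in> V" for u
      using that V by (intro cycle_integral_eq[OF D f \<Gamma>]) auto
    ultimately have "(\<lambda>u. cycle_integral (\<Gamma> u) (f u)) holomorphic_on V"
      by (simp cong: holomorphic_cong)
    then show ?thesis
      using V by (auto simp: analytic_at)
  qed
  then show ?thesis
    using analytic_imp_holomorphic analytic_on_analytic_at by blast
qed

lemma cycle_integral_cong:
  assumes "sep_cycle D \<Gamma>" "\<And>x. x \<in> zero_free D D \<Longrightarrow> f x = g x"
  shows "cycle_integral \<Gamma> f = cycle_integral \<Gamma> g"
  unfolding cycle_integral_def
  using assms sep_cycle_zero_free[OF assms(1)] by (intro arg_cong2[where f = "(/)"] contour_integral_cong) auto

lemma cycle_integral_cmult: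
  "cycle_integral \<Gamma> (\<lambda>x. c * f x) = c * cycle_integral \<Gamma> f"
  using contour_integral_cmult[of \<Gamma> c "\<lambda>x. f x / x"] by (simp add: cycle_integral_def)

lemma cycle_integral_add:
  assumes D: "D holomorphic_on UNIV" "D 0 \<noteq> 0" and \<Gamma>: "sep_cycle D \<Gamma>"
    and fg: "f holomorphic_on zero_free D D" "g holomorphic_on zero_free D D"
  shows "cycle_integral \<Gamma> (\<lambda>x. f x + g x) = cycle_integral \<Gamma> f + cycle_integral \<Gamma> g"
proof -
  have "(\<lambda>x. h x / x) contour_integrable_on \<Gamma>" if "h holomorphic_on zero_free D D" for h
  proof (rule contour_integrable_holomorphic_simple)
    show "(\<lambda>x. h x / x) holomorphic_on zero_free D D"
      using that zero_free_nz by (intro holomorphic_intros) auto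
  qed (use zero_free_open_connected[OF D D] sep_cycleD(1)[OF \<Gamma>] sep_cycle_zero_free[OF \<Gamma>] in auto)
  then show ?thesis
    using fg by (simp add: cycle_integral_def add_divide_distrib contour_integral_add)
qed

section \<open>The beta kernel\<close>

text \<open>The square root \<open>b\<close> of the second nome is the parameter because
  \<open>theta (b * x) q\<close> is invariant under \<open>x \<mapsto> 1 / x\<close>. It will be
  \<open>a^2\<close>.\<close>

locale beta_kernel =
  fixes p b :: complex
  assumes p0: "p \<noteq> 0" and p1: "norm p < 1" and b0: "b \<noteq> 0" and b1: "norm b < 1"
begin

abbreviation "P \<equiv> p\<^sup>2"
abbreviation "q \<equiv> b\<^sup>2"

lemma P: "norm P < 1" "P \<noteq> 0" and q: "norm q < 1" "q \<noteq> 0"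
  using p0 p1 b0 b1 by (auto simp: norm_power power_less_one_iff)

lemma egamma_holomorphic:
  assumes "open S" "u holomorphic_on S" "\<And>x. x \<in> S \<Longrightarrow> u x \<noteq> 0" "\<And>x. x \<in> S \<Longrightarrow> qpoch2 (u x) P q \<noteq> 0"
  shows "(\<lambda>x. egamma (u x) P q) holomorphic_on S"
  unfolding egamma_def using assms P q
  by (intro holomorphic_intros holomorphic_on_qpoch2) auto

lemma egamma_continuous:
  assumes "continuous_on S u" "\<And>x. x \<in> S \<Longrightarrow> u x \<noteq> 0" "\<And>x. x \<in> S \<Longrightarrow> qpoch2 (u x) P q \<noteq> 0"
  shows "continuous_on S (\<lambda>x. egamma (u x) P q)"
  unfolding egamma_def using assms P q
  by (intro continuous_intros continuous_on_qpoch2) auto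

lemma qpoch2_nz_mult:
  assumes "qpoch2 x P q \<noteq> 0"
  shows "qpoch2 (q * x) P q \<noteq> 0" "qpoch x P \<noteq> 0"
  using qpoch2_rec'[OF P(1) q(1), of x] assms by (auto simp: mult.commute)

lemma egamma_q:
  assumes "x \<noteq> 0" "qpoch2 x P q \<noteq> 0"
  shows "egamma (q * x) P q = theta x P * egamma x P q"
  using assms qpoch2_nz_mult(2) P q by (intro egamma_shift_q) auto

text \<open>The double products cancel against each other except for one row of factors from each
  denominator, and these two rows form the theta function. If it vanishes, both sides are 0 by
  division by zero.\<close>

lemma egamma_mult_P:
  assumes "x \<noteq> 0" "y \<noteq> 0" "x * y = P" "qpoch2 (q * x) P q \<noteq> 0" "qpoch2 (q * y) P q \<noteq> 0"
  shows "egamma x P q * egamma y P q = 1 / theta x P"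
proof -
  have xy: "P * q / x = q * y" "P * q / y = q * x" "P / x = y"
    using assms by (auto simp: field_simps)
  have rec: "qpoch2 x P q = qpoch x P * qpoch2 (q * x) P q" "qpoch2 y P q = qpoch y P * qpoch2 (q * y) P q"
    using qpoch2_rec'[OF P(1) q(1), of x] qpoch2_rec'[OF P(1) q(1), of y] by (simp_all only: mult.commute)
  show ?thesis
    unfolding egamma_def theta_def xy rec using assms(4,5) by simp
qed

lemma egamma_mult_q:
  assumes "x \<noteq> 0" "y \<noteq> 0" "x * y = q" "qpoch2 (P * x) P q \<noteq> 0" "qpoch2 (P * y) P q \<noteq> 0"
  shows "egamma x P q * egamma y P q = 1 / theta x q"
proof -
  have xy: "P * q / x = P * y" "P * q / y = P * x" "q / x = y"
    using assms by (auto simp: field_simps)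
  have rec: "qpoch2 x P q = qpoch x q * qpoch2 (P * x) P q" "qpoch2 y P q = qpoch y q * qpoch2 (P * y) P q"
    using qpoch2_rec[OF P(1) q(1), of x] qpoch2_rec[OF P(1) q(1), of y] by (simp_all only: mult.commute)
  show ?thesis
    unfolding egamma_def theta_def xy rec using assms(4,5) by simp
qed

text \<open>Common denominator of the gamma functions with arguments \<open>t * u\<close> and
  \<open>s * u\<close>; the arguments \<open>t / x\<close> and \<open>s / x\<close> are covered by
  \<open>u = 1 / x\<close>.\<close>

definition poles :: "complex \<Rightarrow> complex \<Rightarrow> complex \<Rightarrow> complex" where
  "poles t s u = qpoch2 (t * u) P q * qpoch2 (s * u) P q"

lemma poles_entire: "poles t s holomorphic_on UNIV" "poles t s 0 \<noteq> 0"
proof -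
  show "poles t s holomorphic_on UNIV"
    unfolding poles_def using P q by (intro holomorphic_intros holomorphic_on_qpoch2) auto
  show "poles t s 0 \<noteq> 0"
    by (simp add: poles_def)
qed

lemma poles_q: "poles t s (q * y) = 0 \<Longrightarrow> poles t s y = 0"
  using qpoch2_nz_mult(1)[of "t * y"] qpoch2_nz_mult(1)[of "s * y"]
  by (auto simp: poles_def mult_ac)

lemmas poles_region = zero_free_open_connected[OF poles_entire poles_entire]

lemma poles_nz:
  assumes "x \<in> zero_free (poles t s) (poles t s)"
  shows "x \<noteq> 0" "qpoch2 (t * x) P q \<noteq> 0" "qpoch2 (s * x) P q \<noteq> 0" "qpoch2 (t / x) P q \<noteq> 0" "qpoch2 (s / x) P q \<noteq> 0"
  using assms by (auto simp: zero_free_def poles_def)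

text \<open>For \<open>t = 1 / a\<close> and \<open>s = p / a\<close> this is the part of the
  integrand that does not involve \<open>z\<close>.\<close>

definition weight :: "complex \<Rightarrow> complex \<Rightarrow> complex \<Rightarrow> complex" where
  "weight t s x = egamma (t * x) P q * egamma (t / x) P q * egamma (s * x) P q * egamma (s / x) P q * theta (b * x) q"

lemma weight_inverse: "weight t s (1 / x) = weight t s x" if "x \<noteq> 0"
proof -
  have "q / (b * x) = b / x"
    using b0 by (simp add: power2_eq_square)
  then show ?thesis
    using theta_reflect[OF q(2), of "b * x"] by (simp add: weight_def mult_ac)
qed

lemma weight_holomorphic:
  assumes "t \<noteq> 0" "s \<noteq> 0"
  shows "weight t s holomorphic_on zero_free (poles t s) (poles t s)"
  unfolding weight_def using assms poles_region poles_nz b0 q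
  by (intro holomorphic_intros egamma_holomorphic holomorphic_on_theta) auto

text \<open>The quotient of \<open>g x + g (1 / x)\<close> by the weight, for the telescoping
  function \<open>g\<close> of \<open>weight_H_integral\<close>; its theta factors in
  \<open>t\<close> and \<open>s\<close> arise from multiplying gamma arguments by
  \<open>q\<close>.\<close>

definition H :: "complex \<Rightarrow> complex \<Rightarrow> complex \<Rightarrow> complex" where
  "H t s x = x * theta (t / x) P * theta (s / x) P * theta (- b / x) P +
             theta (t * x) P * theta (s * x) P * theta (- (b * x)) P / x"

lemma H_holomorphic:
  assumes "t \<noteq> 0" "s \<noteq> 0"
  shows "H t s holomorphic_on - {0}"
  unfolding H_def using assms b0 P by (intro holomorphic_intros holomorphic_on_theta) auto

text \<open>The function \<open>g\<close> satisfies \<open>g (q x) = - g (1 / x)\<close>, and both \<open>x \<mapsto> q x\<close> and \<open>x \<mapsto> 1 / x\<close>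
  preserve its integral, which therefore vanishes.\<close>

lemma weight_H_integral:
  assumes ts: "t \<noteq> 0" "s \<noteq> 0" and \<Gamma>: "sep_cycle (poles t s) \<Gamma>"
  shows "cycle_integral \<Gamma> (\<lambda>x. weight t s x * H t s x) = 0"
proof -
  \<comment> \<open>Only the arguments with \<open>1 / x\<close> carry an extra \<open>q\<close>, so
    scaling the cycle by \<open>q\<close> meets no pole. The factors \<open>x\<close> and
    \<open>theta (- b / x) P\<close> are there to make the multiplier exactly
    \<open>- 1\<close>.\<close>
  define g where "g x = x * egamma (t * x) P q * egamma (s * x) P q * egamma (q * t / x) P q *
    egamma (q * s / x) P q * theta (b * x) q * theta (- b / x) P" for x
  let ?Z = "zero_free (poles t s) (poles t s)" and ?Y = "zero_free (poles t s) (\<lambda>y. poles t s (q * y))"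
  have "(\<lambda>y. poles t s (q * y)) holomorphic_on UNIV" "poles t s (q * 0) \<noteq> 0"
    using holomorphic_on_compose_gen[OF _ poles_entire(1), of "\<lambda>y. q * y" UNIV] poles_entire(2)
    by (auto simp: o_def intro!: holomorphic_intros)
  then have opY: "open ?Y"
    by (intro zero_free_open_connected poles_entire)
  have nzY: "x \<noteq> 0" "qpoch2 (t * x) P q \<noteq> 0" "qpoch2 (s * x) P q \<noteq> 0"
      "qpoch2 (q * t / x) P q \<noteq> 0" "qpoch2 (q * s / x) P q \<noteq> 0" if "x \<in> ?Y" for x
    using that by (auto simp: zero_free_def poles_def mult_ac)
  have gY: "g holomorphic_on ?Y"
    unfolding g_def using ts nzY opY b0 P q
    by (intro holomorphic_intros egamma_holomorphic holomorphic_on_theta) auto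
  have "?Z \<subseteq> ?Y"
    using poles_q by (auto simp: zero_free_def)
  then have gZ: "g holomorphic_on ?Z"
    using gY holomorphic_on_subset by blast
  have inv: "g (q * x) = - g (1 / x)" if x: "x \<noteq> 0" for x
  proof -
    have bb: "b * (q * x) = q * (b * x)" "- b / (q * x) = 1 / - (b * x)" "b * (1 / x) = q / (b * x)"
      "- b / (1 / x) = - (b * x)"
      using b0 x by (auto simp: power2_eq_square)
    have "theta (b * (q * x)) q = - theta (b * x) q / (b * x)"
      using theta_shift[OF q, of "b * x"] b0 x by (simp add: bb)
    moreover have "theta (- b / (q * x)) P = theta (- (b * x)) P / (b * x)"
      unfolding bb using theta_inverse[OF P(1), of "- (b * x)"] b0 x by simp
    moreover have "theta (b * (1 / x)) q = theta (b * x) q"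
      unfolding bb by (rule theta_reflect[OF q(2)])
    moreover have "q * t / (q * x) = t / x" "q * s / (q * x) = s / x" "q * t / (1 / x) = t * (q * x)"
      "q * s / (1 / x) = s * (q * x)"
      using q by auto
    ultimately show ?thesis
      unfolding g_def using b0 x by (simp only:) (simp add: field_simps power2_eq_square)
  qed
  have "cycle_integral \<Gamma> g = cycle_integral \<Gamma> (\<lambda>x. g (q * x))"
    using cycle_integral_scale[OF poles_entire q(2) poles_q gY \<Gamma>] by simp
  also have "\<dots> = cycle_integral \<Gamma> (\<lambda>x. - 1 * g (1 / x))"
    by (rule cycle_integral_cong[OF \<Gamma>]) (use inv zero_free_nz in auto)
  also have "\<dots> = - cycle_integral \<Gamma> (\<lambda>x. g (1 / x))"
    by (subst cycle_integral_cmult) simp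
  also have inv_eq: "cycle_integral \<Gamma> (\<lambda>x. g (1 / x)) = cycle_integral \<Gamma> g"
    by (rule cycle_integral_inverse[OF poles_entire gZ \<Gamma>])
  finally have "cycle_integral \<Gamma> g = 0"
    by simp
  have "(\<lambda>x. g (1 / x)) holomorphic_on ?Z"
  proof -
    have "g \<circ> (\<lambda>x. 1 / x) holomorphic_on ?Z"
      using zero_free_nz by (intro holomorphic_on_compose_gen[OF _ gZ] holomorphic_intros) (auto simp: zero_free_def)
    then show ?thesis by (simp add: o_def)
  qed
  then have "cycle_integral \<Gamma> (\<lambda>x. g x + g (1 / x)) = 0"
    using \<open>cycle_integral \<Gamma> g = 0\<close> inv_eq by (simp add: cycle_integral_add[OF poles_entire \<Gamma> gZ])
  also have "cycle_integral \<Gamma> (\<lambda>x. g x + g (1 / x)) = cycle_integral \<Gamma> (\<lambda>x. weight t s x * H t s x)"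
  proof (rule cycle_integral_cong[OF \<Gamma>])
    fix x assume x: "x \<in> ?Z"
    note nz = poles_nz[OF x]
    have e: "egamma (q * t / x) P q = theta (t / x) P * egamma (t / x) P q"
      "egamma (q * s / x) P q = theta (s / x) P * egamma (s / x) P q"
      "egamma (q * t * x) P q = theta (t * x) P * egamma (t * x) P q"
      "egamma (q * s * x) P q = theta (s * x) P * egamma (s * x) P q"
      using egamma_q[of "t / x"] egamma_q[of "s / x"] egamma_q[of "t * x"] egamma_q[of "s * x"] nz ts
      by (simp_all add: mult.assoc)
    have "q / (b * x) = b / x"
      using b0 by (simp add: power2_eq_square)
    then have "theta (b / x) q = theta (b * x) q"
      using theta_reflect[OF q(2), of "b * x"] by simp
    then show "g x + g (1 / x) = weight t s x * H t s x"
      unfolding g_def weight_def H_def using nz(1) by (simp add: e) (simp add: field_simps)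
  qed
  finally show ?thesis .
qed

text \<open>Even in \<open>x\<close> with zeros at \<open>u\<close> and \<open>1 / u\<close>; the
  first factor carries the zero that evenness forces.\<close>

definition tau :: "complex \<Rightarrow> complex \<Rightarrow> complex" where
  "tau u x = theta (- (p * x)) P * theta (u * x) P * theta (u / x) P"

lemma tau_holomorphic: "u \<noteq> 0 \<Longrightarrow> tau u holomorphic_on - {0}"
  unfolding tau_def using p0 P by (intro holomorphic_intros holomorphic_on_theta) auto

lemma H_inverse: "H t s (1 / x) = H t s x" if "x \<noteq> 0"
  using that by (simp add: H_def mult_ac)

text \<open>The two summands of \<open>H\<close> have multipliers that involve
  \<open>t * s * b\<close> and its reciprocal. The balancing condition makes them equal to each
  other and to the multiplier of \<open>tau\<close>.\<close>

lemma H_P: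
  assumes x: "x \<noteq> 0" and ts: "t * s * b = p"
  shows "H t s (P * x) = H t s x / (p * x) ^ 3"
proof -
  have nz: "t \<noteq> 0" "s \<noteq> 0"
    using ts p0 by auto
  have 1: "theta (w / (P * x)) P = - (w / (P * x)) * theta (w / x) P" if "w \<noteq> 0" for w
    using theta_shift[OF P, of "w / (P * x)"] that P x by (simp add: field_simps)
  have 2: "theta (w * (P * x)) P = - theta (w * x) P / (w * x)" if "w \<noteq> 0" for w
    using theta_shift[OF P, of "w * x"] that x by (simp add: mult_ac)
  have 3: "theta (- (b * (P * x))) P = theta (- (b * x)) P / (b * x)"
    using 2[of "- b"] b0 by simp
  have "H t s (P * x) = P * x * (- (t / (P * x)) * theta (t / x) P) * (- (s / (P * x)) * theta (s / x) P) *
      (b / (P * x) * theta (- b / x) P) +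
      (- theta (t * x) P / (t * x)) * (- theta (s * x) P / (s * x)) * (theta (- (b * x)) P / (b * x)) / (P * x)"
    unfolding H_def using 1[of t] 1[of s] 1[of "- b"] 2[of t] 2[of s] 3 nz b0 by simp
  also have "\<dots> = (t * s * b) * x * theta (t / x) P * theta (s / x) P * theta (- b / x) P / (P ^ 2 * x ^ 3) +
      theta (t * x) P * theta (s * x) P * theta (- (b * x)) P / ((t * s * b) * P * x ^ 3 * x)"
    using nz b0 p0 x by (simp add: field_simps power2_eq_square power3_eq_cube)
  also have "\<dots> = H t s x / (p * x) ^ 3"
    unfolding ts H_def using p0 x by (simp add: field_simps power2_eq_square power3_eq_cube)
  finally show ?thesis .
qed

text \<open>This is the interpolation formula for \<open>H\<close> at the nodes \<open>u\<close> and
  \<open>v\<close>, integrated against the weight; the integral of \<open>weight * H\<close>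
  vanishes.\<close>

lemma tau_relation:
  assumes ts: "t * s * b = p" and u: "u \<noteq> 0" and v: "v \<noteq> 0"
    and nz: "theta (u\<^sup>2) P \<noteq> 0" "tau u v \<noteq> 0" "tau v u \<noteq> 0"
    and \<Gamma>: "sep_cycle (poles t s) \<Gamma>"
  shows "H t s v / tau u v * cycle_integral \<Gamma> (\<lambda>x. weight t s x * tau u x) +
         H t s u / tau v u * cycle_integral \<Gamma> (\<lambda>x. weight t s x * tau v x) = 0"
proof -
  have ts0: "t \<noteq> 0" "s \<noteq> 0"
    using ts p0 by auto
  let ?Z = "zero_free (poles t s) (poles t s)"
  have hol: "(\<lambda>x. c * (weight t s x * tau w x)) holomorphic_on ?Z" if "w \<noteq> 0" for c w
    using holomorphic_on_subset[OF tau_holomorphic[OF that], of ?Z] zero_free_nz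
    by (intro holomorphic_intros weight_holomorphic ts0) auto
  have "0 = cycle_integral \<Gamma> (\<lambda>x. weight t s x * H t s x)"
    using weight_H_integral[OF ts0 \<Gamma>] by simp
  also have "\<dots> = cycle_integral \<Gamma> (\<lambda>x. H t s v / tau u v * (weight t s x * tau u x) +
      H t s u / tau v u * (weight t s x * tau v x))"
  proof (rule cycle_integral_cong[OF \<Gamma>])
    fix x assume "x \<in> ?Z"
    then have x: "x \<noteq> 0" by (rule zero_free_nz)
    have "H t s x = H t s v * tau u x / tau u v + H t s u * tau v x / tau v u"
      unfolding tau_def using nz unfolding tau_def
      by (intro theta_even_interpolation[OF p1 p0] H_holomorphic H_inverse H_P ts ts0 u v x)
    then show "weight t s x * H t s x = H t s v / tau u v * (weight t s x * tau u x) +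
      H t s u / tau v u * (weight t s x * tau v x)"
      by (simp add: field_simps)
  qed
  also have "\<dots> = H t s v / tau u v * cycle_integral \<Gamma> (\<lambda>x. weight t s x * tau u x) +
         H t s u / tau v u * cycle_integral \<Gamma> (\<lambda>x. weight t s x * tau v x)"
    using hol[OF u] hol[OF v] by (simp only: cycle_integral_add[OF poles_entire \<Gamma>] cycle_integral_cmult)
  finally show ?thesis ..
qed

text \<open>The result of multiplying the weight by \<open>tau\<close> at one of its own parameters,
  which raises that parameter by \<open>q\<close>; after the raise the parameters satisfy
  \<open>t * s = b * p\<close>.\<close>

definition beta :: "complex \<Rightarrow> complex \<Rightarrow> complex \<Rightarrow> complex" where
  "beta t s x = egamma (t * x) P q * egamma (t / x) P q * egamma (s * x) P q * egamma (s / x) P q *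
     theta (b * x) q * theta (- (p * x)) P"

lemma weight_tau:
  assumes "x \<in> zero_free (poles t s) (poles t s)" "t \<noteq> 0" "s \<noteq> 0"
  shows "weight t s x * tau t x = beta (q * t) s x" "weight t s x * tau s x = beta t (q * s) x"
  using egamma_q[of "t * x"] egamma_q[of "t / x"] egamma_q[of "s * x"] egamma_q[of "s / x"]
    poles_nz[OF assms(1)] assms(2,3)
  by (simp_all add: weight_def tau_def beta_def mult_ac)

subsection \<open>The one-parameter elliptic beta integral\<close>

text \<open>This is \<open>H t s t / tau s t\<close> at \<open>x = t\<close>, freed from the factor
  \<open>1 / (t * theta (s / t) P)\<close>, after \<open>theta_square_split\<close> has been applied
  to \<open>theta (t\<^sup>2) P\<close>.\<close>

definition n_fac :: "complex \<Rightarrow> complex" where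
  "n_fac x = theta x P * theta (- x) P * theta (p * x) P * theta (- (b * x)) P"

text \<open>Built by replacing each theta function of \<open>n_fac\<close> by a gamma function, so
  that it solves \<open>N_fac (q * x) = n_fac x * N_fac x\<close>.\<close>

definition N_fac :: "complex \<Rightarrow> complex" where
  "N_fac x = egamma x P q * egamma (- x) P q * egamma (p * x) P q * egamma (- (b * x)) P q"

definition circle_beta :: "complex \<Rightarrow> complex" where
  "circle_beta t = cycle_integral (circlepath 0 1) (beta t (b * p / t))"

lemma sep_cycle_circle:
  assumes "norm t < 1" "norm s < 1"
  shows "sep_cycle (poles t s) (circlepath 0 1)"
proof (rule sep_cycle_circlepath)
  have "norm (w * y) < 1" if "norm y \<le> 1" "norm w < 1" for w y :: complex
    using that mult_left_le[of "norm y" "norm w"] by (simp add: norm_mult)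
  then show "poles t s y \<noteq> 0" if "norm y \<le> 1" for y
    unfolding poles_def using that assms qpoch2_nz[OF P(1) q(1)] by simp
qed

lemma theta_square_split:
  "theta (x\<^sup>2) P = theta x P * theta (p * x) P * (theta (- x) P * theta (- (p * x)) P)"
  using theta_square[OF p1, of x] theta_split[OF p1 p0, of x] theta_split[OF p1 p0, of "- x"] by simp

text \<open>In \<open>tau_relation\<close> the nodes are the parameters themselves, where one
  summand of \<open>H\<close> vanishes and the other one factors. The theta functions of
  \<open>t / s\<close> and \<open>s / t\<close> differ by an elementary factor and cancel.\<close>

lemma beta_shift_generic:
  assumes t: "t \<noteq> 0" and ts: "t * s * b = p"
    and nz: "theta (t\<^sup>2) P \<noteq> 0" "tau t s \<noteq> 0" "tau s t \<noteq> 0"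
    and \<Gamma>: "sep_cycle (poles t s) \<Gamma>"
  shows "n_fac s * cycle_integral \<Gamma> (beta (q * t) s) = n_fac t * cycle_integral \<Gamma> (beta t (q * s))"
proof -
  have s: "s \<noteq> 0"
    using ts p0 by auto
  define I1 where "I1 = cycle_integral \<Gamma> (beta (q * t) s)"
  define I2 where "I2 = cycle_integral \<Gamma> (beta t (q * s))"
  have "I1 = cycle_integral \<Gamma> (\<lambda>x. weight t s x * tau t x)" "I2 = cycle_integral \<Gamma> (\<lambda>x. weight t s x * tau s x)"
    unfolding I1_def I2_def by (rule cycle_integral_cong[OF \<Gamma>], simp add: weight_tau t s)+
  then have rel: "H t s s / tau t s * I1 + H t s t / tau s t * I2 = 0"
    using tau_relation[OF ts t s nz \<Gamma>] by simp
  have "theta (t / s) P = - (t / s) * theta (s / t) P"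
    using theta_inverse[OF P(1), of "s / t"] t s by simp
  moreover have "H t s s / tau t s = n_fac s / (s * theta (t / s) P)"
    using nz(2) s P by (simp add: H_def tau_def n_fac_def theta_square_split field_simps flip: power2_eq_square)
  moreover have "H t s t / tau s t = n_fac t / (t * theta (s / t) P)"
    using nz(3) t P by (simp add: H_def tau_def n_fac_def theta_square_split field_simps flip: power2_eq_square)
  moreover have "theta (s / t) P \<noteq> 0"
    using nz(3) by (auto simp: tau_def)
  ultimately have "n_fac t * I2 / (t * theta (s / t) P) = n_fac s * I1 / (t * theta (s / t) P)"
    using rel s t by simp
  then show ?thesis
    using \<open>theta (s / t) P \<noteq> 0\<close> t by (simp add: I1_def I2_def)
qed

lemma annulus_open_connected:
  "open {t :: complex. r < norm t \<and> norm t < R}" "connected {t :: complex. r < norm t \<and> norm t < R}"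
proof -
  have "{t :: complex. r < norm t \<and> norm t < R} = {t. r < norm t} \<inter> {t. norm t < R}"
    by auto
  then show "open {t :: complex. r < norm t \<and> norm t < R}"
    by (simp add: open_Collect_less open_Int continuous_intros)
  show "connected {t :: complex. r < norm t \<and> norm t < R}"
    using connected_annulus(1)[of r "0 :: complex" R] by simp
qed

lemma beta_holomorphic:
  assumes "t \<noteq> 0" "s \<noteq> 0"
  shows "beta t s holomorphic_on zero_free (poles t s) (poles t s)"
proof -
  have "(\<lambda>x. theta (- (p * x)) P) holomorphic_on zero_free (poles t s) (poles t s)"
    using p0 P poles_region poles_nz(1)[of _ t s] by (intro holomorphic_on_theta holomorphic_intros) auto
  then have "(\<lambda>x. weight t s x * theta (- (p * x)) P) holomorphic_on zero_free (poles t s) (poles t s)"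
    by (intro holomorphic_intros weight_holomorphic assms)
  then show ?thesis
    by (simp add: weight_def[abs_def] beta_def[abs_def])
qed

lemma circle_beta_holomorphic:
  "circle_beta holomorphic_on {t :: complex. norm (b * p) < norm t \<and> norm t < 1}"
  unfolding circle_beta_def
proof (rule cycle_integral_param_holomorphic)
  let ?A = "{t :: complex. norm (b * p) < norm t \<and> norm t < 1}"
  have t0: "t \<noteq> 0" if "t \<in> ?A" for t
    using that by auto
  show "open ?A"
    by (rule annulus_open_connected)
  show "continuous_on (?A \<times> UNIV) (\<lambda>(t, x). poles t (b * p / t) x)"
    unfolding poles_def case_prod_unfold using t0 P q
    by (intro continuous_intros continuous_on_qpoch2) auto
  show "sep_cycle (poles t (b * p / t)) (circlepath 0 1)" if "t \<in> ?A" for t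
  proof (rule sep_cycle_circle)
    show "norm (b * p / t) < 1"
      using that t0[OF that] by (simp add: norm_divide)
  qed (use that in simp)
  show "beta t (b * p / t) holomorphic_on zero_free (poles t (b * p / t)) (poles t (b * p / t))"
    if "t \<in> ?A" for t
    using t0[OF that] b0 p0 by (intro beta_holomorphic) auto
  show "continuous_on {(t, x). t \<in> ?A \<and> x \<in> zero_free (poles t (b * p / t)) (poles t (b * p / t))}
          (\<lambda>(t, x). beta t (b * p / t) x)"
  proof -
    let ?S = "{(t, x). t \<in> ?A \<and> x \<in> zero_free (poles t (b * p / t)) (poles t (b * p / t))}"
    have "fst z \<noteq> 0 \<and> snd z \<noteq> 0 \<and> qpoch2 (fst z * snd z) P q \<noteq> 0 \<and> qpoch2 (fst z / snd z) P q \<noteq> 0 \<and>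
      qpoch2 (b * p / fst z * snd z) P q \<noteq> 0 \<and> qpoch2 (b * p / fst z / snd z) P q \<noteq> 0" if "z \<in> ?S" for z
      using that t0 poles_nz[of "snd z" "fst z" "b * p / fst z"] by auto
    then show ?thesis
      unfolding beta_def case_prod_unfold using b0 p0 P q
      by (intro continuous_intros egamma_continuous continuous_on_theta) simp_all
  qed
  show "(\<lambda>t. beta t (b * p / t) x) holomorphic_on V" if "open V" "V \<subseteq> ?A"
    "\<And>t. t \<in> V \<Longrightarrow> x \<in> zero_free (poles t (b * p / t)) (poles t (b * p / t))" for x V
  proof -
    have "t \<noteq> 0" if "t \<in> V" for t
      using that t0 \<open>V \<subseteq> ?A\<close> by blast
    moreover note nz = poles_nz[OF that(3)]
    ultimately show ?thesis
      unfolding beta_def using that(1) b0 p0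
      by (intro holomorphic_intros egamma_holomorphic) auto
  qed
qed (rule poles_entire)+

lemma theta_eq_0_norm:
  assumes "theta x P = 0" "x \<noteq> 0"
  shows "\<exists>k :: int. norm x = norm P powi k"
  using assms theta_eq_0_iff[OF P, of x] by (metis norm_power_int)

text \<open>The nonvanishing conditions of \<open>beta_shift_generic\<close> hold at some point \<open>t1\<close> of the annulus, so the
  identity theorem removes them.\<close>

lemma circle_beta_shift:
  assumes t: "norm (p / b) < norm t" "norm t < 1" and pb: "norm p < norm b"
  shows "n_fac (p / (b * t)) * circle_beta (q * t) = n_fac t * circle_beta t"
proof -
  define A where "A = {t :: complex. norm (p / b) < norm t \<and> norm t < 1}"
  have A: "open A" "connected A"
    unfolding A_def by (rule annulus_open_connected)+
  have t0: "t \<noteq> 0" if "t \<in> A" for t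
    using that by (auto simp: A_def)
  have sub: "A \<subseteq> {t :: complex. norm (b * p) < norm t \<and> norm t < 1}"
  proof -
    have "norm (b * p) \<le> norm (p / b)"
      using b0 b1 p0 mult_mono[of "norm b" 1 "norm b" 1]
      by (simp add: norm_mult norm_divide field_simps mult_le_one)
    then show ?thesis
      by (auto simp: A_def)
  qed
  have subq: "q * t \<in> {t :: complex. norm (b * p) < norm t \<and> norm t < 1}" if "t \<in> A" for t
  proof -
    have "norm p < norm b * norm t"
      using that b0 by (simp add: A_def norm_divide field_simps)
    then have "norm b * norm p < norm b * (norm b * norm t)"
      using b0 by (intro mult_strict_left_mono) auto
    then have 1: "norm (b * p) < norm (q * t)"
      by (simp add: norm_mult power2_eq_square)
    have "norm q * norm t \<le> 1 * norm t"
      using q by (intro mult_right_mono) auto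
    then have "norm (q * t) < 1"
      using that by (simp add: norm_mult A_def)
    then show ?thesis
      using 1 by simp
  qed
  have n_hol: "(\<lambda>t. n_fac (u t)) holomorphic_on A" if "u holomorphic_on A" "\<And>t. t \<in> A \<Longrightarrow> u t \<noteq> 0" for u
    unfolding n_fac_def using that A P p0 b0
    by (intro holomorphic_intros holomorphic_on_theta) auto
  define D where "D t = n_fac (p / (b * t)) * circle_beta (q * t) - n_fac t * circle_beta t" for t
  define B where "B t = theta (t\<^sup>2) P * tau t (p / (b * t)) * tau (p / (b * t)) t" for t
  have "circle_beta \<circ> (\<lambda>t. q * t) holomorphic_on A"
    using subq by (intro holomorphic_on_compose_gen[OF _ circle_beta_holomorphic] holomorphic_intros) auto
  then have D_hol: "D holomorphic_on A"
    unfolding D_def o_def using t0 p0 b0 holomorphic_on_subset[OF circle_beta_holomorphic sub]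
    by (intro holomorphic_intros n_hol) auto
  have B_hol: "B holomorphic_on A"
    unfolding B_def tau_def using t0 p0 b0 P A
    by (intro holomorphic_intros holomorphic_on_theta) auto
  have DB: "D t * B t = 0" if tA: "t \<in> A" for t
  proof (cases "B t = 0")
    case False
    have "norm p < norm b * norm t"
      using tA b0 by (simp add: A_def norm_divide field_simps)
    then have "sep_cycle (poles t (p / (b * t))) (circlepath 0 1)"
      using tA t0[OF tA] b0 by (intro sep_cycle_circle) (auto simp: A_def norm_divide norm_mult divide_less_eq)
    then have "n_fac (p / (b * t)) * cycle_integral (circlepath 0 1) (beta (q * t) (p / (b * t))) =
        n_fac t * cycle_integral (circlepath 0 1) (beta t (q * (p / (b * t))))"
      using False t0[OF tA] b0 by (intro beta_shift_generic) (auto simp: B_def)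
    moreover have "b * p / (q * t) = p / (b * t)" "q * (p / (b * t)) = b * p / t"
      using b0 by (auto simp: power2_eq_square)
    ultimately show ?thesis
      by (simp add: D_def circle_beta_def)
  qed auto
  obtain t1 where t1: "t1 \<in> A" "B t1 \<noteq> 0"
  proof -
    \<comment> \<open>With \<open>s = p / (b * t1)\<close> and \<open>norm t1 = \<rho>\<close>, the
      five radii are those at which the theta functions of \<open>t1\<^sup>2\<close>,
      \<open>- (p * s)\<close>, \<open>t1 / s\<close>, \<open>- (p * t1)\<close> and
      \<open>s / t1\<close>, in this order, could vanish. The remaining argument
      \<open>t1 * s = p / b\<close> is fixed and lies between \<open>norm P\<close> and 1 in
      norm.\<close>
    define bad where "bad = (\<Union>k :: int. {sqrt (norm P powi k), norm (p * p / b) / (norm P powi k),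
      sqrt (norm (p / b) * norm P powi k), norm P powi k / norm p, sqrt (norm (p / b) / (norm P powi k))})"
    have "countable bad"
      unfolding bad_def by auto
    moreover have "norm (p / b) < 1"
      using pb b0 by (simp add: norm_divide)
    ultimately have "uncountable ({norm (p / b)<..<1} - bad)"
      by (intro uncountable_minus_countable) (auto simp: uncountable_open_interval)
    then obtain \<rho> where \<rho>: "norm (p / b) < \<rho>" "\<rho> < 1" "\<rho> \<notin> bad"
      by (metis Diff_iff countable_empty greaterThanLessThan_iff ex_in_conv)
    have \<rho>0: "\<rho> > 0"
      using \<rho>(1) by (rule le_less_trans[OF norm_ge_zero])
    define t1 :: complex where "t1 = of_real \<rho>"
    have n1: "norm t1 = \<rho>" and t1: "t1 \<noteq> 0"
      using \<rho>0 by (auto simp: t1_def)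
    have "t1 \<in> A"
      using \<rho> n1 by (simp add: A_def)
    define s where "s = p / (b * t1)"
    have s: "s \<noteq> 0"
      using p0 b0 t1 by (simp add: s_def)
    have ns: "norm s = norm (p / b) / \<rho>"
      using n1 by (simp add: s_def norm_divide norm_mult)
    have Pk: "norm P powi k > 0" for k
      using P by (intro zero_less_power_int) auto
    have notbad: "\<rho> \<noteq> sqrt (norm P powi k)" "\<rho> \<noteq> norm (p * p / b) / (norm P powi k)"
      "\<rho> \<noteq> sqrt (norm (p / b) * norm P powi k)" "\<rho> \<noteq> norm P powi k / norm p"
      "\<rho> \<noteq> sqrt (norm (p / b) / (norm P powi k))" for k
      using \<rho>(3) unfolding bad_def by blast+
    have sq: "\<rho> = sqrt c" if "\<rho>\<^sup>2 = c" for c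
      using that \<rho>0 by (metis real_sqrt_unique less_imp_le)
    have "theta (t1\<^sup>2) P \<noteq> 0"
    proof
      assume "theta (t1\<^sup>2) P = 0"
      then obtain k where "norm (t1\<^sup>2) = norm P powi k"
        using theta_eq_0_norm t1 by (metis power_not_zero)
      then show False
        using sq[of "norm P powi k"] notbad(1)[of k] n1 by (simp add: norm_power)
    qed
    moreover have "theta (- (p * s)) P \<noteq> 0"
    proof
      assume "theta (- (p * s)) P = 0"
      then obtain k where k: "norm (- (p * s)) = norm P powi k"
        using theta_eq_0_norm s p0 by (metis neg_equal_0_iff_equal mult_eq_0_iff)
      have "norm (p * p / b) / \<rho> = norm P powi k"
        using k by (simp add: norm_mult norm_divide ns)
      then have *: "norm (p * p / b) = \<rho> * norm P powi k"
        using \<rho>0 by (simp add: field_simps)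
      have "\<rho> = norm (p * p / b) / norm P powi k"
        unfolding * using Pk[of k] by (metis less_irrefl nonzero_mult_div_cancel_right)
      then show False
        using notbad(2)[of k] by blast
    qed
    moreover have "theta (- (p * t1)) P \<noteq> 0"
    proof
      assume "theta (- (p * t1)) P = 0"
      then obtain k where k: "norm (- (p * t1)) = norm P powi k"
        using theta_eq_0_norm t1 p0 by (metis neg_equal_0_iff_equal mult_eq_0_iff)
      then show False
        using notbad(4)[of k] p0 n1 by (simp add: norm_mult field_simps)
    qed
    moreover have "theta (t1 / s) P \<noteq> 0"
    proof
      assume "theta (t1 / s) P = 0"
      then obtain k where k: "norm (t1 / s) = norm P powi k"
        using theta_eq_0_norm t1 s by (metis divide_eq_0_iff)
      have "\<rho>\<^sup>2 = norm (p / b) * norm P powi k"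
        using k \<rho>0 p0 b0 by (simp add: norm_divide n1 ns power2_eq_square field_simps)
      then show False
        using sq notbad(3)[of k] by blast
    qed
    moreover have "theta (s / t1) P \<noteq> 0"
    proof
      assume "theta (s / t1) P = 0"
      then obtain k where k: "norm (s / t1) = norm P powi k"
        using theta_eq_0_norm t1 s by (metis divide_eq_0_iff)
      have "norm (p / b) / \<rho> / \<rho> = norm P powi k"
        using k by (simp only: norm_divide[of s t1] ns n1)
      then have *: "norm (p / b) = \<rho>\<^sup>2 * norm P powi k"
        using \<rho>0 by (simp add: power2_eq_square field_simps)
      have "\<rho>\<^sup>2 = norm (p / b) / norm P powi k"
        unfolding * using Pk[of k] by (metis less_irrefl nonzero_mult_div_cancel_right)
      then show False
        using sq notbad(5)[of k] by blast
    qed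
    moreover have "theta (t1 * s) P \<noteq> 0"
    proof -
      have "t1 * s = p / b"
        using t1 by (simp add: s_def)
      moreover have "norm P < norm (p / b)"
      proof -
        have "norm b * norm p < 1"
          using b1 p1 mult_strict_mono'[of "norm b" 1 "norm p" 1] by simp
        then have "norm b * norm p * norm p < 1 * norm p"
          using p0 by (intro mult_strict_right_mono) auto
        then show ?thesis
          using b0 by (simp add: norm_divide norm_mult power2_eq_square less_divide_eq mult_ac)
      qed
      ultimately show ?thesis
        using \<open>norm (p / b) < 1\<close> P by (simp add: theta_nz)
    qed
    ultimately have "B t1 \<noteq> 0"
      by (simp add: B_def tau_def s_def[symmetric] mult.commute)
    then show thesis
      using that \<open>t1 \<in> A\<close> by blast
  qed
  have "D t = 0"
    using t by (intro holomorphic_mult_eq_0[OF A D_hol B_hol DB t1]) (auto simp: A_def)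
  then show ?thesis
    by (simp add: D_def)
qed

lemma N_fac_nz:
  assumes "norm (b * p) < norm t" "norm t < 1"
  shows "N_fac t \<noteq> 0"
proof -
  have t0: "t \<noteq> 0"
    using assms(1) by auto
  have g: "egamma y P q \<noteq> 0" if "y \<noteq> 0" "norm y < 1" "norm (P * q) < norm y" for y
    using that P q unfolding egamma_def by (auto simp: qpoch2_nz norm_divide divide_less_eq)
  have less: "norm x * norm y < norm y" if "norm x < 1" "y \<noteq> 0" for x y :: complex
    using that mult_strict_right_mono[of "norm x" 1 "norm y"] by simp
  have bp: "norm (b * p) < 1"
    using less[OF b1 p0] p1 by (simp add: norm_mult)
  have 1: "norm (P * q) < norm t"
  proof -
    have "norm (P * q) = norm (b * p) * norm (b * p)"
      by (simp add: norm_mult norm_power power2_eq_square)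
    also have "\<dots> < norm (b * p)"
      using less[OF bp, of "b * p"] b0 p0 by simp
    finally show ?thesis
      using assms by simp
  qed
  have 2: "norm (P * q) < norm (p * t)"
  proof -
    have "norm (P * q) = norm p * (norm b * norm (b * p))"
      by (simp add: norm_mult norm_power power2_eq_square)
    also have "\<dots> < norm p * norm (b * p)"
      using less[OF b1, of "b * p"] b0 p0 by (intro mult_strict_left_mono) auto
    also have "\<dots> < norm p * norm t"
      using assms p0 by (intro mult_strict_left_mono) auto
    finally show ?thesis
      by (simp add: norm_mult)
  qed
  have 3: "norm (P * q) < norm (b * t)"
  proof -
    have "norm (P * q) = norm b * (norm p * norm (b * p))"
      by (simp add: norm_mult norm_power power2_eq_square)
    also have "\<dots> < norm b * norm (b * p)"
      using less[OF p1, of "b * p"] b0 p0 by (intro mult_strict_left_mono) auto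
    also have "\<dots> < norm b * norm t"
      using assms b0 by (intro mult_strict_left_mono) auto
    finally show ?thesis
      by (simp add: norm_mult)
  qed
  have 4: "norm (p * t) < 1" "norm (b * t) < 1"
    using less[OF p1 t0] less[OF b1 t0] assms by (auto simp: norm_mult)
  show ?thesis
    unfolding N_fac_def using g[of t] g[of "- t"] g[of "p * t"] g[of "- (b * t)"] 1 2 3 4 t0 p0 b0 assms by simp
qed

lemma N_fac_q:
  assumes "t \<noteq> 0" "norm t < 1"
  shows "N_fac (q * t) = n_fac t * N_fac t"
proof -
  have nz: "qpoch2 x P q \<noteq> 0" if "norm x < 1" for x
    using that P q by (intro qpoch2_nz)
  have "norm (p * t) < 1" "norm (b * t) < 1"
    using mult_strict_mono'[of "norm p" 1 "norm t" 1] mult_strict_mono'[of "norm b" 1 "norm t" 1] assms p1 b1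
    by (auto simp: norm_mult)
  moreover have e: "egamma (q * y) P q = theta y P * egamma y P q" if "y \<noteq> 0" "norm y < 1" for y
    by (rule egamma_q[OF that(1) nz[OF that(2)]])
  moreover have "- (q * t) = q * - t" "p * (q * t) = q * (p * t)" "- (b * (q * t)) = q * - (b * t)"
    by simp_all
  ultimately have "N_fac (q * t) = (theta t P * egamma t P q) * (theta (- t) P * egamma (- t) P q) *
      (theta (p * t) P * egamma (p * t) P q) * (theta (- (b * t)) P * egamma (- (b * t)) P q)"
    unfolding N_fac_def using assms p0 b0 by (metis e neg_equal_0_iff_equal mult_eq_0_iff norm_minus_cancel)
  then show ?thesis
    by (simp add: N_fac_def n_fac_def mult_ac)
qed

lemma N_fac_holomorphic:
  "N_fac holomorphic_on {t :: complex. norm (b * p) < norm t \<and> norm t < 1}"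
proof -
  have nz: "qpoch2 (x * t) P q \<noteq> 0" if "norm x \<le> 1" "norm t < 1" for x t
  proof -
    have "norm (x * t) \<le> norm t"
      using that mult_right_mono[of "norm x" 1 "norm t"] by (simp add: norm_mult)
    then show ?thesis
      using that P q by (intro qpoch2_nz) auto
  qed
  show ?thesis
    unfolding N_fac_def using annulus_open_connected(1)[of "norm (b * p)" 1] p0 b0 p1 b1
      nz[of 1] nz[of "- 1"] nz[of p] nz[of "- b"]
    by (intro holomorphic_intros egamma_holomorphic) auto
qed

text \<open>By \<open>circle_beta_shift\<close>, \<open>circle_beta t\<close> and
  \<open>N_fac t * N_fac (b * p / t)\<close> acquire the same factor under
  \<open>t \<mapsto> q * t\<close>. Their quotient is thus \<open>q\<close>-periodic, and
  \<open>norm p < norm b\<close> provides a radius \<rho> with both \<rho> and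
  \<open>\<rho> * norm q\<close> in the annulus.\<close>

lemma circle_beta_proportional:
  assumes pb: "norm p < norm b" and t: "norm (b * p) < norm t" "norm t < 1"
  shows "circle_beta t * (N_fac (- b) * N_fac (- p)) = circle_beta (- b) * (N_fac t * N_fac (b * p / t))"
proof -
  define A where "A = {t :: complex. norm (b * p) < norm t \<and> norm t < 1}"
  have t0: "t \<noteq> 0" if "t \<in> A" for t
    using that by (auto simp: A_def)
  have inA: "b * p / t \<in> A" if "t \<in> A" for t
    using that t0[OF that] b0 p0
    by (auto simp: A_def norm_divide divide_less_eq less_divide_eq)
  have N: "N_fac t \<noteq> 0" if "t \<in> A" for t
    using that N_fac_nz by (simp add: A_def)
  define f where "f t = circle_beta t / (N_fac t * N_fac (b * p / t))" for t
  have "N_fac \<circ> (\<lambda>t. b * p / t) holomorphic_on A"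
    using t0 inA by (intro holomorphic_on_compose_gen[OF _ N_fac_holomorphic] holomorphic_intros) (auto simp: A_def)
  then have f_hol: "f holomorphic_on A"
    unfolding f_def o_def using circle_beta_holomorphic N_fac_holomorphic N inA unfolding A_def
    by (intro holomorphic_intros) auto
  have per: "f (q * t) = f t" if t: "t \<in> A" "q * t \<in> A" for t
  proof -
    define s where "s = p / (b * t)"
    have s0: "s \<noteq> 0"
      using t0[OF t(1)] p0 b0 by (simp add: s_def)
    have sq: "b * p / (q * t) = s" "b * p / t = q * s"
      using b0 by (auto simp: s_def power2_eq_square)
    have s1: "norm s < 1" "s \<in> A"
      using inA[OF t(2)] by (auto simp: sq A_def)
    have pt: "norm (p / b) < norm t"
      using s1(1) t0[OF t(1)] b0 by (simp add: s_def norm_divide norm_mult field_simps)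
    have Nq: "N_fac (q * t) = n_fac t * N_fac t" "N_fac (q * s) = n_fac s * N_fac s"
      using N_fac_q t0[OF t(1)] s0 s1 t by (auto simp: A_def)
    then have nz: "n_fac t \<noteq> 0" "n_fac s \<noteq> 0" "N_fac t \<noteq> 0" "N_fac s \<noteq> 0"
      using N[OF t(2)] N[OF inA[OF t(1)]] sq by auto
    have "n_fac s * circle_beta (q * t) = n_fac t * circle_beta t"
      using circle_beta_shift[OF pt _ pb] t by (simp add: s_def A_def)
    then show ?thesis
      unfolding f_def sq Nq using nz by (simp add: field_simps)
  qed
  obtain \<rho> where \<rho>: "norm (p / b) < \<rho>" "\<rho> < 1"
    using dense[of "norm (p / b)" 1] pb b0 by (auto simp: norm_divide)
  have \<rho>0: "\<rho> > 0"
    using \<rho>(1) by (rule le_less_trans[OF norm_ge_zero])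
  have "norm p < \<rho> * norm b"
    using \<rho>(1) b0 by (simp add: norm_divide field_simps)
  then have "norm b * norm p < norm b * (\<rho> * norm b)"
    using b0 by (intro mult_strict_left_mono) auto
  then have \<rho>q: "norm (b * p) < \<rho> * norm q"
    by (simp add: norm_mult norm_power power2_eq_square mult_ac)
  have \<rho>q1: "\<rho> * norm q < \<rho>"
    using mult_strict_left_mono[of "norm q" 1 \<rho>] \<rho>0 q by simp
  have "\<exists>c. \<forall>t\<in>A. f t = c"
    by (rule q_periodic_constant[where q = q and I = "{norm (b * p)<..<1}" and \<rho> = \<rho>])
      (use q \<rho> \<rho>0 \<rho>q less_trans[OF \<rho>q \<rho>q1] less_trans[OF \<rho>q1 \<rho>(2)] per f_hol annulus_open_connected[of "norm (b * p)" 1] le_less_trans[OF norm_ge_zero] in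
        \<open>auto simp: A_def is_interval_oo\<close>)
  moreover have b: "- b \<in> A"
    using b0 b1 p1 mult_strict_left_mono[of "norm p" 1 "norm b"] by (simp add: A_def norm_mult)
  moreover have "t \<in> A"
    using t by (simp add: A_def)
  ultimately have "f t = f (- b)"
    by metis
  moreover have "b * p / (- b) = - p"
    using b0 by simp
  ultimately show ?thesis
    using N[OF b] N[OF inA[OF b]] N[OF \<open>t \<in> A\<close>] N[OF inA[OF \<open>t \<in> A\<close>]]
    by (simp add: f_def field_simps)
qed

text \<open>For the parameter \<open>- b\<close> the two gamma arguments multiply to
  \<open>q\<close>, for \<open>- p\<close> to \<open>P\<close>, so each pair collapses to the
  reciprocal of a theta function; the second cancels the last factor of \<open>beta\<close>.\<close>

lemma beta_special:
  assumes "norm x = 1"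
  shows "beta (- b) (- p) x = theta (b * x) q / theta (- (b * x)) q"
proof -
  have x: "x \<noteq> 0"
    using assms by auto
  have nz: "qpoch2 (c * w) P q \<noteq> 0" if "norm c < 1" "norm w < 1" for c w
    using that P q mult_strict_mono'[of "norm c" 1 "norm w" 1] by (intro qpoch2_nz) (auto simp: norm_mult)
  have nrm: "norm (- (b * x)) < 1" "norm (- b / x) < 1" "norm (- (p * x)) < 1" "norm (- p / x) < 1"
    using assms p1 b1 by (auto simp: norm_mult norm_divide)
  have "egamma (- (b * x)) P q * egamma (- b / x) P q = 1 / theta (- (b * x)) q"
    using x b0 nrm P q by (intro egamma_mult_q nz) (auto simp: power2_eq_square)
  moreover have "egamma (- (p * x)) P q * egamma (- p / x) P q = 1 / theta (- (p * x)) P"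
    using x p0 nrm P q by (intro egamma_mult_P nz) (auto simp: power2_eq_square)
  moreover have "theta (- (p * x)) P \<noteq> 0"
  proof (rule theta_nz[OF P])
    show "norm P < norm (- (p * x))"
      using assms p0 p1 mult_strict_left_mono[of "norm p" 1 "norm p"] by (simp add: norm_mult norm_power power2_eq_square)
  qed (use nrm in auto)
  moreover have "beta (- b) (- p) x = (egamma (- (b * x)) P q * egamma (- b / x) P q) *
     (egamma (- (p * x)) P q * egamma (- p / x) P q) * theta (b * x) q * theta (- (p * x)) P"
    by (simp add: beta_def)
  ultimately show ?thesis
    by simp
qed

text \<open>The integrand \<open>e\<close> satisfies \<open>e (q x) = - e x\<close>, so twice the integral is the difference of the
  integrals over the circles of radius 1 and \<open>norm q\<close>, which is the residue of \<open>e x / x\<close> at \<open>- b\<close>.\<close>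

lemma circle_beta_special: "circle_beta (- b) = (qpoch (- q) q / qpoch q q)\<^sup>2"
proof -
  define e where "e x = theta (b * x) q / theta (- (b * x)) q" for x
  define A where "A = {x :: complex. norm (b * q) < norm x \<and> norm x < 1 / norm b}"
  have A: "open A" "connected A"
    unfolding A_def by (rule annulus_open_connected)+
  have A0: "x \<noteq> 0" if "x \<in> A" for x
    using that by (auto simp: A_def)
  \<comment> \<open>This is \<open>theta (- (b * x)) q\<close> without the factor
    \<open>(x + b) / x\<close>. It has no zeros in \<open>A\<close>, so \<open>- b\<close> is the
    only possible pole of \<open>e x / x\<close> there.\<close>
  define M where "M x = qpoch (- (b * x)) q * qpoch (- (b * q) / x) q" for x
  have M: "M x \<noteq> 0" if "x \<in> A" for x
  proof -
    have "norm (- (b * x)) < 1" "norm (- (b * q) / x) < 1"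
      using that A0[OF that] b0 by (auto simp: A_def norm_mult norm_divide field_simps)
    then show ?thesis
      unfolding M_def using qpoch_nz[OF q(1)] by simp
  qed
  have theta_M: "theta (- (b * x)) q = (x + b) / x * M x" if "x \<noteq> 0" for x
  proof -
    have "q / (- (b * x)) = - b / x" "- b / x * q = - (b * q) / x" "1 - (- b / x) = (x + b) / x"
      using that b0 by (auto simp: power2_eq_square field_simps)
    then show ?thesis
      using qpoch_rec[OF q(1), of "- b / x"] by (simp add: theta_def M_def)
  qed
  define \<phi> where "\<phi> x = theta (b * x) q / M x" for x
  have \<phi>_hol: "\<phi> holomorphic_on A"
    unfolding \<phi>_def using M A0 A b0 q unfolding M_def
    by (intro holomorphic_intros holomorphic_on_theta holomorphic_on_qpoch) auto
  have e_\<phi>: "e x / x = \<phi> x / (x + b)" if "x \<noteq> 0" for x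
    using that theta_M[OF that] by (simp add: e_def \<phi>_def)
  define \<psi> where "\<psi> x = (if x = - b then deriv \<phi> (- b) else (\<phi> x - \<phi> (- b)) / (x - (- b)))" for x
  have \<psi>_hol: "\<psi> holomorphic_on A"
    unfolding \<psi>_def by (rule pole_lemma_open[OF \<phi>_hol A(1)])
  define g where "g = circlepath 0 1"
  define h where "h = (\<lambda>x. q * x) \<circ> g"
  have g: "valid_path g" "pathfinish g = pathstart g" "path_image g = sphere 0 1"
    by (auto simp: g_def)
  have an: "(\<lambda>x. q * x) analytic_on UNIV"
    by (intro analytic_intros)
  have h: "valid_path h" "pathfinish h = pathstart h"
    unfolding h_def using g(2)
    by (auto intro!: valid_path_compose_holomorphic[OF g(1) analytic_imp_holomorphic[OF an]]
        simp: pathstart_compose pathfinish_compose)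
  have h_im: "path_image h \<subseteq> sphere 0 (norm q)"
    using g(3) by (auto simp: h_def path_image_compose norm_mult)
  have int: "contour_integral h F = contour_integral g (\<lambda>w. q * F (q * w))" for F
    unfolding h_def using contour_integral_comp_analyticW[OF an g(1), of F] by simp
  have bq: "norm (b * q) < norm q" "norm q < norm b" "norm b < 1"
    using b0 b1 q mult_strict_right_mono[of "norm b" 1 "norm q"] mult_strict_left_mono[of "norm b" 1 "norm b"]
    by (auto simp: norm_mult norm_power power2_eq_square)
  have b1': "1 < 1 / norm b"
    using b0 b1 by simp
  have im: "path_image g \<subseteq> A" "path_image h \<subseteq> A"
    using g(3) h_im bq b1' by (auto simp: A_def)
  have wg: "winding_number g w = (if norm w < 1 then 1 else 0)" if "norm w \<noteq> 1" for w
    using winding_circlepath_inside(2)[of w 1] winding_circlepath_outside(2)[of 1 w] that by (auto simp: g_def)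
  have wh: "winding_number h w = (if norm w < norm q then 1 else 0)" if "norm w \<noteq> norm q" for w
  proof -
    have "contour_integral h (\<lambda>x. 1 / (x - w)) = contour_integral g (\<lambda>x. 1 / (x - w / q))"
      unfolding int
    proof (rule contour_integral_cong[OF refl])
      fix x assume "x \<in> path_image g"
      then have "x \<noteq> w / q"
        using that q g(3) by (auto simp: norm_divide)
      then show "q * (1 / (q * x - w)) = 1 / (x - w / q)"
        using q by (auto simp: field_simps)
    qed
    moreover have "w \<notin> path_image h" "w / q \<notin> path_image g"
      using that h_im g(3) q by (auto simp: norm_divide)
    ultimately have "winding_number h w = winding_number g (w / q)"
      using winding_number_valid_path[OF h(1)] winding_number_valid_path[OF g(1)] by metis
    then show ?thesis
      using wg[of "w / q"] that q by (simp add: norm_divide)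
  qed
  have "contour_integral g \<psi> = contour_integral h \<psi>"
  proof (rule contour_integral_eq_same_winding[OF A \<psi>_hol g(1,2) im(1) h im(2)])
    fix w assume "w \<notin> A"
    then have "norm w \<le> norm (b * q) \<or> 1 / norm b \<le> norm w"
      by (auto simp: A_def)
    then show "winding_number g w = winding_number h w"
      using wg[of w] wh[of w] bq b1' by auto
  qed
  have part: "contour_integral k \<psi> = contour_integral k (\<lambda>x. e x / x) - \<phi> (- b) * (2 * pi * \<i> * winding_number k (- b))"
    if k: "valid_path k" "path_image k \<subseteq> A" "- b \<notin> path_image k" for k
  proof -
    have ik: "(\<lambda>x. \<phi> x / (x + b)) contour_integrable_on k"
    proof (rule contour_integrable_holomorphic_simple[OF _ _ k(1)])
      show "(\<lambda>x. \<phi> x / (x + b)) holomorphic_on A - {- b}"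
        using \<phi>_hol by (intro holomorphic_intros) (auto simp: eq_neg_iff_add_eq_0 elim: holomorphic_on_subset)
    qed (use A k in auto)
    have ik2: "(\<lambda>x. \<phi> (- b) * (1 / (x - (- b)))) contour_integrable_on k"
      by (intro contour_integrable_lmul contour_integrable_inversediff k)
    have "contour_integral k \<psi> = contour_integral k (\<lambda>x. \<phi> x / (x + b) - \<phi> (- b) * (1 / (x - (- b))))"
      by (rule contour_integral_cong) (use k in \<open>auto simp: \<psi>_def diff_divide_distrib\<close>)
    also have "\<dots> = contour_integral k (\<lambda>x. \<phi> x / (x + b)) - contour_integral k (\<lambda>x. \<phi> (- b) * (1 / (x - (- b))))"
      by (rule contour_integral_diff[OF ik ik2])
    also have "contour_integral k (\<lambda>x. \<phi> (- b) * (1 / (x - (- b)))) = \<phi> (- b) * contour_integral k (\<lambda>x. 1 / (x - (- b)))"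
      by (intro contour_integral_lmul contour_integrable_inversediff k)
    also have "contour_integral k (\<lambda>x. 1 / (x - (- b))) = 2 * pi * \<i> * winding_number k (- b)"
      using winding_number_valid_path[OF k(1,3)] by simp
    also have "contour_integral k (\<lambda>x. \<phi> x / (x + b)) = contour_integral k (\<lambda>x. e x / x)"
      by (rule contour_integral_cong) (use k A0 e_\<phi> in auto)
    finally show ?thesis .
  qed
  have "- b \<notin> path_image g" "- b \<notin> path_image h"
    using g(3) h_im bq by auto
  moreover have "winding_number g (- b) = 1" "winding_number h (- b) = 0"
    using wg[of "- b"] wh[of "- b"] bq by auto
  ultimately have "contour_integral g (\<lambda>x. e x / x) - \<phi> (- b) * (2 * pi * \<i>) = contour_integral h (\<lambda>x. e x / x)"
    using part[OF g(1) im(1)] part[OF h(1) im(2)] \<open>contour_integral g \<psi> = contour_integral h \<psi>\<close> by simp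
  also have "\<dots> = contour_integral g (\<lambda>x. - (e x / x))"
    unfolding int
  proof (rule contour_integral_cong[OF refl])
    fix x assume "x \<in> path_image g"
    then have x: "x \<noteq> 0" using A0 im by blast
    have "theta (q * (b * x)) q = - theta (b * x) q / (b * x)"
      "theta (q * - (b * x)) q = theta (- (b * x)) q / (b * x)"
      using theta_shift[OF q, of "b * x"] theta_shift[OF q, of "- (b * x)"] b0 x by auto
    then show "q * (e (q * x) / (q * x)) = - (e x / x)"
      using x b0 q by (simp add: e_def mult_ac)
  qed
  also have "\<dots> = - contour_integral g (\<lambda>x. e x / x)"
    by (rule contour_integral_neg)
  finally have "contour_integral g (\<lambda>x. e x / x) = \<phi> (- b) * (pi * \<i>)"
    by (simp add: field_simps)
  moreover have cancel: "x * c / (2 * c) = x / 2" if "c \<noteq> 0" for x c :: complex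
    using that by simp
  ultimately have "cycle_integral g e = \<phi> (- b) / 2"
    using cancel[of "pi * \<i>" "\<phi> (- b)"] by (simp add: cycle_integral_def mult.assoc)
  moreover have "cycle_integral g (beta (- b) (- p)) = cycle_integral g e"
    unfolding cycle_integral_def
    by (intro arg_cong2[where f = "(/)"] contour_integral_cong refl) (use g(3) in \<open>auto simp: e_def beta_special\<close>)
  moreover have "b * p / (- b) = - p"
    using b0 by simp
  ultimately have "circle_beta (- b) = \<phi> (- b) / 2"
    by (simp only: circle_beta_def g_def[symmetric])
  also have "\<phi> (- b) = 2 * (qpoch (- q) q / qpoch q q)\<^sup>2"
  proof -
    have "theta (- q) q = theta (- 1) q"
      using theta_shift[OF q, of "- 1"] by simp
    also have "\<dots> = 2 * qpoch (- q) q * qpoch (- q) q"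
      using qpoch_rec[OF q(1), of "- 1"] by (simp add: theta_def)
    finally show ?thesis
      using b0 by (simp add: \<phi>_def M_def power2_eq_square power_divide)
  qed
  finally show ?thesis
    by simp
qed

end

section \<open>The integral as a theta function of \<open>z\<close>\<close>

locale target_kernel =
  fixes p a :: complex
  assumes p_nz: "p \<noteq> 0" and p_less: "norm p < 1" and a0: "a \<noteq> 0" and a1: "norm a < 1"
begin

sublocale beta_kernel p "a\<^sup>2"
  using p_nz p_less a0 a1 by unfold_locales (auto simp: norm_power power_less_one_iff)

text \<open>The even powers of \<open>p\<close> belong to the parameter \<open>1 / a\<close>, the
  odd ones to \<open>p / a\<close>.\<close>

lemma poles_target: "poles (1 / a) (p / a) = (\<lambda>u. qpoch2 (u / a) p q)"
  using qpoch2_even_odd[OF p1 q(1), of "u / a" for u] by (simp add: poles_def fun_eq_iff mult_ac)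

lemma weight_target:
  assumes "x \<noteq> 0"
  shows "weight (1 / a) (p / a) x = egamma (x / a) p q * egamma (1 / (x * a)) p q * theta (a\<^sup>2 * x) q"
  using egamma_split[OF p1 p0 q(1), of "x / a"] egamma_split[OF p1 p0 q(1), of "1 / (x * a)"] assms a0
  by (simp add: weight_def mult_ac)

text \<open>The second factor is what the dissection leaves of two theta functions of nome
  \<open>p ^ 8\<close>, at \<open>y = z\<^sup>2 / x\<close>.\<close>

definition Phi :: "complex \<Rightarrow> complex \<Rightarrow> complex" where
  "Phi z x = theta (x * z) p * theta (- (z\<^sup>2 / x)) P"

definition F :: "(real \<Rightarrow> complex) \<Rightarrow> complex \<Rightarrow> complex" where
  "F \<Gamma> z = cycle_integral \<Gamma> (\<lambda>x. weight (1 / a) (p / a) x * Phi z x)"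

abbreviation "D \<equiv> poles (1 / a) (p / a)"
abbreviation "\<Omega> \<equiv> zero_free D D"

lemma nz_ts: "1 / a \<noteq> 0" "p / a \<noteq> 0"
  using a0 p0 by auto

lemma Phi_holomorphic: "Phi z holomorphic_on \<Omega>" if "z \<noteq> 0"
  unfolding Phi_def using that p1 P zero_free_nz poles_region
  by (intro holomorphic_intros holomorphic_on_theta) auto

lemma weight_Phi_holomorphic: "z \<noteq> 0 \<Longrightarrow> (\<lambda>x. weight (1 / a) (p / a) x * Phi z x) holomorphic_on \<Omega>"
  by (intro holomorphic_intros weight_holomorphic nz_ts Phi_holomorphic)

lemma F_holomorphic:
  assumes \<Gamma>: "sep_cycle D \<Gamma>"
  shows "F \<Gamma> holomorphic_on - {0}"
proof -
  have "(\<lambda>z. cycle_integral ((\<lambda>_. \<Gamma>) z) (\<lambda>x. weight (1 / a) (p / a) x * Phi z x)) holomorphic_on - {0}"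
  proof (rule cycle_integral_param_holomorphic[where D = "\<lambda>_. D"])
    show "continuous_on ((- {0 :: complex}) \<times> UNIV) (\<lambda>(u, x). D x)"
      unfolding case_prod_unfold
      by (rule continuous_on_compose2[OF holomorphic_on_imp_continuous_on[OF poles_entire(1)]])
        (auto intro!: continuous_intros)
    show "(\<lambda>x. weight (1 / a) (p / a) x * Phi u x) holomorphic_on \<Omega>" if "u \<in> - {0}" for u
      using that by (intro weight_Phi_holomorphic) auto
    show "continuous_on {(u, x). u \<in> - {0} \<and> x \<in> \<Omega>} (\<lambda>(u, x). weight (1 / a) (p / a) x * Phi u x)"
    proof -
      have "continuous_on {(u, x). u \<in> - {0} \<and> x \<in> \<Omega>} (\<lambda>z. weight (1 / a) (p / a) (snd z))"
        by (rule continuous_on_compose2[OF holomorphic_on_imp_continuous_on[OF weight_holomorphic[OF nz_ts]]])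
          (auto intro!: continuous_intros)
      moreover have "continuous_on {(u, x). u \<in> - {0} \<and> x \<in> \<Omega>} (\<lambda>z. Phi (fst z) (snd z))"
        unfolding Phi_def using p1 P zero_free_nz
        by (intro continuous_intros continuous_on_theta) auto
      ultimately show ?thesis
        unfolding case_prod_unfold by (rule continuous_on_mult)
    qed
    show "(\<lambda>u. weight (1 / a) (p / a) x * Phi u x) holomorphic_on V"
      if "open V" "V \<subseteq> - {0}" "\<And>u. u \<in> V \<Longrightarrow> x \<in> \<Omega>" for x V
      unfolding Phi_def using that zero_free_nz[of x D D] p1 P
      by (intro holomorphic_intros holomorphic_on_theta) auto
  qed (use \<Gamma> poles_entire in auto)
  then show ?thesis
    by (simp add: F_def[abs_def])
qed

lemma Phi_p: "Phi (p * z) x = - Phi z x / z ^ 3" if "x \<noteq> 0" "z \<noteq> 0"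
proof -
  have "theta (p * (x * z)) p = - theta (x * z) p / (x * z)"
    using theta_shift[OF p1 p0, of "x * z"] that by simp
  moreover have "theta (P * - (z\<^sup>2 / x)) P = theta (- (z\<^sup>2 / x)) P * x / z\<^sup>2"
    using theta_shift[OF P, of "- (z\<^sup>2 / x)"] that by simp
  moreover have "x * (p * z) = p * (x * z)" "- ((p * z)\<^sup>2 / x) = P * - (z\<^sup>2 / x)"
    by (simp_all add: power_mult_distrib)
  ultimately have "Phi (p * z) x = (- theta (x * z) p / (x * z)) * (theta (- (z\<^sup>2 / x)) P * x / z\<^sup>2)"
    unfolding Phi_def by (simp only:)
  then show ?thesis
    using that by (simp add: Phi_def power2_eq_square power3_eq_cube)
qed

lemma Phi_inverse: "Phi (1 / z) (1 / x) = - Phi z x / z ^ 3" if "x \<noteq> 0" "z \<noteq> 0"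
proof -
  have "theta (1 / (x * z)) p = - theta (x * z) p / (x * z)"
    using theta_inverse[OF p1, of "x * z"] that by simp
  moreover have "theta (1 / - (z\<^sup>2 / x)) P = theta (- (z\<^sup>2 / x)) P * x / z\<^sup>2"
    using theta_inverse[OF P(1), of "- (z\<^sup>2 / x)"] that by simp
  moreover have "1 / x * (1 / z) = 1 / (x * z)" "- ((1 / z)\<^sup>2 / (1 / x)) = 1 / - (z\<^sup>2 / x)"
    by (simp_all add: power_divide)
  ultimately have "Phi (1 / z) (1 / x) = (- theta (x * z) p / (x * z)) * (theta (- (z\<^sup>2 / x)) P * x / z\<^sup>2)"
    unfolding Phi_def by (simp only:)
  then show ?thesis
    using that by (simp add: Phi_def power2_eq_square power3_eq_cube)
qed

lemma F_p: "F \<Gamma> (p * z) = - F \<Gamma> z / z ^ 3" if "sep_cycle D \<Gamma>" "z \<noteq> 0"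
proof -
  have "F \<Gamma> (p * z) = cycle_integral \<Gamma> (\<lambda>x. - 1 / z ^ 3 * (weight (1 / a) (p / a) x * Phi z x))"
    unfolding F_def using that zero_free_nz by (intro cycle_integral_cong[OF that(1)]) (auto simp: Phi_p)
  also have "\<dots> = - 1 / z ^ 3 * F \<Gamma> z"
    by (simp only: cycle_integral_cmult F_def)
  finally show ?thesis
    by simp
qed

lemma F_inverse: "F \<Gamma> (1 / z) = - F \<Gamma> z / z ^ 3" if "sep_cycle D \<Gamma>" "z \<noteq> 0"
proof -
  have "F \<Gamma> (1 / z) = cycle_integral \<Gamma> (\<lambda>x. weight (1 / a) (p / a) (1 / x) * Phi (1 / z) (1 / x))"
    unfolding F_def using that weight_Phi_holomorphic[of "1 / z"]
    by (intro cycle_integral_inverse[OF poles_entire _ that(1), symmetric]) auto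
  also have "\<dots> = cycle_integral \<Gamma> (\<lambda>x. - 1 / z ^ 3 * (weight (1 / a) (p / a) x * Phi z x))"
    using that zero_free_nz by (intro cycle_integral_cong[OF that(1)]) (auto simp: Phi_inverse weight_inverse)
  also have "\<dots> = - 1 / z ^ 3 * F \<Gamma> z"
    by (simp only: cycle_integral_cmult F_def)
  finally show ?thesis
    by simp
qed

text \<open>For the parameters \<open>1 / a\<close> and \<open>p / a\<close> the function \<open>H\<close> is a symmetrization of \<open>Phi a\<close>.\<close>

lemma F_a: "F \<Gamma> a = 0" if \<Gamma>: "sep_cycle D \<Gamma>"
proof -
  have H: "H (1 / a) (p / a) x = - (1 / a) * (Phi a x + Phi a (1 / x))" if x: "x \<noteq> 0" for x
  proof -
    have 1: "theta (1 / (x * a)) p = - theta (x * a) p / (x * a)"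
      using theta_inverse[OF p1, of "x * a"] x a0 by simp
    have 2: "theta (x / a) p = - theta (a / x) p * (x / a)"
      using theta_inverse[OF p1, of "a / x"] x a0 by simp
    have "theta (1 / a / x) P * theta (p / a / x) P = theta (1 / (x * a)) p"
      "theta (1 / a * x) P * theta (p / a * x) P = theta (x / a) p"
      using theta_split[OF p1 p0, of "1 / (x * a)"] theta_split[OF p1 p0, of "x / a"] by (simp_all add: mult_ac)
    then have "H (1 / a) (p / a) x = x * theta (1 / (x * a)) p * theta (- (a\<^sup>2) / x) P +
        theta (x / a) p * theta (- (a\<^sup>2 * x)) P / x"
      unfolding H_def by (simp add: mult.assoc)
    also have "\<dots> = - (1 / a) * (theta (x * a) p * theta (- (a\<^sup>2) / x) P + theta (a / x) p * theta (- (a\<^sup>2 * x)) P)"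
      unfolding 1 2 using x a0 by (simp add: distrib_left)
    finally show ?thesis
      using x by (simp add: Phi_def mult.commute)
  qed
  have hol: "(\<lambda>x. weight (1 / a) (p / a) x * Phi a (1 / x)) holomorphic_on \<Omega>"
  proof (intro holomorphic_intros weight_holomorphic nz_ts)
    show "(\<lambda>x. Phi a (1 / x)) holomorphic_on \<Omega>"
      unfolding Phi_def using a0 p1 P zero_free_nz poles_region
      by (intro holomorphic_intros holomorphic_on_theta) auto
  qed
  have "0 = cycle_integral \<Gamma> (\<lambda>x. weight (1 / a) (p / a) x * H (1 / a) (p / a) x)"
    using weight_H_integral[OF nz_ts \<Gamma>] by simp
  also have "\<dots> = cycle_integral \<Gamma> (\<lambda>x. - (1 / a) * (weight (1 / a) (p / a) x * Phi a x + weight (1 / a) (p / a) x * Phi a (1 / x)))"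
    by (rule cycle_integral_cong[OF \<Gamma>]) (simp add: H zero_free_nz algebra_simps)
  also have "\<dots> = - (1 / a) * (F \<Gamma> a + cycle_integral \<Gamma> (\<lambda>x. weight (1 / a) (p / a) x * Phi a (1 / x)))"
    unfolding cycle_integral_cmult F_def
    using cycle_integral_add[OF poles_entire \<Gamma> weight_Phi_holomorphic[OF a0] hol] by simp
  also have "cycle_integral \<Gamma> (\<lambda>x. weight (1 / a) (p / a) x * Phi a (1 / x)) =
      cycle_integral \<Gamma> (\<lambda>x. weight (1 / a) (p / a) (1 / x) * Phi a (1 / x))"
    by (rule cycle_integral_cong[OF \<Gamma>]) (simp add: weight_inverse zero_free_nz)
  also have "\<dots> = F \<Gamma> a"
    unfolding F_def by (rule cycle_integral_inverse[OF poles_entire weight_Phi_holomorphic[OF a0] \<Gamma>])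
  finally show ?thesis
    using a0 by simp
qed

text \<open>Theta zeros are integral powers of \<open>p\<close>. Those with exponent at most 0 have
  norm at least 1 and cannot equal \<open>a\<^sup>2\<close>, so positive exponents are all that must
  be excluded; \<open>a\<close> and \<open>- a\<close> are reduced to \<open>a\<^sup>2\<close> by
  squaring.\<close>

lemma nonresonant_theta:
  assumes res: "\<And>j. j > 0 \<Longrightarrow> p ^ j \<noteq> a\<^sup>2"
  shows "theta (a\<^sup>2) p \<noteq> 0" "theta a p \<noteq> 0" "theta (- a) p \<noteq> 0" "theta (- 1) p \<noteq> 0"
proof -
  have no: "a\<^sup>2 \<noteq> p powi k" for k
  proof
    assume eq: "a\<^sup>2 = p powi k"
    show False
    proof (cases "k > 0")
      case True
      then show False
        using res[of "nat k"] eq by (simp add: power_int_def)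
    next
      case False
      then obtain n where n: "k = - int n"
        using that[of "nat (- k)"] by simp
      have "norm (p powi k) = inverse (norm p ^ n)"
        by (simp add: n power_int_minus norm_inverse norm_power)
      then have "norm (p powi k) \<ge> 1"
        using p0 p1 by (simp add: one_le_inverse power_le_one)
      then show False
        using b1 eq by (metis not_le)
    qed
  qed
  show "theta (a\<^sup>2) p \<noteq> 0"
    using no theta_eq_0_iff[OF p1 p0, of "a\<^sup>2"] a0 by simp
  have sq: "theta x p \<noteq> 0" if "x\<^sup>2 = a\<^sup>2" for x
  proof
    assume "theta x p = 0"
    moreover have "x \<noteq> 0"
      using that a0 by auto
    ultimately obtain k where "x = p powi k"
      using theta_eq_0_iff[OF p1 p0] by blast
    then have "a\<^sup>2 = p powi (k + k)"
      using that p0 by (metis power2_eq_square power_int_add)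
    then show False
      using no by blast
  qed
  show "theta a p \<noteq> 0" "theta (- a) p \<noteq> 0"
    by (rule sq; simp)+
  have "qpoch (- p) p \<noteq> 0"
    using p1 by (simp add: qpoch_nz)
  then show "theta (- 1) p \<noteq> 0"
    using qpoch_rec[OF p1, of "- 1"] by (simp add: theta_def)
qed

lemma F_proportional:
  assumes res: "\<And>j. j > 0 \<Longrightarrow> p ^ j \<noteq> a\<^sup>2" and \<Gamma>: "sep_cycle D \<Gamma>" and z: "z \<noteq> 0"
  shows "F \<Gamma> z * (theta (- 1) p * theta (- (1 / a)) p * theta (- a) p) =
         F \<Gamma> (- 1) * (theta z p * theta (z / a) p * theta (z * a) p)"
proof -
  have "F \<Gamma> 1 = - F \<Gamma> 1"
    using F_inverse[OF \<Gamma>, of 1] by simp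
  then have F1: "F \<Gamma> 1 = 0"
    by simp
  have "F \<Gamma> (1 / a) = 0"
    using F_inverse[OF \<Gamma> a0] F_a[OF \<Gamma>] by simp
  then obtain k where k: "\<And>z. z \<noteq> 0 \<Longrightarrow> F \<Gamma> z = k * (theta z p * theta (z / a) p * theta (z * a) p)"
    using theta_odd_space[OF p1 p0 a0 nonresonant_theta(2,1)[OF res] F_holomorphic[OF \<Gamma>] F1 F_a[OF \<Gamma>] _ F_p[OF \<Gamma>]]
    by blast
  show ?thesis
    using k[OF z] k[of "- 1"] by simp
qed

text \<open>Here \<open>tau_relation\<close> is used with the nodes \<open>1 / a\<close> and
  \<open>- 1\<close>. The first raises the parameter \<open>1 / a\<close> to \<open>q / a\<close>;
  for the second, \<open>theta_split\<close> identifies \<open>tau (- 1)\<close> with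
  \<open>Phi (- 1)\<close>.\<close>

lemma F_minus_one:
  assumes res: "\<And>j. j > 0 \<Longrightarrow> p ^ j \<noteq> a\<^sup>2" and \<Gamma>: "sep_cycle D \<Gamma>"
  shows "F \<Gamma> (- 1) * (a * theta (1 / a\<^sup>2) p * theta p P) =
    2 * (theta (- (p / a)) P)\<^sup>2 * theta (a\<^sup>2) P * cycle_integral \<Gamma> (beta (q / a) (p / a))"
proof -
  define X where "X = cycle_integral \<Gamma> (beta (q / a) (p / a))"
  have "theta (1 / a\<^sup>2) p \<noteq> 0"
    using theta_inverse[OF p1, of "a\<^sup>2"] nonresonant_theta(1)[OF res] a0 by simp
  then have n1: "theta (1 / a\<^sup>2) P \<noteq> 0" "theta (p / a\<^sup>2) P \<noteq> 0"
    using theta_split[OF p1 p0, of "1 / a\<^sup>2"] by auto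
  have n2: "theta (- a) P \<noteq> 0"
    using theta_split[OF p1 p0, of "- a"] nonresonant_theta(3)[OF res] by auto
  have "theta (- (1 / a)) p \<noteq> 0"
    using theta_inverse[OF p1, of "- a"] nonresonant_theta(3)[OF res] a0 by simp
  then have n3: "theta (- (1 / a)) P \<noteq> 0" "theta (- (p / a)) P \<noteq> 0"
    using theta_split[OF p1 p0, of "- (1 / a)"] by auto
  have n4: "theta p P \<noteq> 0"
    using p0 p1 mult_strict_left_mono[of "norm p" 1 "norm p"]
    by (intro theta_nz[OF P]) (auto simp: norm_mult power2_eq_square)
  have tau1: "tau (1 / a) (- 1) = theta p P * (theta (- (1 / a)) P)\<^sup>2"
    by (simp add: tau_def power2_eq_square)
  have tau2: "tau (- 1) (1 / a) = theta (- (p / a)) P * theta (- (1 / a)) P * theta (- a) P"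
    by (simp add: tau_def)
  have H1: "H (1 / a) (p / a) (- 1) = - 2 * (theta (- (1 / a)) P * theta (- (p / a)) P * theta (a\<^sup>2) P)"
    by (simp add: H_def)
  have H2: "H (1 / a) (p / a) (1 / a) = a * theta (1 / a\<^sup>2) P * theta (p / a\<^sup>2) P * theta (- a) P"
  proof -
    have "1 / a * (1 / a) = 1 / a\<^sup>2" "p / a * (1 / a) = p / a\<^sup>2" "a\<^sup>2 * (1 / a) = a" "1 / a / (1 / a) = 1"
      using a0 by (auto simp: power2_eq_square)
    then show ?thesis
      unfolding H_def using theta_1[OF P(1)] by simp
  qed
  have "1 / a * (p / a) * a\<^sup>2 = p"
    using a0 by (simp add: power2_eq_square)
  then have rel: "H (1 / a) (p / a) (- 1) / tau (1 / a) (- 1) * cycle_integral \<Gamma> (\<lambda>x. weight (1 / a) (p / a) x * tau (1 / a) x) +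
         H (1 / a) (p / a) (1 / a) / tau (- 1) (1 / a) * cycle_integral \<Gamma> (\<lambda>x. weight (1 / a) (p / a) x * tau (- 1) x) = 0"
    using n1 n2 n3 n4 a0 \<Gamma> unfolding tau1[symmetric]
    by (intro tau_relation) (auto simp: tau1 tau2 power_divide)
  have "cycle_integral \<Gamma> (\<lambda>x. weight (1 / a) (p / a) x * tau (1 / a) x) = X"
    unfolding X_def using weight_tau(1)[of _ "1 / a" "p / a"] nz_ts by (intro cycle_integral_cong[OF \<Gamma>]) simp
  moreover have "cycle_integral \<Gamma> (\<lambda>x. weight (1 / a) (p / a) x * tau (- 1) x) = F \<Gamma> (- 1)"
  proof -
    have "theta (- x) p = theta (- x) P * theta (- (p * x)) P" for x
      using theta_split[OF p1 p0, of "- x"] by simp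
    then show ?thesis
      unfolding F_def Phi_def tau_def by (simp add: mult_ac)
  qed
  ultimately have "- 2 * (theta (- (1 / a)) P * theta (- (p / a)) P * theta (a\<^sup>2) P) / (theta p P * (theta (- (1 / a)) P)\<^sup>2) * X +
      a * theta (1 / a\<^sup>2) P * theta (p / a\<^sup>2) P * theta (- a) P /
        (theta (- (p / a)) P * theta (- (1 / a)) P * theta (- a) P) * F \<Gamma> (- 1) = 0"
    using rel unfolding H1 H2 tau1 tau2 by (simp only:)
  moreover have "2 * Q\<^sup>2 * R * X' = Y * (a * (E1 * E2) * T)"
    if "- 2 * (O' * Q * R) / (T * O'\<^sup>2) * X' + a * E1 * E2 * N / (Q * O' * N) * Y = 0"
      "O' \<noteq> 0" "Q \<noteq> 0" "N \<noteq> 0" "T \<noteq> 0" for O' Q R T X' Y E1 E2 N :: complex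
    using that by (simp add: field_simps power2_eq_square)
  ultimately have "2 * (theta (- (p / a)) P)\<^sup>2 * theta (a\<^sup>2) P * X =
      F \<Gamma> (- 1) * (a * (theta (1 / a\<^sup>2) P * theta (p / a\<^sup>2) P) * theta p P)"
    using n2 n3 n4 by blast
  then show ?thesis
    using theta_split[OF p1 p0, of "1 / a\<^sup>2"] by (simp add: X_def)
qed

text \<open>Raising \<open>1 / a\<close> to \<open>q / a = a ^ 3\<close> brings the parameter into
  the unit disc and only removes poles. The cycle still separates and can be exchanged for the unit
  circle.\<close>

lemma beta_integral_circle:
  assumes pa: "norm p < norm (a\<^sup>2)" and \<Gamma>: "sep_cycle D \<Gamma>"
  shows "cycle_integral \<Gamma> (beta (q / a) (p / a)) * (N_fac (- (a\<^sup>2)) * N_fac (- p)) =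
    (qpoch (- q) q / qpoch q q)\<^sup>2 * (N_fac (q / a) * N_fac (p / a))"
proof -
  have "poles (1 / a) (p / a) u = 0" if "poles (q / a) (p / a) u = 0" for u
    using that qpoch2_nz_mult(1)[of "u / a"] by (auto simp: poles_def mult_ac)
  then have G: "sep_cycle (poles (q / a) (p / a)) \<Gamma>"
    using \<Gamma> sep_cycle_mono by blast
  have qa: "q / a = a ^ 3"
    using a0 by (simp add: power2_eq_square power3_eq_cube)
  have "norm (a\<^sup>2) \<le> norm a"
    using a1 by (simp add: norm_mult power2_eq_square mult_left_le)
  then have pa1: "norm p < norm a"
    using pa by simp
  have n: "norm (q / a) < 1" "norm (p / a) < 1"
    using a0 a1 pa1 unfolding qa by (auto simp: norm_divide norm_power power_less_one_iff)
  have "norm (a\<^sup>2) * norm p < norm (a\<^sup>2) * norm a"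
    using pa1 a0 by (intro mult_strict_left_mono) auto
  then have n3: "norm (a\<^sup>2 * p) < norm (q / a)"
    unfolding qa by (simp add: norm_mult norm_power power2_eq_square power3_eq_cube)
  have "q / a \<noteq> 0"
    using a0 by simp
  then have "cycle_integral \<Gamma> (beta (q / a) (p / a)) = cycle_integral (circlepath 0 1) (beta (q / a) (p / a))"
    using nz_ts by (intro cycle_integral_eq[OF poles_entire beta_holomorphic G] sep_cycle_circle n)
  moreover have "a\<^sup>2 * p / (q / a) = p / a"
    using a0 by (simp add: power2_eq_square)
  ultimately show ?thesis
    using circle_beta_proportional[OF pa n3 n(1)] circle_beta_special by (simp add: circle_beta_def)
qed

end

section \<open>Closed form of the constant\<close>

context beta_kernel
begin

lemma qpoch2_nz': "norm x < 1 \<Longrightarrow> qpoch2 x P q \<noteq> 0"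
  using P q by (intro qpoch2_nz)

lemma egamma_nz: "norm x < 1 \<Longrightarrow> norm (P * q / x) < 1 \<Longrightarrow> egamma x P q \<noteq> 0"
  unfolding egamma_def using qpoch2_nz' by simp

lemma egamma_inverse:
  assumes "x * y = P * q"
  shows "egamma y P q = inverse (egamma x P q)"
proof -
  have "x \<noteq> 0"
    using assms P q by auto
  moreover from this have "y = P * q / x"
    unfolding assms[symmetric] by simp
  ultimately show ?thesis
    using egamma_reflect[OF P(2) q(2)] by simp
qed

text \<open>At a square root of \<open>P * q\<close> numerator and denominator of
  \<open>egamma\<close> coincide; at a square root of \<open>P\<close> or \<open>q\<close> they
  differ by a single row of factors. The two remaining arguments, \<open>q\<close> and
  \<open>- P\<close>, are reduced by the product recursions.\<close>

lemma N_fac_special: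
  "N_fac (- b) * N_fac (- p) = qpoch P P * qpoch (- q) q /
     (qpoch q q * qpoch (- P) P * (qpoch b q * qpoch (- b) q) * (qpoch p P * qpoch (- p) P))"
proof -
  have less: "norm (x * y) < 1" if "norm x < 1" "norm y < 1" for x y :: complex
    using that mult_strict_mono'[of "norm x" 1 "norm y" 1] by (simp add: norm_mult)
  have eP: "egamma x P q = 1 / qpoch x P" if "x * x = P" "qpoch2 (x * q) P q \<noteq> 0" for x
  proof -
    have "x \<noteq> 0"
      using that(1) P(2) by auto
    then have "P * q / x = x * q"
      unfolding that(1)[symmetric] by simp
    then show ?thesis
      using that(2) qpoch2_rec'[OF P(1) q(1), of x] by (simp add: egamma_def)
  qed
  have eq: "egamma x P q = 1 / qpoch x q" if "x * x = q" "qpoch2 (x * P) P q \<noteq> 0" for x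
  proof -
    have "x \<noteq> 0"
      using that(1) q(2) by auto
    then have "P * q / x = x * P"
      unfolding that(1)[symmetric] by simp
    then show ?thesis
      using that(2) qpoch2_rec[OF P(1) q(1), of x] by (simp add: egamma_def)
  qed
  have eb: "egamma b P q = 1 / qpoch b q" "egamma (- b) P q = 1 / qpoch (- b) q"
    using eq[OF _ qpoch2_nz'[OF less[OF b1 P(1)]]] eq[OF _ qpoch2_nz'[OF less[of "- b", OF _ P(1)]]] b1
    by (simp_all add: power2_eq_square)
  have ep: "egamma p P q = 1 / qpoch p P" "egamma (- p) P q = 1 / qpoch (- p) P"
    using eP[OF _ qpoch2_nz'[OF less[OF p1 q(1)]]] eP[OF _ qpoch2_nz'[OF less[of "- p", OF _ q(1)]]] p1
    by (simp_all add: power2_eq_square)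
  have one: "egamma (b * p) P q = 1" "egamma (- (p * b)) P q = 1"
  proof -
    have "P * q / (b * p) = b * p" "P * q / (- (p * b)) = - (p * b)"
      using b0 p0 by (auto simp: power2_eq_square)
    moreover have "qpoch2 (b * p) P q \<noteq> 0" "qpoch2 (- (p * b)) P q \<noteq> 0"
      using less[OF b1 p1] less[OF p1 b1] by (auto intro!: qpoch2_nz')
    ultimately show "egamma (b * p) P q = 1" "egamma (- (p * b)) P q = 1"
      by (simp_all add: egamma_def)
  qed
  have Pq: "qpoch2 (P * q) P q \<noteq> 0" "qpoch2 (- (P * q)) P q \<noteq> 0"
    using less[OF P(1) q(1)] by (auto intro!: qpoch2_nz')
  have "qpoch2 P P q = qpoch P P * qpoch2 (P * q) P q" "qpoch2 q P q = qpoch q q * qpoch2 (P * q) P q"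
    using qpoch2_rec'[OF P(1) q(1), of P] qpoch2_rec[OF P(1) q(1), of q] by (simp_all add: mult.commute)
  then have eq1: "egamma q P q = qpoch P P / qpoch q q"
    using Pq(1) q by (simp add: egamma_def)
  have "qpoch2 (- P) P q = qpoch (- P) P * qpoch2 (- (P * q)) P q" "qpoch2 (- q) P q = qpoch (- q) q * qpoch2 (- (P * q)) P q"
    using qpoch2_rec'[OF P(1) q(1), of "- P"] qpoch2_rec[OF P(1) q(1), of "- q"] by (simp_all add: mult.commute)
  then have eP1: "egamma (- P) P q = qpoch (- q) q / qpoch (- P) P"
    using Pq(2) P by (simp add: egamma_def)
  have "N_fac (- b) = egamma (- b) P q * egamma b P q * egamma (- (p * b)) P q * egamma q P q"
    unfolding N_fac_def by (simp add: power2_eq_square)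
  moreover have "N_fac (- p) = egamma (- p) P q * egamma p P q * egamma (- P) P q * egamma (b * p) P q"
    unfolding N_fac_def by (simp add: power2_eq_square)
  ultimately show ?thesis
    by (simp add: eb ep one eq1 eP1)
qed

end

text \<open>Euler's identity behind the equality of the numbers of partitions into distinct and into
  odd parts.\<close>

lemma qpoch_euler:
  assumes "norm x < 1"
  shows "qpoch (- x) x * qpoch x (x\<^sup>2) = 1"
proof -
  have "qpoch (x\<^sup>2) (x\<^sup>2) = qpoch x x * qpoch (- x) x"
    by (rule qpoch_square[OF assms])
  also have "qpoch x x = qpoch x (x\<^sup>2) * qpoch (x\<^sup>2) (x\<^sup>2)"
    using qpoch_even_odd[OF assms, of x] by (simp add: power2_eq_square)
  finally have "qpoch (x\<^sup>2) (x\<^sup>2) * (qpoch (- x) x * qpoch x (x\<^sup>2)) = qpoch (x\<^sup>2) (x\<^sup>2) * 1"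
    by (simp add: mult_ac)
  moreover have "qpoch (x\<^sup>2) (x\<^sup>2) \<noteq> 0"
    using assms by (intro qpoch_nz) (auto simp: norm_power power_less_one_iff)
  ultimately show ?thesis
    by (metis mult_cancel_left)
qed

text \<open>The expected value of \<open>F \<Gamma> (- 1)\<close>: the coefficient in
  \<open>F_value\<close> times the theta product at \<open>z = - 1\<close>. It stands outside the
  locale because \<open>p\<close> will vary.\<close>

definition F_constant :: "complex \<Rightarrow> complex \<Rightarrow> complex" where
  "F_constant a p = egamma (a ^ 3) p (a ^ 4) / (egamma a p (a ^ 4) * theta (1 / a\<^sup>2) p * qpoch (p\<^sup>2) (p\<^sup>2) *
     qpoch (a\<^sup>2) (a\<^sup>2) * qpoch (- a) a) * (theta (- 1) p * theta (- (1 / a)) p * theta (- a) p)"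

context target_kernel
begin

text \<open>Since \<open>(p * a ^ 3) * (p * a) = P * q\<close>, the gamma values at these arguments
  are reciprocal, also after both change sign. Up to theta factors the eight values reduce to six,
  and \<open>egamma_split\<close> reassembles the nome \<open>p\<close>.\<close>

lemma N_fac_product:
  assumes pa: "norm p < norm (a\<^sup>2)"
  shows "N_fac (q / a) * N_fac (p / a) = egamma (a ^ 3) p q / egamma a p q *
    (theta (- a) P / (theta (p / a) P * theta (- (p / a)) P * theta a P * qpoch (- a) (a\<^sup>2)))"
proof -
  have less: "norm (x * y) < norm y" if "norm x < 1" "y \<noteq> 0" for x y :: complex
    using that mult_strict_right_mono[of "norm x" 1 "norm y"] by (simp add: norm_mult)
  have aa: "norm (a\<^sup>2) < norm a"
    using less[OF a1 a0] by (simp add: power2_eq_square)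
  have pa1: "norm (p / a) < 1" "norm (- (p / a)) < 1"
    using pa aa a0 by (auto simp: norm_divide divide_less_eq)
  have pp: "norm P < norm (p / a)"
  proof -
    have "norm P < norm p" "norm p < norm (p / a)"
      using less[OF p1 p0] p0 a0 a1 by (auto simp: power2_eq_square norm_divide less_divide_eq)
    then show ?thesis by simp
  qed
  have Pa: "norm P < norm a"
    using less[OF p1 p0] pa aa by (simp add: power2_eq_square)
  have less1: "norm (x * y) < 1" if "norm x < 1" "norm y < 1" for x y :: complex
    using that mult_strict_mono'[of "norm x" 1 "norm y" 1] by (simp add: norm_mult)
  have a3: "norm (a ^ 3) < 1" "norm (P * a ^ 3) < 1" "norm (p * a ^ 3) < 1" "norm (p * a) < 1" "norm (P * a) < 1"
    using less1[OF P(1), of "a ^ 3"] less1[OF p1, of "a ^ 3"] less1[OF p1 a1] less1[OF P(1) a1] a1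
    by (auto simp: norm_power power_less_one_iff)
  have qa: "q / a = a ^ 3" "p * (q / a) = p * a ^ 3" "a\<^sup>2 * a ^ 3 = q * a" "a\<^sup>2 * (p / a) = p * a"
    "p * (p / a) = P / a" "q * (p / a) = p * a ^ 3" "P * q / (p * a ^ 3) = p * a" "P * q / (q * a) = P / a"
    "P * q / (p * a) = p * a ^ 3" "P * q / a = P * a ^ 3" "P * q / a ^ 3 = P * a"
    using a0 p0 by (auto simp: power2_eq_square power3_eq_cube)
  note nz = qpoch2_nz'
  define x1 y1 x3 y3 u v where "x1 = egamma a P q" and "y1 = egamma (- a) P q" and "x3 = egamma (a ^ 3) P q"
    and "y3 = egamma (- (a ^ 3)) P q" and "u = egamma (p * a ^ 3) P q" and "v = egamma (- (p * a ^ 3)) P q"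
  have uA: "u = theta (p / a) P * egamma (p / a) P q"
    unfolding u_def qa(6)[symmetric] using nz_ts(2) by (intro egamma_q nz pa1)
  have "egamma (q * - (p / a)) P q = theta (- (p / a)) P * egamma (- (p / a)) P q"
    using p0 a0 by (intro egamma_q nz pa1) auto
  moreover have "q * - (p / a) = - (p * a ^ 3)"
    using qa(6) by simp
  ultimately have vB: "v = theta (- (p / a)) P * egamma (- (p / a)) P q"
    by (simp only: v_def)
  have pa_v: "egamma (- (p * a)) P q = inverse v"
    unfolding v_def by (rule egamma_inverse) (simp add: power2_eq_square power3_eq_cube)
  have pa_u: "egamma (p * a) P q = inverse u"
    unfolding u_def by (rule egamma_inverse) (simp add: power2_eq_square power3_eq_cube)
  have qa1: "egamma (q * a) P q = theta a P * x1"
    unfolding x1_def using a0 a1 by (intro egamma_q nz)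
  have Pa_x: "egamma (P / a) P q = inverse (theta a P * x1)"
    unfolding qa1[symmetric] using a0 by (intro egamma_inverse) simp
  have "egamma (q * - a) P q = theta (- a) P * y1"
    unfolding y1_def using a0 a1 by (intro egamma_q nz) auto
  then have qa2: "egamma (- (q * a)) P q = theta (- a) P * y1"
    by simp
  have R: "y1 * y3 = 1 / qpoch (- a) (a\<^sup>2)"
  proof -
    have e: "P * q / - a = - (P * a ^ 3)" "P * q / - (a ^ 3) = - (P * a)"
      using qa(10,11) by simp_all
    have r: "qpoch2 (- a) P q = qpoch (- a) q * qpoch2 (- (P * a)) P q"
      "qpoch2 (- (a ^ 3)) P q = qpoch (- (a ^ 3)) q * qpoch2 (- (P * a ^ 3)) P q"
      using qpoch2_rec[OF P(1) q(1), of "- a"] qpoch2_rec[OF P(1) q(1), of "- (a ^ 3)"] by (simp_all add: mult.commute)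
    have "qpoch (- a) (a\<^sup>2) = qpoch (- a) q * qpoch (- (a ^ 3)) q"
      using qpoch_even_odd[OF b1, of "- a"] by (simp add: power2_eq_square power3_eq_cube mult.assoc)
    moreover have "qpoch2 (- (P * a)) P q \<noteq> 0" "qpoch2 (- (P * a ^ 3)) P q \<noteq> 0"
      using a3 by (simp_all only: norm_minus_cancel nz not_False_eq_True)
    ultimately show ?thesis
      unfolding y1_def y3_def egamma_def e r by simp
  qed
  have nz0: "u \<noteq> 0" "v \<noteq> 0" "x1 \<noteq> 0"
  proof -
    have "P * q / - (p * a ^ 3) = - (p * a)"
      using qa(7) by simp
    then show "u \<noteq> 0" "v \<noteq> 0" "x1 \<noteq> 0"
      unfolding u_def v_def x1_def by (intro egamma_nz; simp only: norm_minus_cancel qa(7,10) a3 a1)+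
  qed
  have th: "theta (p / a) P \<noteq> 0" "theta (- (p / a)) P \<noteq> 0" "theta a P \<noteq> 0"
    by (rule theta_nz[OF P]; simp only: norm_minus_cancel pp pa1 Pa a1)+
  have d: "egamma (p / a) P q = u / theta (p / a) P" "egamma (- (p / a)) P q = v / theta (- (p / a)) P"
    unfolding uA vB using th by (metis nonzero_mult_div_cancel_left)+
  have "egamma (a ^ 3) p q = x3 * u"
    unfolding x3_def u_def by (rule egamma_split[OF p1 p0 q(1)]) (use a0 in simp)
  moreover have "egamma a p q = x1 * inverse u"
    unfolding x1_def pa_u[symmetric] by (rule egamma_split[OF p1 p0 q(1) a0])
  ultimately have "egamma (a ^ 3) p q / egamma a p q = x3 * u / (x1 * inverse u)"
    by (simp only:)
  moreover have "N_fac (q / a) * N_fac (p / a) = x3 * y3 * u * (theta (- a) P * y1) *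
     ((u / theta (p / a) P) * (v / theta (- (p / a)) P) * inverse (theta a P * x1) * inverse v)"
    by (simp only: N_fac_def qa(1,2,3,4,5) pa_v Pa_x qa2 d x3_def y3_def u_def)
  moreover have "x3 * y3 * u * (E * y1) * ((u / A) * (v / B) * inverse (C * x1) * inverse v) =
     x3 * u / (x1 * inverse u) * (E / (A * B * C)) * (y1 * y3)" for A B C E :: complex
    using nz0 by (simp add: field_simps)
  ultimately show ?thesis
    by (simp add: R)
qed

lemma F_minus_one_value:
  assumes pa: "norm p < norm (a\<^sup>2)" and \<Gamma>: "sep_cycle D \<Gamma>"
  shows "F \<Gamma> (- 1) = F_constant a p"
proof -
  have res: "p ^ j \<noteq> a\<^sup>2" if "j > 0" for j
  proof -
    have "norm p ^ j \<le> norm p ^ 1"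
      using that p1 by (intro power_decreasing) auto
    then show ?thesis
      using pa by (metis norm_power not_le power_one_right)
  qed
  define X where "X = cycle_integral \<Gamma> (beta (q / a) (p / a))"
  define RR where "RR = egamma (a ^ 3) p q / egamma a p q"
  define A B C D' E' F' G S R where "A = qpoch (- q) q" and "B = qpoch q q" and "C = qpoch (- P) P"
    and "D' = qpoch (a\<^sup>2) q" and "E' = qpoch (- (a\<^sup>2)) q" and "F' = qpoch p P" and "G = qpoch (- p) P"
    and "S = qpoch P P" and "R = qpoch (- a) (a\<^sup>2)"
  have nz: "A \<noteq> 0" "B \<noteq> 0" "C \<noteq> 0" "D' \<noteq> 0" "E' \<noteq> 0" "F' \<noteq> 0" "G \<noteq> 0" "S \<noteq> 0" "R \<noteq> 0"
    unfolding A_def B_def C_def D'_def E'_def F'_def G_def S_def R_def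
    by (rule qpoch_nz; simp only: norm_minus_cancel P q p1 b1 a1)+
  have E1: "G * C * F' = 1"
    using qpoch_euler[OF p1] qpoch_even_odd[OF p1, of "- p"] by (simp add: G_def C_def F'_def power2_eq_square)
  have E2: "E' * A * D' = 1"
    using qpoch_euler[OF b1] qpoch_even_odd[OF b1, of "- (a\<^sup>2)"] by (simp add: E'_def A_def D'_def power2_eq_square)
  have b_b: "qpoch (a\<^sup>2) (a\<^sup>2) = D' * B"
    using qpoch_even_odd[OF b1, of "a\<^sup>2"] by (simp add: D'_def B_def power2_eq_square)
  have ma: "qpoch (- a) a = R * (E' * A)"
    using qpoch_even_odd[OF a1, of "- a"] qpoch_even_odd[OF b1, of "- (a\<^sup>2)"]
    by (simp add: R_def E'_def A_def power2_eq_square)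
  have mp: "qpoch (- p) p = G * C"
    using qpoch_even_odd[OF p1, of "- p"] by (simp add: G_def C_def power2_eq_square)
  have th1: "theta (- 1) p = 2 * (G * C) * (G * C)"
    using qpoch_rec[OF p1, of "- 1"] by (simp add: theta_def mp)
  define t1 t2 t3 t4 where "t1 = theta a P" and "t2 = theta (- a) P" and "t3 = theta (p / a) P" and "t4 = theta (- (p / a)) P"
  have refl: "theta (p * a) P = t3" "theta (- (p * a)) P = t4"
    using theta_reflect[OF P(2), of "p / a"] theta_reflect[OF P(2), of "- (p / a)"] p0 a0
    by (auto simp: t3_def t4_def power2_eq_square)
  have th_a2: "theta (a\<^sup>2) P = t1 * t3 * (t2 * t4)"
    using theta_square_split[of a] refl by (simp add: t1_def t2_def)
  have th_ma: "theta (- a) p = t2 * t4"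
    using theta_split[OF p1 p0, of "- a"] refl by (simp add: t2_def)
  have th_ia: "theta (- (1 / a)) p = t2 * t4 / a"
    using theta_inverse[OF p1, of "- a"] th_ma a0 by simp
  have th_p: "theta p P = F' * F'"
    using p0 by (simp add: theta_def F'_def power2_eq_square)
  have tnz: "t1 \<noteq> 0" "t2 \<noteq> 0" "t3 \<noteq> 0" "t4 \<noteq> 0"
  proof -
    have "theta (- a) p \<noteq> 0" "theta a p \<noteq> 0"
      using nonresonant_theta[OF res] by auto
    then show "t1 \<noteq> 0" "t2 \<noteq> 0" "t3 \<noteq> 0" "t4 \<noteq> 0"
      using th_ma theta_split[OF p1 p0, of a] refl by (auto simp: t1_def)
  qed
  have T: "theta (1 / a\<^sup>2) p \<noteq> 0"
    using theta_inverse[OF p1, of "a\<^sup>2"] nonresonant_theta(1)[OF res] a0 by simp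
  define T where "T = theta (1 / a\<^sup>2) p"
  have 1: "F \<Gamma> (- 1) * (a * T * (F' * F')) = 2 * t4\<^sup>2 * (t1 * t3 * (t2 * t4)) * X"
    using F_minus_one[OF res \<Gamma>] unfolding th_p th_a2 T_def t4_def X_def by simp
  have 2: "X * (S * A / (B * C * (D' * E') * (F' * G))) = (A / B)\<^sup>2 * (RR * (t2 / (t3 * t4 * t1 * R)))"
    using beta_integral_circle[OF pa \<Gamma>] unfolding N_fac_special N_fac_product[OF pa]
    by (simp only: X_def A_def B_def C_def D'_def E'_def F'_def G_def S_def R_def RR_def t1_def t2_def t3_def t4_def)
  have X: "X = A / B * (RR * (t2 / (t3 * t4 * t1 * R))) * (C * (D' * E') * (F' * G)) / S"
  proof -
    have "X = X * (S * A / (B * C * (D' * E') * (F' * G))) * (B * C * (D' * E') * (F' * G) / (S * A))"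
      using nz by simp
    also have "\<dots> = A / B * (RR * (t2 / (t3 * t4 * t1 * R))) * (C * (D' * E') * (F' * G)) / S"
      unfolding 2 using nz by (simp add: power2_eq_square mult_ac)
    finally show ?thesis .
  qed
  have "F \<Gamma> (- 1) = 2 * t4\<^sup>2 * (t1 * t3 * (t2 * t4)) * X / (a * T * (F' * F'))"
    using 1 a0 nz T unfolding T_def[symmetric] by (simp add: field_simps)
  also have "\<dots> = 2 * RR * (t2 * t4) * (t2 * t4) / a * (E' * A * D') * (G * C * F') / (T * S * B * R * F' * F')"
    unfolding X using nz tnz by (simp add: field_simps power2_eq_square)
  also have "\<dots> = 2 * RR * (t2 * t4) * (t2 * t4) / a / (T * S * B * R * F' * F')"
    by (simp add: E1 E2)
  \<comment> \<open>Euler's identities enter a second time, now to insert the factors that complete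
    \<open>theta (- 1) p\<close>, \<open>qpoch (a\<^sup>2) (a\<^sup>2)\<close> and
    \<open>qpoch (- a) a\<close>.\<close>
  also have "\<dots> = 2 * RR * (t2 * t4) * (t2 * t4) / a * ((G * C * F') * (G * C * F')) / (T * S * B * R * F' * F' * (E' * A * D'))"
    by (simp add: E1 E2)
  also have "\<dots> = RR / (T * S * (D' * B) * (R * (E' * A))) * (2 * (G * C) * (G * C) * (t2 * t4 / a) * (t2 * t4))"
    using nz by (simp add: field_simps)
  also have "\<dots> = F_constant a p"
    unfolding F_constant_def th1 th_ia th_ma b_b ma RR_def T_def S_def by (simp add: mult_ac power2_eq_square power_numeral_reduce)
  finally show ?thesis .
qed

end

section \<open>Analytic continuation in \<open>p\<close>\<close>

definition nonresonant :: "complex \<Rightarrow> complex set" where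
  "nonresonant a = {p. p \<noteq> 0 \<and> norm p < 1 \<and> (\<forall>j>0. p ^ j \<noteq> a\<^sup>2)}"

text \<open>Infinitely many conditions need not define an open set; the single product
  \<open>qpoch (p / a\<^sup>2) p\<close> encodes them all. Connectedness holds because only
  countably many points of the disc are missing.\<close>

lemma nonresonant_open_connected:
  assumes a: "a \<noteq> 0"
  shows "open (nonresonant a)" "connected (nonresonant a)"
proof -
  have eq: "(\<forall>j>0. p ^ j \<noteq> a\<^sup>2) \<longleftrightarrow> qpoch (p / a\<^sup>2) p \<noteq> 0" if "norm p < 1" for p
  proof -
    have "qpoch (p / a\<^sup>2) p = 0 \<longleftrightarrow> (\<exists>n. p ^ Suc n = a\<^sup>2)"
      using a that by (simp add: qpoch_eq_0_iff field_simps)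
    also have "\<dots> \<longleftrightarrow> (\<exists>j>0. p ^ j = a\<^sup>2)"
      by (metis Suc_pred zero_less_Suc)
    finally show ?thesis by blast
  qed
  have "open {p \<in> ball 0 1 - {0}. qpoch (p / a\<^sup>2) p \<noteq> 0}"
    using a by (intro open_nonzeros continuous_on_qpoch continuous_intros) auto
  moreover have "{p \<in> ball 0 1 - {0}. qpoch (p / a\<^sup>2) p \<noteq> 0} = nonresonant a"
    using eq by (auto simp: nonresonant_def)
  ultimately show "open (nonresonant a)" by simp
  have "countable (insert 0 (\<Union>j\<in>{0<..}. {p. p ^ j = a\<^sup>2}))"
    by (intro countable_insert countable_UN) (auto intro!: countable_finite)
  then have "connected (ball 0 1 - insert 0 (\<Union>j\<in>{0<..}. {p. p ^ j = a\<^sup>2}))"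
    by (intro connected_open_diff_countable) auto
  moreover have "ball 0 1 - insert 0 (\<Union>j\<in>{0<..}. {p. p ^ j = a\<^sup>2}) = nonresonant a"
    by (auto simp: nonresonant_def)
  ultimately show "connected (nonresonant a)" by simp
qed

text \<open>The function \<open>D\<close> and the integrand of \<open>F (-1)\<close>, written outside the locale so that \<open>p\<close> can vary.\<close>

definition residue_poles :: "complex \<Rightarrow> complex \<Rightarrow> complex \<Rightarrow> complex" where
  "residue_poles a p u = qpoch2 (u / a) p (a ^ 4)"

definition kernel_at :: "complex \<Rightarrow> complex \<Rightarrow> complex \<Rightarrow> complex" where
  "kernel_at a p x = egamma (x / a) p (a ^ 4) * egamma (1 / (x * a)) p (a ^ 4) * theta (a\<^sup>2 * x) (a ^ 4) *
     (theta (- x) p * theta (- (1 / x)) (p\<^sup>2))"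

text \<open>A clash would give \<open>p ^ m * q ^ n = a^2\<close> with \<open>q = a ^ 4\<close>. For
  \<open>n > 0\<close> the left side has norm at most \<open>norm q\<close>, the square of
  \<open>norm (a^2)\<close> and hence too small; \<open>n = 0\<close> is excluded by nonresonance,
  or by \<open>norm a < 1\<close> if also \<open>m = 0\<close>.\<close>

lemma residue_poles_no_clash:
  assumes a: "a \<noteq> 0" "norm a < 1" and p: "p \<in> nonresonant a" and y: "y \<noteq> 0" "residue_poles a p y = 0"
  shows "residue_poles a p (1 / y) \<noteq> 0"
proof
  assume y': "residue_poles a p (1 / y) = 0"
  have p1: "norm p < 1" and res: "\<And>j. j > 0 \<Longrightarrow> p ^ j \<noteq> a\<^sup>2"
    using p by (auto simp: nonresonant_def)
  have q1: "norm (a ^ 4) < 1"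
    using a by (simp add: norm_power power_less_one_iff)
  obtain j k where jk: "y / a * p ^ j * (a ^ 4) ^ k = 1"
    using y(2) qpoch2_eq_0_iff[OF p1 q1] by (auto simp: residue_poles_def)
  obtain j' k' where jk': "1 / y / a * p ^ j' * (a ^ 4) ^ k' = 1"
    using y' qpoch2_eq_0_iff[OF p1 q1] by (auto simp: residue_poles_def)
  have "(y / a * p ^ j * (a ^ 4) ^ k) * (1 / y / a * p ^ j' * (a ^ 4) ^ k') = 1"
    by (simp only: jk jk' mult_1)
  then have eq: "p ^ (j + j') * (a ^ 4) ^ (k + k') = a\<^sup>2"
    using y(1) a(1) by (simp add: power_add field_simps power2_eq_square)
  show False
  proof (cases "k + k' = 0")
    case True
    then have "p ^ (j + j') = a\<^sup>2"
      using eq by simp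
    moreover have "a\<^sup>2 \<noteq> 1"
      using a by (metis norm_one norm_power power_less_one_iff norm_ge_zero less_irrefl pos2)
    ultimately show False
      using res[of "j + j'"] by (cases "j + j' = 0") auto
  next
    case False
    have "norm (a\<^sup>2) = norm p ^ (j + j') * norm (a ^ 4) ^ (k + k')"
      unfolding eq[symmetric] by (simp add: norm_mult norm_power)
    also have "\<dots> \<le> 1 * norm (a ^ 4) ^ 1"
      using p1 q1 False by (intro mult_mono power_le_one power_decreasing) auto
    also have "\<dots> = norm (a\<^sup>2) * norm (a\<^sup>2)"
      by (simp add: norm_power flip: power_add)
    also have "\<dots> < norm (a\<^sup>2) * 1"
      using a by (intro mult_strict_left_mono) (auto simp: norm_power power_less_one_iff)
    finally show False by simp
  qed
qed

lemma F_constant_holomorphic: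
  assumes a: "a \<noteq> 0" "norm a < 1"
  shows "F_constant a holomorphic_on nonresonant a"
proof -
  have q1: "norm (a ^ 4) < 1"
    using a by (simp add: norm_power power_less_one_iff)
  let ?N = "nonresonant a"
  have a3: "norm (a ^ 3) < 1"
    using a by (simp add: norm_power power_less_one_iff)
  have small: "norm (p * a ^ k) < 1" if "p \<in> ?N" for p k
  proof -
    have "norm (p * a ^ k) \<le> norm p * 1"
      unfolding norm_mult norm_power using a by (intro mult_left_mono power_le_one) auto
    also have "\<dots> < 1"
      using that by (simp add: nonresonant_def)
    finally show "norm (p * a ^ k) < 1" .
  qed
  have arg: "p * a ^ 4 / a ^ 3 = p * a ^ 1" "p * a ^ 4 / a = p * a ^ 3" for p
    using a by (simp_all add: power_numeral_reduce)
  \<comment> \<open>The quotient of gamma functions is rewritten with denominators that have no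
    zeros on \<open>?N\<close>; the factors of \<open>egamma a\<close> change places.\<close>
  have eq: "F_constant a p = qpoch2 (p * a ^ 1) p (a ^ 4) * qpoch2 (a ^ 1) p (a ^ 4) /
      (qpoch2 (a ^ 3) p (a ^ 4) * qpoch2 (p * a ^ 3) p (a ^ 4)) /
      (theta (1 / a\<^sup>2) p * qpoch (p\<^sup>2) (p\<^sup>2) * qpoch (a\<^sup>2) (a\<^sup>2) * qpoch (- a) a) *
      (theta (- 1) p * theta (- (1 / a)) p * theta (- a) p)" for p
    by (simp add: F_constant_def egamma_def arg)
  have nz: "qpoch2 (a ^ 3) p (a ^ 4) \<noteq> 0" "qpoch2 (p * a ^ 3) p (a ^ 4) \<noteq> 0"
      "theta (1 / a\<^sup>2) p \<noteq> 0" "qpoch (p\<^sup>2) (p\<^sup>2) \<noteq> 0" if p: "p \<in> ?N" for p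
  proof -
    have p1: "norm p < 1" and p0: "p \<noteq> 0"
      using p by (auto simp: nonresonant_def)
    then show "qpoch2 (a ^ 3) p (a ^ 4) \<noteq> 0" "qpoch2 (p * a ^ 3) p (a ^ 4) \<noteq> 0"
      using small[OF p, of 3] a3 q1 by (simp_all add: qpoch2_nz)
    show "qpoch (p\<^sup>2) (p\<^sup>2) \<noteq> 0"
      using p1 by (intro qpoch_nz) (auto simp: norm_power power_less_one_iff)
    interpret target_kernel p a
      using p0 p1 a by unfold_locales
    have "theta (a\<^sup>2) p \<noteq> 0"
      by (rule nonresonant_theta) (use p in \<open>auto simp: nonresonant_def\<close>)
    then show "theta (1 / a\<^sup>2) p \<noteq> 0"
      using theta_inverse[OF p1, of "a\<^sup>2"] a by simp
  qed
  have "qpoch (a\<^sup>2) (a\<^sup>2) \<noteq> 0" "qpoch (- a) a \<noteq> 0"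
    using a by (simp_all add: qpoch_nz norm_power power_less_one_iff)
  then show ?thesis
    unfolding eq using nz a q1 nonresonant_open_connected[OF a(1)]
    by (intro holomorphic_intros holomorphic_on_qpoch2 holomorphic_on_qpoch holomorphic_on_theta)
      (auto simp: nonresonant_def norm_power power_less_one_iff)
qed

text \<open>The value is known for \<open>norm p < norm (a^2)\<close> and spreads over the connected
  set \<open>nonresonant a\<close> by the identity theorem. A cycle \<open>G p\<close> is picked for
  each \<open>p\<close> separately; holomorphy of the integral survives this arbitrary
  choice.\<close>

lemma kernel_at_integral:
  assumes a: "a \<noteq> 0" "norm a < 1" and p: "p \<in> nonresonant a" and \<Gamma>: "sep_cycle (residue_poles a p) \<Gamma>"
  shows "cycle_integral \<Gamma> (kernel_at a p) = F_constant a p"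
proof -
  have q1: "norm (a ^ 4) < 1"
    using a by (simp add: norm_power power_less_one_iff)
  let ?N = "nonresonant a"
  have N: "open ?N" "connected ?N"
    using nonresonant_open_connected[OF a(1)] by auto
  have pN: "p \<noteq> 0" "norm p < 1" "norm (p\<^sup>2) < 1" if "p \<in> ?N" for p
    using that by (auto simp: nonresonant_def norm_power power_less_one_iff)
  have entire: "residue_poles a p holomorphic_on UNIV" "residue_poles a p 0 \<noteq> 0" if "p \<in> ?N" for p
    unfolding residue_poles_def using pN[OF that] q1 a
    by (auto intro!: holomorphic_intros holomorphic_on_qpoch2)
  have "\<exists>G. sep_cycle (residue_poles a p) G" if "p \<in> ?N" for p
    using sep_cycle_exists[OF entire[OF that]] residue_poles_no_clash[OF a that] by blast
  then obtain G where G: "\<And>p. p \<in> ?N \<Longrightarrow> sep_cycle (residue_poles a p) (G p)"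
    by metis
  have nz: "x \<noteq> 0" "qpoch2 (x / a) p (a ^ 4) \<noteq> 0" "qpoch2 (1 / (x * a)) p (a ^ 4) \<noteq> 0"
    if "x \<in> zero_free (residue_poles a p) (residue_poles a p)" for x p
    using that by (auto simp: zero_free_def residue_poles_def)
  have hol_x: "kernel_at a p holomorphic_on zero_free (residue_poles a p) (residue_poles a p)" if "p \<in> ?N" for p
    unfolding kernel_at_def egamma_def
    using nz[of _ p] pN[OF that] q1 a zero_free_open_connected(1)[OF entire[OF that] entire[OF that]]
    by (intro holomorphic_intros holomorphic_on_qpoch2 holomorphic_on_theta) auto
  have "(\<lambda>p. cycle_integral (G p) (kernel_at a p)) holomorphic_on ?N"
  proof (rule cycle_integral_param_holomorphic[OF N(1) _ entire G hol_x])
    show "continuous_on (?N \<times> UNIV) (\<lambda>(p, x). residue_poles a p x)"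
      unfolding residue_poles_def case_prod_unfold using pN q1 a
      by (intro continuous_intros continuous_on_qpoch2) auto
    show "continuous_on {(p, x). p \<in> ?N \<and> x \<in> zero_free (residue_poles a p) (residue_poles a p)}
      (\<lambda>(p, x). kernel_at a p x)"
    proof -
      let ?S = "{(p, x). p \<in> ?N \<and> x \<in> zero_free (residue_poles a p) (residue_poles a p)}"
      have "norm (fst z) < 1 \<and> norm ((fst z)\<^sup>2) < 1 \<and> snd z \<noteq> 0 \<and> qpoch2 (snd z / a) (fst z) (a ^ 4) \<noteq> 0 \<and>
          qpoch2 (1 / (snd z * a)) (fst z) (a ^ 4) \<noteq> 0" if "z \<in> ?S" for z
        using that pN[of "fst z"] nz[of "snd z" "fst z"] by (auto simp: case_prod_unfold)
      then show ?thesis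
        unfolding kernel_at_def egamma_def case_prod_unfold using q1 a
        by (intro continuous_intros continuous_on_qpoch2 continuous_on_theta) simp_all
    qed
    show "(\<lambda>p. kernel_at a p x) holomorphic_on V" if "open V" "V \<subseteq> ?N"
      "\<And>p. p \<in> V \<Longrightarrow> x \<in> zero_free (residue_poles a p) (residue_poles a p)" for x V
    proof (cases "V = {}")
      case False
      then have "x \<noteq> 0"
        using nz(1) that(3) by blast
      moreover have Vp: "norm p < 1" "norm (p\<^sup>2) < 1" if "p \<in> V" for p
        using pN[of p] that \<open>V \<subseteq> ?N\<close> by blast+
      ultimately show ?thesis
        unfolding kernel_at_def egamma_def using that(1) Vp nz(2,3)[OF that(3)] q1 a
        by (intro holomorphic_intros holomorphic_on_qpoch2 holomorphic_on_theta) simp_all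
    next
      case True
      then show ?thesis
        by (simp add: holomorphic_on_def)
    qed
  qed
  then have hol: "(\<lambda>p. cycle_integral (G p) (kernel_at a p) - F_constant a p) holomorphic_on ?N"
    by (intro holomorphic_intros F_constant_holomorphic a)
  define S where "S = {p :: complex. 0 < norm p \<and> norm p < norm (a\<^sup>2)}"
  have a2: "norm (a\<^sup>2) < 1"
    using a by (simp add: norm_power power_less_one_iff)
  have S: "open S" "S \<subseteq> ?N"
  proof -
    show "open S"
      unfolding S_def by (rule beta_kernel.annulus_open_connected[of "1 / 2" "1 / 2"]) (auto simp: beta_kernel_def)
    show "S \<subseteq> ?N"
    proof
      fix p assume p: "p \<in> S"
      have "p ^ j \<noteq> a\<^sup>2" if "j > 0" for j
      proof -
        have "norm p ^ j \<le> norm p ^ 1"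
          using that p a2 by (intro power_decreasing) (auto simp: S_def)
        then show ?thesis
          using p by (metis (no_types, lifting) S_def mem_Collect_eq norm_power not_le power_one_right)
      qed
      then show "p \<in> ?N"
        using p a2 by (auto simp: nonresonant_def S_def)
    qed
  qed
  define p0 where "p0 = a\<^sup>2 / 2"
  have p0: "p0 \<in> S"
    using a by (simp add: p0_def S_def norm_divide norm_power)
  have zero: "cycle_integral (G p) (kernel_at a p) - F_constant a p = 0" if p: "p \<in> S" for p
  proof -
    have pn: "p \<in> ?N"
      using p S by blast
    interpret target_kernel p a
      using pN[OF pn] a by unfold_locales
    have sq: "(a\<^sup>2)\<^sup>2 = a ^ 4"
      by simp
    have poles: "poles (1 / a) (p / a) = residue_poles a p"
      unfolding poles_target residue_poles_def fun_eq_iff sq by simp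
    have \<Gamma>: "sep_cycle D (G p)"
      unfolding poles by (rule G[OF pn])
    have "cycle_integral (G p) (kernel_at a p) = F (G p) (- 1)"
      unfolding F_def
    proof (rule cycle_integral_cong[OF \<Gamma>])
      fix x assume "x \<in> \<Omega>"
      then have x: "x \<noteq> 0" by (rule zero_free_nz)
      show "kernel_at a p x = weight (1 / a) (p / a) x * Phi (- 1) x"
        unfolding weight_target[OF x] kernel_at_def Phi_def sq by simp
    qed
    also have "\<dots> = F_constant a p"
      using p by (intro F_minus_one_value \<Gamma>) (simp add: S_def)
    finally show ?thesis by simp
  qed
  have "p0 islimpt S"
    using p0 S(1) by (intro interior_limit_point) (simp add: interior_open)
  then have "cycle_integral (G p) (kernel_at a p) - F_constant a p = 0"
    using analytic_continuation[OF hol N S(2) _ _ zero p, of p0] p0 S(2) by blast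
  moreover have "cycle_integral \<Gamma> (kernel_at a p) = cycle_integral (G p) (kernel_at a p)"
    by (rule cycle_integral_eq[OF entire[OF p] hol_x[OF p] \<Gamma> G[OF p]])
  ultimately show ?thesis
    by simp
qed

context target_kernel
begin

lemma F_value:
  assumes res: "\<And>j. j > 0 \<Longrightarrow> p ^ j \<noteq> a\<^sup>2" and \<Gamma>: "sep_cycle D \<Gamma>" and z: "z \<noteq> 0"
  shows "F \<Gamma> z = egamma (a ^ 3) p (a ^ 4) / (egamma a p (a ^ 4) * theta (1 / a\<^sup>2) p * qpoch P P *
     qpoch (a\<^sup>2) (a\<^sup>2) * qpoch (- a) a) * (theta z p * theta (z / a) p * theta (z * a) p)"
proof -
  have pn: "p \<in> nonresonant a"
    using res p0 p1 by (simp add: nonresonant_def)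
  have sq: "q = a ^ 4"
    by simp
  have poles: "poles (1 / a) (p / a) = residue_poles a p"
    unfolding poles_target residue_poles_def fun_eq_iff sq by simp
  have "F \<Gamma> (- 1) = cycle_integral \<Gamma> (kernel_at a p)"
    unfolding F_def
  proof (rule cycle_integral_cong[OF \<Gamma>])
    fix x assume "x \<in> \<Omega>"
    then have x: "x \<noteq> 0" by (rule zero_free_nz)
    show "weight (1 / a) (p / a) x * Phi (- 1) x = kernel_at a p x"
      unfolding weight_target[OF x] kernel_at_def Phi_def sq by simp
  qed
  also have "\<dots> = F_constant a p"
    using \<Gamma> unfolding poles by (intro kernel_at_integral a0 a1 pn)
  finally have F1: "F \<Gamma> (- 1) = F_constant a p" .
  have "theta (- (1 / a)) p = theta (- a) p / a"
    using theta_inverse[OF p1, of "- a"] a0 by simp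
  then have nz: "theta (- 1) p * theta (- (1 / a)) p * theta (- a) p \<noteq> 0"
    using nonresonant_theta[OF res] a0 by simp
  have "F \<Gamma> z * (theta (- 1) p * theta (- (1 / a)) p * theta (- a) p) =
         F_constant a p * (theta z p * theta (z / a) p * theta (z * a) p)"
    using F_proportional[OF res \<Gamma> z] F1 by simp
  then have "F \<Gamma> z = F_constant a p * (theta z p * theta (z / a) p * theta (z * a) p) /
      (theta (- 1) p * theta (- (1 / a)) p * theta (- a) p)"
    by (subst nonzero_eq_divide_eq[OF nz])
  then show ?thesis
    using nz unfolding F_constant_def by (simp add: mult_ac)
qed

subsection \<open>The integrand\<close>

text \<open>With \<open>x = e2pi t\<close> and \<open>z = e2pi l\<close>, the integrand of the theorem is \<open>J z x / a ^ 3\<close> away from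
  its removable singularities.\<close>

definition J :: "complex \<Rightarrow> complex \<Rightarrow> complex" where
  "J z x = weight (1 / a) (p / a) x * (theta (x * z) p * theta (- (x\<^sup>2 * p ^ 6 / z ^ 4)) (p ^ 8))"

text \<open>Inverting the cycle in the second integral gives both integrands the factor
  \<open>theta (x * z) p\<close>. With \<open>y = z\<^sup>2 / x\<close> the other theta functions
  are the two halves in the dissection of \<open>theta (- y) P\<close>, because
  \<open>P ^ 4 = p ^ 8\<close>. The weight \<open>z ^ 3\<close> stems from the exponential prefactor
  at \<open>- l\<close>.\<close>

lemma J_antisymmetrization:
  assumes \<Gamma>: "sep_cycle D \<Gamma>" and z: "z \<noteq> 0"
  shows "cycle_integral \<Gamma> (J z) - z ^ 3 * cycle_integral \<Gamma> (J (1 / z)) =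
    qpoch P P / qpoch (p ^ 8) (p ^ 8) * F \<Gamma> z"
proof -
  have p8: "norm (p ^ 8) < 1" "p ^ 8 \<noteq> 0"
    using p0 p1 by (auto simp: norm_power power_less_one_iff)
  have hol: "J z holomorphic_on \<Omega>" if "z \<noteq> 0" for z
  proof -
    have "(\<lambda>x. theta (x * z) p * theta (- (x\<^sup>2 * p ^ 6 / z ^ 4)) (p ^ 8)) holomorphic_on \<Omega>"
      using p0 p1 p8 that zero_free_nz poles_region by (intro holomorphic_intros holomorphic_on_theta) auto
    then show ?thesis
      unfolding J_def[abs_def] by (rule holomorphic_on_mult[rotated]) (intro weight_holomorphic nz_ts)
  qed
  have hol': "(\<lambda>x. J (1 / z) (1 / x)) holomorphic_on \<Omega>"
  proof -
    have "J (1 / z) \<circ> (\<lambda>x. 1 / x) holomorphic_on \<Omega>"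
      using zero_free_nz z by (intro holomorphic_on_compose_gen[OF _ hol] holomorphic_intros) (auto simp: zero_free_def)
    then show ?thesis
      by (simp add: o_def)
  qed
  have "cycle_integral \<Gamma> (J (1 / z)) = cycle_integral \<Gamma> (\<lambda>x. J (1 / z) (1 / x))"
    using z by (intro cycle_integral_inverse[OF poles_entire hol \<Gamma>, symmetric]) simp
  then have "cycle_integral \<Gamma> (J z) - z ^ 3 * cycle_integral \<Gamma> (J (1 / z)) =
      cycle_integral \<Gamma> (J z) + cycle_integral \<Gamma> (\<lambda>x. - (z ^ 3) * J (1 / z) (1 / x))"
    by (simp only: cycle_integral_cmult) simp
  also have "\<dots> = cycle_integral \<Gamma> (\<lambda>x. J z x + - (z ^ 3) * J (1 / z) (1 / x))"
    using hol[OF z] hol' by (intro cycle_integral_add[OF poles_entire \<Gamma>, symmetric] holomorphic_intros)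
  also have "\<dots> = cycle_integral \<Gamma> (\<lambda>x. qpoch P P / qpoch (p ^ 8) (p ^ 8) * (weight (1 / a) (p / a) x * Phi z x))"
  proof (rule cycle_integral_cong[OF \<Gamma>])
    fix x assume "x \<in> \<Omega>"
    then have x: "x \<noteq> 0" by (rule zero_free_nz)
    define y where "y = z\<^sup>2 / x"
    have y: "y \<noteq> 0"
      using x z by (simp add: y_def)
    have e1: "- (x\<^sup>2 * p ^ 6 / z ^ 4) = p ^ 8 / - (P * y\<^sup>2)"
      using x z p0 by (simp add: y_def field_simps power_numeral_reduce power2_eq_square)
    have e2: "- ((1 / x)\<^sup>2 * p ^ 6 / (1 / z) ^ 4) = - (P ^ 3 * y\<^sup>2)"
      using x z by (simp add: y_def field_simps power_numeral_reduce power2_eq_square)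
    have t1: "theta (- (x\<^sup>2 * p ^ 6 / z ^ 4)) (p ^ 8) = theta (- (P * y\<^sup>2)) (p ^ 8)"
      unfolding e1 by (rule theta_reflect[OF p8(2)])
    have t2: "theta (1 / x * (1 / z)) p = - theta (x * z) p / (x * z)"
      using theta_inverse[OF p1, of "x * z"] x z by simp
    have P4: "P ^ 4 = p ^ 8"
      by simp
    have "qpoch P P * theta (- y) P = qpoch (p ^ 8) (p ^ 8) * (theta (- (P * y\<^sup>2)) (p ^ 8) + y * theta (- (P ^ 3 * y\<^sup>2)) (p ^ 8))"
      using theta_dissection[OF P y] unfolding P4 .
    moreover have "qpoch (p ^ 8) (p ^ 8) \<noteq> 0"
      using p8(1) by (simp add: qpoch_nz)
    ultimately have dis: "theta (- (P * y\<^sup>2)) (p ^ 8) + y * theta (- (P ^ 3 * y\<^sup>2)) (p ^ 8) =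
        qpoch P P / qpoch (p ^ 8) (p ^ 8) * theta (- y) P"
      by (simp add: field_simps)
    have "J z x + - (z ^ 3) * J (1 / z) (1 / x) = weight (1 / a) (p / a) x * theta (x * z) p *
        (theta (- (P * y\<^sup>2)) (p ^ 8) + z ^ 3 / (x * z) * theta (- (P ^ 3 * y\<^sup>2)) (p ^ 8))"
      unfolding J_def weight_inverse[OF x] t1 t2 e2 by (simp add: algebra_simps)
    also have "z ^ 3 / (x * z) = y"
      using x z by (simp add: y_def power2_eq_square power3_eq_cube)
    finally show "J z x + - (z ^ 3) * J (1 / z) (1 / x) = qpoch P P / qpoch (p ^ 8) (p ^ 8) * (weight (1 / a) (p / a) x * Phi z x)"
      unfolding dis Phi_def y_def[symmetric] by (simp add: mult_ac)
  qed
  also have "\<dots> = qpoch P P / qpoch (p ^ 8) (p ^ 8) * F \<Gamma> z"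
    by (simp only: cycle_integral_cmult F_def)
  finally show ?thesis .
qed

text \<open>The three denominators at \<open>y = x * a\<close> combine to a gamma function at
  \<open>1 / y\<close>, by reflection and removal of one row of factors in each direction. Together
  with \<open>theta (x / a\<^sup>2) q\<close>, whose argument is inverted using
  \<open>q = a ^ 4\<close>, this leaves the constant \<open>1 / a ^ 3\<close>.\<close>

lemma integrand_eq_J:
  assumes x: "x \<noteq> 0" and nz: "qpoch2 (1 / (x * a)) p q \<noteq> 0" "qpoch (x * a) p \<noteq> 0" "qpoch (x * a) q \<noteq> 0"
  shows "egamma (x / a) p q / egamma (x * a) p q * (theta (x * z) p / theta (x * a) p) *
     (theta (x / a\<^sup>2) q / theta (x * a) q) * theta (- (x\<^sup>2 * p ^ 6 / z ^ 4)) (p ^ 8) = 1 / a ^ 3 * J z x"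
proof -
  define y where "y = x * a"
  define y' where "y' = 1 / y"
  have y: "y \<noteq> 0" "y' \<noteq> 0"
    using x a0 by (auto simp: y_def y'_def)
  have r1: "qpoch2 y p q = qpoch y p * (qpoch (y * q) q * qpoch2 (y * q * p) p q)"
    using qpoch2_rec'[OF p1 q(1), of y] qpoch2_rec[OF p1 q(1), of "y * q"] by simp
  have r2: "qpoch y q = (1 - y) * qpoch (y * q) q"
    by (rule qpoch_rec[OF q(1)])
  have r3: "qpoch2 y' p q = (1 - y') * qpoch (y' * p) p * (qpoch (y' * q) q * qpoch2 (y' * q * p) p q)"
    using qpoch2_rec'[OF p1 q(1), of y'] qpoch2_rec[OF p1 q(1), of "y' * q"] qpoch_rec[OF p1, of y'] by simp
  have n1: "qpoch y p \<noteq> 0" "1 - y \<noteq> 0" "qpoch (y * q) q \<noteq> 0"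
    using nz r2 by (auto simp: y_def)
  have n2: "1 - y' \<noteq> 0" "qpoch (y' * p) p \<noteq> 0" "qpoch (y' * q) q \<noteq> 0" "qpoch2 (y' * q * p) p q \<noteq> 0"
    using nz(1) r3 by (auto simp: y_def y'_def)
  have arg: "p * q / y = y' * q * p" "p / y = y' * p" "q / y = y' * q" "p * q / y' = y * q * p"
    by (simp_all add: y'_def)
  have ratio: "(1 - y') / (1 - y) = - y'"
    using y n1(2) by (simp add: y'_def field_simps)
  have key: "1 / (egamma y p q * theta y p * theta y q) = - y' * egamma y' p q"
  proof -
    have "1 / (egamma y p q * theta y p * theta y q) =
        qpoch2 (y * q * p) p q * ((1 - y') / (1 - y)) /
          ((1 - y') * qpoch (y' * p) p * (qpoch (y' * q) q * qpoch2 (y' * q * p) p q))"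
      unfolding egamma_def theta_def arg r1 r2 using n1 n2 by simp
    also have "\<dots> = - y' * egamma y' p q"
      unfolding ratio egamma_def arg r3[symmetric] by simp
    finally show ?thesis .
  qed
  have "theta (a\<^sup>2 / x) q = theta (a\<^sup>2 * x) q"
    using theta_reflect[OF q(2), of "a\<^sup>2 * x"] a0 by (simp add: power2_eq_square)
  then have th: "theta (x / a\<^sup>2) q = - (x / a\<^sup>2) * theta (a\<^sup>2 * x) q"
    using theta_inverse[OF q(1), of "a\<^sup>2 / x"] x a0 by simp
  have "egamma (x / a) p q / egamma y p q * (theta (x * z) p / theta y p) * (theta (x / a\<^sup>2) q / theta y q) *
     theta (- (x\<^sup>2 * p ^ 6 / z ^ 4)) (p ^ 8) =
     egamma (x / a) p q * theta (x * z) p * theta (x / a\<^sup>2) q * theta (- (x\<^sup>2 * p ^ 6 / z ^ 4)) (p ^ 8) *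
     (1 / (egamma y p q * theta y p * theta y q))"
    by simp
  also have "\<dots> = (y' * (x / a\<^sup>2)) * J z x"
    unfolding key unfolding th J_def weight_target[OF x] y'_def y_def by (simp add: mult_ac)
  also have "y' * (x / a\<^sup>2) = 1 / a ^ 3"
    using x a0 by (simp add: y'_def y_def power2_eq_square power3_eq_cube)
  finally show ?thesis
    by (simp only: y_def)
qed

end

section \<open>Additive notation\<close>

lemma e2pi_add: "e2pi (x + y) = e2pi x * e2pi y"
  by (simp add: e2pi_def distrib_left exp_add)

lemma e2pi_minus: "e2pi (- x) = 1 / e2pi x"
  by (simp add: e2pi_def exp_minus inverse_eq_divide)

lemma e2pi_diff: "e2pi (x - y) = e2pi x / e2pi y"
  using e2pi_add[of x "- y"] by (simp add: e2pi_minus)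

lemma e2pi_mult_of_nat: "e2pi (of_nat n * x) = e2pi x ^ n"
  by (simp add: e2pi_def exp_of_nat_mult[symmetric] mult_ac)

lemma e2pi_numeral: "e2pi (numeral n * x) = e2pi x ^ numeral n"
  using e2pi_mult_of_nat[of "numeral n" x] by simp

lemma e2pi_nz [simp]: "e2pi x \<noteq> 0"
  by (simp add: e2pi_def)

lemma e2pi_half: "e2pi (1 / 2) = - 1"
  using exp_pi_i by (simp add: e2pi_def)

lemma e2pi_eq_1_iff: "e2pi x = 1 \<longleftrightarrow> x \<in> \<int>"
proof
  assume "e2pi x = 1"
  then obtain n :: int where "Re (2 * of_real pi * \<i> * x) = 0" "Im (2 * of_real pi * \<i> * x) = of_int (2 * n) * pi"
    unfolding e2pi_def exp_eq_1 by blast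
  then have "x = of_int n"
    by (simp add: complex_eq_iff)
  then show "x \<in> \<int>" by simp
next
  assume "x \<in> \<int>"
  then obtain n :: int where "x = of_int n"
    by (elim Ints_cases)
  then show "e2pi x = 1"
    unfolding e2pi_def exp_eq_1 by auto
qed

lemma norm_e2pi: "norm (e2pi x) = exp (- (2 * pi * Im x))"
  by (simp add: e2pi_def)

lemma e2pi_norm_less: "Im x > 0 \<Longrightarrow> norm (e2pi x) < 1"
  by (simp add: norm_e2pi)

lemma e2pi_has_derivative: "(e2pi has_field_derivative 2 * of_real pi * \<i> * e2pi x) (at x)"
  unfolding e2pi_def[abs_def] by (auto intro!: derivative_eq_intros)

lemma e2pi_analytic: "e2pi analytic_on UNIV"
  unfolding e2pi_def[abs_def] by (intro analytic_intros)

lemma qprod_eq: "qprod z \<tau> = qpoch (e2pi z) (e2pi \<tau>)"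
  by (simp add: qprod_def qpoch_def e2pi_add e2pi_mult_of_nat)

lemma theta0_eq: "theta0 z \<tau> = theta (e2pi z) (e2pi \<tau>)"
  by (simp add: theta0_def theta_def qprod_eq e2pi_diff)

lemma ell_Gamma_eq:
  assumes "Im \<tau> > 0" "Im \<sigma> > 0"
  shows "ell_Gamma z \<tau> \<sigma> = egamma (e2pi z) (e2pi \<tau>) (e2pi \<sigma>)"
proof -
  have n: "norm (e2pi \<tau>) < 1" "norm (e2pi \<sigma>) < 1"
    using assms by (auto intro: e2pi_norm_less)
  define x p q where "x = e2pi z" and "p = e2pi \<tau>" and "q = e2pi \<sigma>"
  have "ell_Gamma z \<tau> \<sigma> = (\<Prod>n. \<Prod>m. (1 - p * q / x * p ^ n * q ^ m) / (1 - x * p ^ n * q ^ m))"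
    by (simp add: ell_Gamma_def e2pi_add e2pi_diff e2pi_mult_of_nat x_def p_def q_def)
  also have "\<dots> = (\<Prod>n. qpoch (p * q / x * p ^ n) q / qpoch (x * p ^ n) q)"
    unfolding qpoch_def using n
    by (intro prodinf_cong prodinf_divide[symmetric] convergent_prod_qpoch) (simp_all add: q_def)
  also have "\<dots> = egamma x p q"
    unfolding egamma_def qpoch2_def using n
    by (intro prodinf_divide[symmetric] convergent_prod_qpoch2) (simp_all add: q_def p_def)
  finally show ?thesis
    by (simp add: x_def p_def q_def)
qed

lemma contour_integral_cycle_integral:
  assumes "valid_path \<gamma>"
  shows "contour_integral \<gamma> (\<lambda>t. f (e2pi t)) = cycle_integral (e2pi \<circ> \<gamma>) f"
proof -
  have "contour_integral (e2pi \<circ> \<gamma>) (\<lambda>x. f x / x) = contour_integral \<gamma> (\<lambda>t. deriv e2pi t * (f (e2pi t) / e2pi t))"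
    by (rule contour_integral_comp_analyticW[OF e2pi_analytic assms]) auto
  also have "\<dots> = contour_integral \<gamma> (\<lambda>t. (2 * of_real pi * \<i>) * f (e2pi t))"
    by (simp add: DERIV_imp_deriv[OF e2pi_has_derivative] mult.assoc)
  finally show ?thesis
    by (simp add: cycle_integral_def contour_integral_cmult)
qed

text \<open>In the variable \<open>t\<close> these are the zeros of a q-product, that is, integers
  shifted by \<open>d + n * \<sigma>\<close>; such sets contain the points where the integrand takes
  a default value.\<close>

lemma countable_e2pi_orbit: "countable {t. \<exists>n. e2pi t * c * e2pi \<sigma> ^ n = 1}" if "c \<noteq> 0"
proof -
  obtain d where d: "c = e2pi d"
  proof -
    obtain w where "exp w = c"
      using \<open>c \<noteq> 0\<close> by (metis exp_Ln)
    then show thesis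
      by (intro that[of "w / (2 * of_real pi * \<i>)"]) (simp add: e2pi_def)
  qed
  have "{t. \<exists>n. e2pi t * c * e2pi \<sigma> ^ n = 1} \<subseteq> (\<lambda>(n :: nat, m). m - (d + of_nat n * \<sigma>)) ` (UNIV \<times> \<int>)"
  proof
    fix t assume "t \<in> {t. \<exists>n. e2pi t * c * e2pi \<sigma> ^ n = 1}"
    then obtain n where "e2pi (t + (d + of_nat n * \<sigma>)) = 1"
      by (auto simp: d e2pi_add e2pi_mult_of_nat mult.assoc)
    then have "t + (d + of_nat n * \<sigma>) \<in> \<int>"
      by (simp add: e2pi_eq_1_iff)
    then show "t \<in> (\<lambda>(n :: nat, m). m - (d + of_nat n * \<sigma>)) ` (UNIV \<times> \<int>)"
      by (intro image_eqI[of _ _ "(n, t + (d + of_nat n * \<sigma>))"]) auto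
  qed
  moreover have "countable (\<int> :: complex set)"
    by (simp add: Ints_def)
  ultimately show ?thesis
    by (meson countable_SIGMA countable_image countable_subset countableI_type)
qed

theorem theorem2p4:
  fixes \<tau> \<eta> l :: complex and \<gamma> :: "real \<Rightarrow> complex"
  assumes "Im \<tau> > 0" and "Im \<eta> > 0"
    and "\<And>j :: nat. j > 0 \<Longrightarrow> of_nat j * \<tau> - 4 * \<eta> \<notin> \<int>"
    and "separating_cycle \<tau> \<eta> \<gamma>"
  shows "I_anti \<gamma> l \<tau> \<eta> =
    exp (- 12 * of_real pi * \<i> * \<eta>) *
    (ell_Gamma (6 * \<eta>) \<tau> (8 * \<eta>) / ell_Gamma (2 * \<eta>) \<tau> (8 * \<eta>)) *
    (1 / (qprod (8 * \<tau>) (8 * \<tau>) * theta0 (- 4 * \<eta>) \<tau>)) *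
    (1 / (qprod (4 * \<eta>) (4 * \<eta>) * qprod (2 * \<eta> + 1 / 2) (2 * \<eta>))) *
    exp (- 3 * of_real pi * \<i> * l) *
    theta0 l \<tau> * theta0 (l - 2 * \<eta>) \<tau> * theta0 (l + 2 * \<eta>) \<tau>"
proof -
  define p a where "p = e2pi \<tau>" and "a = e2pi (2 * \<eta>)"
  have a_pow: "e2pi (8 * \<eta>) = a ^ 4" "e2pi (4 * \<eta>) = a\<^sup>2" "e2pi (6 * \<eta>) = a ^ 3"
    using e2pi_numeral[of "num.Bit0 (num.Bit0 num.One)" "2 * \<eta>"] e2pi_numeral[of "num.Bit0 num.One" "2 * \<eta>"]
      e2pi_numeral[of "num.Bit1 num.One" "2 * \<eta>"]
    by (simp_all add: a_def)
  have p8: "e2pi (8 * \<tau>) = p ^ 8"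
    by (simp only: p_def e2pi_numeral)
  interpret target_kernel p a
    using assms(1,2) by unfold_locales (auto simp: p_def a_def intro!: e2pi_norm_less)
  have q4: "q = a ^ 4"
    by simp
  have res: "p ^ j \<noteq> a\<^sup>2" if "j > 0" for j
  proof
    assume "p ^ j = a\<^sup>2"
    then have "e2pi (of_nat j * \<tau> - 4 * \<eta>) = 1"
      by (simp add: e2pi_diff e2pi_mult_of_nat a_pow p_def[symmetric] a0)
    then show False
      using assms(3)[OF that] by (simp add: e2pi_eq_1_iff)
  qed
  have \<gamma>: "valid_path \<gamma>" "pathstart \<gamma> = - 1 / 2" "pathfinish \<gamma> = 1 / 2"
    using assms(4) by (auto simp: separating_cycle_def)
  define \<Gamma> where "\<Gamma> = e2pi \<circ> \<gamma>"
  have v\<Gamma>: "valid_path \<Gamma>"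
    unfolding \<Gamma>_def by (rule valid_path_compose_holomorphic[OF \<gamma>(1) analytic_imp_holomorphic[OF e2pi_analytic]]) auto
  have zero: "0 \<notin> path_image \<Gamma>"
    by (auto simp: \<Gamma>_def path_image_compose image_iff)
  have D_zero: "D y = 0 \<longleftrightarrow> (\<exists>j k. y / a * p ^ j * (a ^ 4) ^ k = 1)" for y
    using qpoch2_eq_0_iff[OF p1 q(1), of "y / a"] by (simp add: poles_target)
  have \<Gamma>: "sep_cycle D \<Gamma>"
    unfolding sep_cycle_def
  proof (intro conjI allI impI)
    show "valid_path \<Gamma>" "0 \<notin> path_image \<Gamma>" by fact+
    have "e2pi (- 1 / 2) = e2pi (1 / 2)"
      using e2pi_minus[of "1 / 2"] by (simp add: e2pi_half)
    then show "pathfinish \<Gamma> = pathstart \<Gamma>"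
      by (simp only: \<Gamma>_def pathfinish_compose pathstart_compose \<gamma>(2,3))
    \<comment> \<open>The form \<open>dx / x\<close> pulls back to a multiple of \<open>dt\<close>,
      so the winding number about 0 is the displacement of \<gamma> from \<open>- 1 / 2\<close> to
      \<open>1 / 2\<close>.\<close>
    have "contour_integral \<gamma> (\<lambda>t. 1) = pathfinish \<gamma> - pathstart \<gamma>"
      using \<gamma>(1) by (intro contour_integral_unique contour_integral_primitive[where S = UNIV and f = "\<lambda>t. t"]) auto
    then have "cycle_integral \<Gamma> (\<lambda>x. 1) = 1"
      using contour_integral_cycle_integral[OF \<gamma>(1), of "\<lambda>x. 1"] \<gamma> by (simp add: \<Gamma>_def)
    then show "winding_number \<Gamma> 0 = 1"
      using winding_number_valid_path[OF v\<Gamma> zero] by (simp add: cycle_integral_def)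
    fix y :: complex assume y: "y \<noteq> 0"
    {
      assume "D y = 0"
      then obtain j k where "y / a * p ^ j * (a ^ 4) ^ k = 1"
        unfolding D_zero by blast
      then have "y = a / (p ^ j * (a ^ 4) ^ k)"
        using a0 p0 by (simp add: field_simps)
      also have "\<dots> = e2pi (2 * \<eta> - of_nat j * \<tau> - of_nat k * (8 * \<eta>))"
        by (simp add: e2pi_diff e2pi_mult_of_nat a_pow p_def[symmetric] a_def[symmetric])
      finally have y_eq: "y = e2pi (2 * \<eta> - of_nat j * \<tau> - 8 * of_nat k * \<eta> + of_int 0)"
        by (simp add: mult_ac)
      have "2 * \<eta> - of_nat j * \<tau> - 8 * of_nat k * \<eta> + of_int 0 \<in> first_poles \<tau> \<eta>"
        unfolding first_poles_def by blast
      then have "below_cycle \<gamma> (2 * \<eta> - of_nat j * \<tau> - 8 * of_nat k * \<eta> + of_int 0)"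
        using assms(4) unfolding separating_cycle_def by blast
      then show "y \<notin> path_image \<Gamma>" "winding_number \<Gamma> y = 0"
        unfolding below_cycle_def y_eq[symmetric] \<Gamma>_def by auto
    }
    {
      assume "D (1 / y) = 0"
      then obtain j k where "1 / y / a * p ^ j * (a ^ 4) ^ k = 1"
        unfolding D_zero by blast
      then have "y = 1 / a * p ^ j * (a ^ 4) ^ k"
        using a0 y by (simp add: field_simps)
      also have "\<dots> = e2pi (- (2 * \<eta>) + of_nat j * \<tau> + of_nat k * (8 * \<eta>))"
        by (simp add: e2pi_add e2pi_diff e2pi_minus e2pi_mult_of_nat a_pow p_def[symmetric] a_def[symmetric])
      finally have y_eq: "y = e2pi (- 2 * \<eta> + of_nat j * \<tau> + 8 * of_nat k * \<eta> + of_int 0)"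
        by (simp add: mult_ac)
      have "- 2 * \<eta> + of_nat j * \<tau> + 8 * of_nat k * \<eta> + of_int 0 \<in> second_poles \<tau> \<eta>"
        unfolding second_poles_def by blast
      then have "above_cycle \<gamma> (- 2 * \<eta> + of_nat j * \<tau> + 8 * of_nat k * \<eta> + of_int 0)"
        using assms(4) unfolding separating_cycle_def by blast
      then show "y \<notin> path_image \<Gamma>" "winding_number \<Gamma> y = 1"
        unfolding above_cycle_def y_eq[symmetric] \<Gamma>_def by auto
    }
  qed
  have "Im (8 * \<eta>) > 0"
    using assms(2) by simp
  note eG = ell_Gamma_eq[OF assms(1) this]
  have integral: "contour_integral \<gamma> (integrand \<tau> \<eta> l) = 1 / a ^ 3 * cycle_integral \<Gamma> (J (e2pi l))" for l
  proof -
    \<comment> \<open>Zeros of the q-products in the theta denominators at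
      \<open>t + 2 * \<eta>\<close>. Where such a zero is removable, \<open>integrand\<close>
      evaluates to 0 while \<open>J\<close> has the true limit.\<close>
    define C where "C = {t. \<exists>n. e2pi t * a * e2pi \<tau> ^ n = 1} \<union> {t. \<exists>n. e2pi t * a * e2pi (8 * \<eta>) ^ n = 1}"
    have "countable C"
      unfolding C_def using a0 by (intro countable_Un countable_e2pi_orbit)
    have "contour_integral \<gamma> (integrand \<tau> \<eta> l) = contour_integral \<gamma> (\<lambda>t. 1 / a ^ 3 * J (e2pi l) (e2pi t))"
    proof (rule contour_integral_cong_countable[OF \<gamma>(1) \<open>countable C\<close>])
      fix t assume t: "t \<in> path_image \<gamma> - C"
      define x where "x = e2pi t"
      have "x \<in> path_image \<Gamma>"
        using t by (auto simp: \<Gamma>_def x_def path_image_compose)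
      then have "x \<in> \<Omega>"
        using sep_cycle_zero_free[OF \<Gamma>] by blast
      then have nz1: "qpoch2 (1 / (x * a)) p q \<noteq> 0"
        unfolding zero_free_def poles_target by simp
      have nz2: "qpoch (x * a) p \<noteq> 0" "qpoch (x * a) q \<noteq> 0"
        using t qpoch_eq_0_iff[OF p1, of "x * a"] qpoch_eq_0_iff[OF q(1), of "x * a"]
        by (auto simp: C_def x_def p_def[symmetric] a_pow)
      have "integrand \<tau> \<eta> l t = egamma (x / a) p q / egamma (x * a) p q * (theta (x * e2pi l) p / theta (x * a) p) *
         (theta (x / a\<^sup>2) q / theta (x * a) q) * theta (- (x\<^sup>2 * p ^ 6 / e2pi l ^ 4)) (p ^ 8)"
        unfolding integrand_def eG theta0_eq e2pi_add e2pi_diff a_pow p8 e2pi_half e2pi_numeral[of _ t] e2pi_numeral[of _ \<tau>]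
          e2pi_numeral[of _ l] p_def[symmetric] a_def[symmetric] x_def[symmetric] q4
        by simp
      also have "\<dots> = 1 / a ^ 3 * J (e2pi l) x"
        by (rule integrand_eq_J[OF _ nz1 nz2]) (simp add: x_def)
      finally show "integrand \<tau> \<eta> l t = 1 / a ^ 3 * J (e2pi l) (e2pi t)"
        by (simp only: x_def)
    qed
    also have "\<dots> = 1 / a ^ 3 * cycle_integral \<Gamma> (J (e2pi l))"
      unfolding contour_integral_cmult \<Gamma>_def by (simp only: contour_integral_cycle_integral[OF \<gamma>(1)])
    finally show ?thesis .
  qed
  define z E where "z = e2pi l" and "E = exp (- 3 * of_real pi * \<i> * l)"
  have z: "z \<noteq> 0"
    by (simp add: z_def)
  \<comment> \<open>Reversing the sign of \<open>l\<close> multiplies the prefactor by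
    \<open>e2pi (3 * l)\<close>, which is where \<open>z ^ 3\<close> in
    \<open>J_antisymmetrization\<close> comes from.\<close>
  have E: "exp (- 3 * of_real pi * \<i> * (- l)) = E * z ^ 3"
  proof -
    have "z ^ 3 = exp (2 * of_real pi * \<i> * (3 * l))"
      using e2pi_numeral[of "num.Bit1 num.One" l] unfolding z_def e2pi_def by (rule sym)
    then have "E * z ^ 3 = exp (- 3 * of_real pi * \<i> * l + 2 * of_real pi * \<i> * (3 * l))"
      unfolding E_def by (simp only: exp_add)
    also have "- 3 * of_real pi * \<i> * l + 2 * of_real pi * \<i> * (3 * l) = - 3 * of_real pi * \<i> * (- l)"
      by (simp add: algebra_simps)
    finally show ?thesis by (rule sym)
  qed
  have "I_anti \<gamma> l \<tau> \<eta> = E / a ^ 3 * (cycle_integral \<Gamma> (J z) - z ^ 3 * cycle_integral \<Gamma> (J (1 / z)))"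
    unfolding I_anti_def I_tilde_def integral E E_def[symmetric] z_def[symmetric] e2pi_minus
    by (simp add: algebra_simps)
  also have "\<dots> = E / a ^ 3 * (qpoch P P / qpoch (p ^ 8) (p ^ 8) * F \<Gamma> z)"
    by (simp only: J_antisymmetrization[OF \<Gamma> z])
  also have "\<dots> = 1 / a ^ 3 * (egamma (a ^ 3) p (a ^ 4) / egamma a p (a ^ 4)) * (1 / (qpoch (p ^ 8) (p ^ 8) * theta (1 / a\<^sup>2) p)) *
      (1 / (qpoch (a\<^sup>2) (a\<^sup>2) * qpoch (- a) a)) * E * theta z p * theta (z / a) p * theta (z * a) p"
  proof -
    have "qpoch P P \<noteq> 0"
      using P by (simp only: qpoch_nz not_False_eq_True)
    then show ?thesis
      by (subst F_value[OF res \<Gamma> z]) (simp_all add: mult_ac)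
  qed
  also have "1 / a ^ 3 = exp (- 12 * of_real pi * \<i> * \<eta>)"
    unfolding a_pow(3)[symmetric] e2pi_def by (simp add: exp_minus field_simps)
  finally show ?thesis
    unfolding eG theta0_eq qprod_eq e2pi_add e2pi_diff a_pow p8 e2pi_half E_def z_def p_def[symmetric] a_def[symmetric]
    using e2pi_minus[of "4 * \<eta>"] by (simp add: a_pow)
qed

end
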